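(* Let $\Omega=(0,1)^2$ with the uniform structured meshes described in the context. Assume that $a\in C^2(\overline\Omega)$ with $a(\mathbf{x})\ge a_0>0$, that $\vec\beta\in C^1(\overline\Omega)$ is a vector field with $\operatorname{div}\vec\beta\ge0$ pointwise in $\Omega$, and that $f\in L^2(\Omega)$. Let $\{\mathrm{Im}(A_n(a,\vec\beta))\}$ and $\{P_n(a)\}$ be the Hermitian matrix sequences defined in the context. Then the sequence $\{P_n^{-1}(a)\,\mathrm{Im}(A_n(a,\vec\beta))\}$ is spectrally bounded (there is a constant independent of $n$ bounding the moduli of all its eigenvalues, for every $n$) and is properly clustered at $0$ with respect to the eigenvalues.
   Context: Mesh: for each integer $m\ge1$, $[0,1]^2$ is divided into $(m+1)^2$ equal squares of side $1/(m+1)$ and each square is divided into two triangles by a diagonal, all diagonals being parallel to one fixed direction. The mesh is denoted $\mathcal{T}_h$, with $h$ the maximum diameter of its triangles; $n=n(h)=m^2$ is the number of internal nodes, and the matrix sequences are indexed by these $n$ as $m\to\infty$. Let $\varphi_1,\dots,\varphi_n$ be the nodal basis of the continuous piecewise linear functions on $\mathcal{T}_h$ vanishing on $\partial\Omega$ ($\varphi_i$ equals $1$ at internal node $i$ and $0$ at every other node). Matrices (arising from the finite element approximation of $\operatorname{div}(-a\nabla u+\vec\beta u)=f$ in $\Omega$, $u=0$ on $\partial\Omega$): $A_n(a,\vec\beta)=\Theta_n(a)+\Psi_n(\vec\beta)\in\mathbb{R}^{n\times n}$ with $$(\Theta_n(a))_{i,j}=\int_\Omega a\,\nabla\varphi_i\cdot\nabla\varphi_j,\qquad(\Psi_n(\vec\beta))_{i,j}=-\int_\Omega(\nabla\varphi_i\cdot\vec\beta)\,\varphi_j.$$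 With $\mathrm{i}^2=-1$, $\mathrm{Im}(A_n(a,\vec\beta))=\frac{1}{2\mathrm{i}}(A_n(a,\vec\beta)-A_n(a,\vec\beta)^T)=\frac{1}{2\mathrm{i}}(\Psi_n(\vec\beta)-\Psi_n^T(\vec\beta))$, a Hermitian matrix. The preconditioner is $$P_n(a)=D_n^{1/2}(a)\,A_n(1,0)\,D_n^{1/2}(a),\qquad D_n(a)=\mathrm{diag}(A_n(a,0))\,\mathrm{diag}^{-1}(A_n(1,0)),$$ where $\mathrm{diag}(X)$ is the diagonal matrix with the same main diagonal as $X$, so that $A_n(a,0)=\Theta_n(a)$ and $A_n(1,0)=\Theta_n(1)$. Clustering: a sequence $\{X_n\}$ of matrices of increasing dimension $n$ is properly (or strongly) clustered at $p$ if for any $\varepsilon>0$ the number of eigenvalues of $X_n$ not belonging to $(p-\varepsilon,p+\varepsilon)$ can be bounded by a constant possibly depending on $\varepsilon$ but not on $n$. *)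

theory Defs
  imports
    "HOL-Analysis.Analysis"
    "HOL-Computational_Algebra.Fundamental_Theorem_Algebra"
    "Jordan_Normal_Form.Char_Poly"
    "Jordan_Normal_Form.Gauss_Jordan_Elimination"
begin

section \<open>Regularity up to the boundary\<close>

(* f is in C^k of the closure of an open S if f and its derivatives up to order k, which
   exist in S, extend continuously to the closure.  Derivatives are bounded linear maps, so
   that C2 can be stated as "the derivative is C1". *)

definition C1_closure ::
    "'a::euclidean_space set \<Rightarrow> ('a \<Rightarrow> 'b::real_normed_vector) \<Rightarrow> bool" where
  "C1_closure S f \<longleftrightarrow> continuous_on (closure S) f \<and>
     (\<exists>f' :: 'a \<Rightarrow> 'a \<Rightarrow>\<^sub>L 'b. continuous_on (closure S) f' \<and>
        (\<forall>x\<in>S. (f has_derivative blinfun_apply (f' x)) (at x)))"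

definition C2_closure ::
    "'a::euclidean_space set \<Rightarrow> ('a \<Rightarrow> 'b::real_normed_vector) \<Rightarrow> bool" where
  "C2_closure S f \<longleftrightarrow> continuous_on (closure S) f \<and>
     (\<exists>f' :: 'a \<Rightarrow> 'a \<Rightarrow>\<^sub>L 'b. C1_closure S f' \<and>
        (\<forall>x\<in>S. (f has_derivative blinfun_apply (f' x)) (at x)))"

definition square_integrable_on :: "('a::euclidean_space \<Rightarrow> real) \<Rightarrow> 'a set \<Rightarrow> bool" where
  "square_integrable_on f S \<longleftrightarrow>
     set_borel_measurable lebesgue S f \<and> set_integrable lebesgue S (\<lambda>x. (f x)\<^sup>2)"

(* Where f is not differentiable, grad f has an unspecified value that does not depend on the
   point.  For the piecewise linear functions below this happens only on mesh edges, which
   form a null set. *)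
definition grad :: "('a::real_inner \<Rightarrow> real) \<Rightarrow> 'a \<Rightarrow> 'a" where
  "grad f x = (THE D. GDERIV f x :> D)"

definition div_field :: "('a::euclidean_space \<Rightarrow> 'a) \<Rightarrow> 'a \<Rightarrow> real" where
  "div_field b x = (\<Sum>e\<in>Basis. inner (frechet_derivative b (at x) e) e)"


section \<open>Meshes and finite element spaces\<close>

definition Omega :: "(real \<times> real) set" where
  "Omega = {0<..<1} \<times> {0<..<1}"

(* The common direction of all diagonals: (1,1) or (1,-1). *)
datatype diagonal = Rising | Falling

definition grid_point :: "nat \<Rightarrow> nat \<Rightarrow> nat \<Rightarrow> real \<times> real" where
  "grid_point m k l = (real k / real (m + 1), real l / real (m + 1))"

fun cell_triangles :: "diagonal \<Rightarrow> nat \<Rightarrow> nat \<Rightarrow> nat \<Rightarrow> (real \<times> real) set set" where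
  "cell_triangles Rising m k l =
     {convex hull {grid_point m k l, grid_point m (k+1) l, grid_point m (k+1) (l+1)},
      convex hull {grid_point m k l, grid_point m k (l+1), grid_point m (k+1) (l+1)}}"
| "cell_triangles Falling m k l =
     {convex hull {grid_point m k l, grid_point m (k+1) l, grid_point m k (l+1)},
      convex hull {grid_point m (k+1) l, grid_point m k (l+1), grid_point m (k+1) (l+1)}}"

definition mesh :: "diagonal \<Rightarrow> nat \<Rightarrow> (real \<times> real) set set" where
  "mesh d m = (\<Union>k\<in>{..m}. \<Union>l\<in>{..m}. cell_triangles d m k l)"

(* Continuous piecewise linear functions vanishing on the boundary.  They live on the closed
   square; as HOL functions are total, they are extended by zero, so that each is determined
   by its values on the square. *)
definition fe_space :: "diagonal \<Rightarrow> nat \<Rightarrow> (real \<times> real \<Rightarrow> real) set" where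
  "fe_space d m =
     {v. continuous_on (closure Omega) v \<and>
         (\<forall>T\<in>mesh d m. \<exists>c b. \<forall>x\<in>T. v x = inner c x + b) \<and>
         (\<forall>x. x \<notin> Omega \<longrightarrow> v x = 0)}"

(* Internal nodes, numbered lexicographically by 0, ..., m^2 - 1. *)
definition node :: "nat \<Rightarrow> nat \<Rightarrow> real \<times> real" where
  "node m i = grid_point m (i mod m + 1) (i div m + 1)"

(* The value 0 at boundary nodes is already part of fe_space. *)
definition hat :: "diagonal \<Rightarrow> nat \<Rightarrow> nat \<Rightarrow> real \<times> real \<Rightarrow> real" where
  "hat d m i = (THE v. v \<in> fe_space d m \<and>
                  (\<forall>j<m\<^sup>2. v (node m j) = (if j = i then 1 else 0)))"


section \<open>Finite element matrices and the preconditioner\<close>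

definition Theta_mat :: "diagonal \<Rightarrow> nat \<Rightarrow> (real \<times> real \<Rightarrow> real) \<Rightarrow> real mat" where
  "Theta_mat d m a = Matrix.mat (m\<^sup>2) (m\<^sup>2) (\<lambda>(i, j).
     LINT x:Omega|lebesgue. a x * inner (grad (hat d m i) x) (grad (hat d m j) x))"

definition Psi_mat ::
    "diagonal \<Rightarrow> nat \<Rightarrow> (real \<times> real \<Rightarrow> real \<times> real) \<Rightarrow> real mat" where
  "Psi_mat d m \<beta> = Matrix.mat (m\<^sup>2) (m\<^sup>2) (\<lambda>(i, j).
     - (LINT x:Omega|lebesgue. inner (grad (hat d m i) x) (\<beta> x) * hat d m j x))"

definition A_mat :: "diagonal \<Rightarrow> nat \<Rightarrow> (real \<times> real \<Rightarrow> real) \<Rightarrow>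
    (real \<times> real \<Rightarrow> real \<times> real) \<Rightarrow> real mat" where
  "A_mat d m a \<beta> = Theta_mat d m a + Psi_mat d m \<beta>"

(* For a real matrix the adjoint is the transpose. *)
definition Im_mat :: "real mat \<Rightarrow> complex mat" where
  "Im_mat A = (1 / (2 * \<i>)) \<cdot>\<^sub>m map_mat complex_of_real (A - transpose_mat A)"

definition diag_part :: "'a::zero mat \<Rightarrow> 'a mat" where
  "diag_part A = mat_diag (dim_row A) (\<lambda>i. A $$ (i, i))"

(* Square root of a diagonal matrix with nonnegative diagonal. *)
definition diag_sqrt :: "real mat \<Rightarrow> real mat" where
  "diag_sqrt D = mat_diag (dim_row D) (\<lambda>i. sqrt (D $$ (i, i)))"

(* Meaningful only for invertible matrices. *)
abbreviation inv_mat :: "'a::field mat \<Rightarrow> 'a mat" where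
  "inv_mat A \<equiv> the (mat_inverse A)"

definition D_mat :: "diagonal \<Rightarrow> nat \<Rightarrow> (real \<times> real \<Rightarrow> real) \<Rightarrow> real mat" where
  "D_mat d m a =
     diag_part (A_mat d m a (\<lambda>_. 0)) * inv_mat (diag_part (A_mat d m (\<lambda>_. 1) (\<lambda>_. 0)))"

definition P_mat :: "diagonal \<Rightarrow> nat \<Rightarrow> (real \<times> real \<Rightarrow> real) \<Rightarrow> real mat" where
  "P_mat d m a =
     diag_sqrt (D_mat d m a) * A_mat d m (\<lambda>_. 1) (\<lambda>_. 0) * diag_sqrt (D_mat d m a)"

definition precond_Im_mat :: "diagonal \<Rightarrow> (real \<times> real \<Rightarrow> real) \<Rightarrow>
    (real \<times> real \<Rightarrow> real \<times> real) \<Rightarrow> nat \<Rightarrow> complex mat" where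
  "precond_Im_mat d a \<beta> m =
     map_mat complex_of_real (inv_mat (P_mat d m a)) * Im_mat (A_mat d m a \<beta>)"


section \<open>Spectral boundedness and clustering\<close>

(* Matrix sequences are indexed by m = 1, 2, ..., the m-th matrix having dimension m^2. *)

definition spectrally_bounded :: "(nat \<Rightarrow> complex mat) \<Rightarrow> bool" where
  "spectrally_bounded X \<longleftrightarrow>
     (\<exists>C. \<forall>m\<ge>1. \<forall>z. eigenvalue (X m) z \<longrightarrow> cmod z \<le> C)"

(* Eigenvalues are counted with algebraic multiplicity. *)
definition eigenvalues_outside :: "complex mat \<Rightarrow> real \<Rightarrow> real \<Rightarrow> nat" where
  "eigenvalues_outside A p \<epsilon> =
     size {#z \<in># proots (char_poly A). z \<notin> complex_of_real ` {p - \<epsilon> <..< p + \<epsilon>}#}"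

definition properly_clustered_at :: "(nat \<Rightarrow> complex mat) \<Rightarrow> real \<Rightarrow> bool" where
  "properly_clustered_at X p \<longleftrightarrow>
     (\<forall>\<epsilon>>0. \<exists>C. \<forall>m\<ge>1. eigenvalues_outside (X m) p \<epsilon> \<le> C)"

end

theory Submission
  imports Defs "Jordan_Normal_Form.Jordan_Normal_Form_Existence"
begin

text \<open>
  Write \<open>n = m\<^sup>2\<close>, \<open>N = m + 1\<close>, and for a real vector \<open>c\<close> let \<open>u\<^sub>c\<close> be the finite element function with
  nodal values \<open>c\<close>.  The eigenvalues of \<open>P\<^sup>-\<^sup>1 Im(A)\<close> are those of the pencil formed by the Hermitian
  matrix \<open>Im(A)\<close> and the positive definite matrix \<open>P\<close>, so they are governed by the quotient of the
  two quadratic forms.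

  At \<open>v = x + i y\<close> the form of \<open>P\<close> is \<open>D(s x) + D(s y)\<close>, where \<open>D(c)\<close> is the Dirichlet energy of \<open>u\<^sub>c\<close> and
  \<open>s\<close> is the diagonal of the square root of \<open>D_mat\<close>.  In the form of \<open>Im(A)\<close> the symmetric stiffness
  matrix cancels and \<open>\<psi>(x, y) - \<psi>(y, x)\<close> remains, with \<open>\<psi>(x, y) = - \<integral> (\<nabla>u\<^sub>x \<bullet> \<beta>) u\<^sub>y\<close>
  (\<open>herm_form_Im_A_mat\<close>).  Only one derivative occurs in \<open>\<psi>\<close>; hence, if the
  \<open>L\<^sup>2\<close> norms of \<open>u\<^sub>x\<close> and \<open>u\<^sub>y\<close> are at most a multiple \<open>t\<close> of their energy norms, then the form of
  \<open>Im(A)\<close> is at most a multiple of \<open>t\<close> of the energy (\<open>Psi_form_bound\<close>).  The weights \<open>s\<close> do no harm: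
  \<open>s\<^sub>i\<^sup>2\<close> is a local average of \<open>a\<close>, so \<open>s\<close> is bounded below and changes by \<open>O(1/N)\<close> between
  neighbouring nodes, and the energy of \<open>u\<^sub>x\<close> is bounded by that of \<open>u\<^sub>s\<^sub>x\<close>
  (\<open>energy_le_scaled_energy\<close>).  Together this is the key estimate \<open>Im_form_bound\<close>.

  Spectral boundedness is the case of the Poincare inequality with zero boundary values, which gives
  a fixed \<open>t\<close>.  For clustering, group the nodes into \<open>K \<times> K\<close> blocks.  A grid function whose sum over
  each block vanishes satisfies the Poincare inequality with the block diameter as constant
  (\<open>block_poincare\<close>), so \<open>t = 3/K\<close> is possible.  The vanishing of the block sums amounts to \<open>K\<^sup>2\<close>
  linear constraints, a number independent of \<open>m\<close>, and the quotient is smaller than \<open>\<epsilon>\<close> on the subspace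
  that they define once \<open>K\<close> is large.  By the Courant-Fischer argument at most \<open>K\<^sup>2\<close> eigenvalues are
  \<open>\<ge> \<epsilon>\<close> and at most \<open>K\<^sup>2\<close> are \<open>\<le> -\<epsilon>\<close> (\<open>eigenvalues_of_pencil_outside_bound\<close>).

  All energies and norms are compared with sums over the nodal values: the gradient on a triangle
  consists of the two difference quotients along its legs, so that the Dirichlet energy is comparable
  to the sum of the squared differences along the edges of the square grid, for both directions of
  the diagonals.
\<close>

section \<open>Eigenvalues of Hermitian pencils\<close>

lemma homogeneous_system_nontrivial_solution:
  fixes M :: "nat \<Rightarrow> nat \<Rightarrow> 'a::field"
  assumes "finite I" and "r < card I"
  shows "\<exists>c. (\<exists>j\<in>I. c j \<noteq> 0) \<and> (\<forall>j. j \<notin> I \<longrightarrow> c j = 0) \<and> (\<forall>i<r. (\<Sum>j\<in>I. M i j * c j) = 0)"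
proof -
  define k where "k = card I"
  obtain f where f: "bij_betw f {..<k} I"
    using ex_bij_betw_nat_finite[OF assms(1)] unfolding k_def by (auto simp: atLeast0LessThan)
  define A where "A = Matrix.mat k k (\<lambda>(i, j). if i < r then M i (f j) else 0)"
  have A: "A \<in> carrier_mat k k" by (simp add: A_def)
  \<comment> \<open>the square matrix \<open>A\<close> of the constraints, padded by zero rows, has a zero row \<open>r\<close> and is singular\<close>
  have "transpose_mat A *\<^sub>v unit_vec k r = 0\<^sub>v k"
    using assms(2) unfolding k_def[symmetric]
    by (intro eq_vecI) (simp_all add: A_def scalar_prod_right_unit)
  moreover have "unit_vec k r \<noteq> (0\<^sub>v k :: 'a Matrix.vec)"
    using assms(2) unfolding k_def[symmetric] by (simp add: unit_vec_nonzero)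
  ultimately have "Determinant.det (transpose_mat A) = 0"
    unfolding det_0_iff_vec_prod_zero_field[OF transpose_carrier_mat[THEN iffD2, OF A]]
    by (intro exI[of _ "unit_vec k r"]) simp
  then have "Determinant.det A = 0" by (simp add: Determinant.det_transpose[OF A])
  then obtain v where v: "v \<in> carrier_vec k" "v \<noteq> 0\<^sub>v k" "A *\<^sub>v v = 0\<^sub>v k"
    using det_0_iff_vec_prod_zero_field[OF A] by auto
  define c where "c j = (if j \<in> I then vec_index v (the_inv_into {..<k} f j) else 0)" for j
  have cf: "c (f i) = vec_index v i" if "i < k" for i
  proof -
    have "f i \<in> I" using f that by (auto simp: bij_betw_def)
    moreover have "the_inv_into {..<k} f (f i) = i"
      using f that by (intro the_inv_into_f_f) (auto simp: bij_betw_def)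
    ultimately show ?thesis by (simp add: c_def)
  qed
  from v obtain i where i: "i < k" "vec_index v i \<noteq> 0" by (metis eq_vecI index_zero_vec carrier_vecD)
  have "(\<Sum>j\<in>I. M i j * c j) = 0" if "i < r" for i
  proof -
    have ik: "i < k" using that assms(2) by (simp add: k_def)
    have "(\<Sum>j\<in>I. M i j * c j) = (\<Sum>j<k. M i (f j) * c (f j))"
      by (rule sum.reindex_bij_betw[OF f, symmetric])
    also have "\<dots> = (\<Sum>j\<in>{0..<k}. A $$ (i, j) * vec_index v j)"
      using ik that by (intro sum.cong) (auto simp: A_def cf)
    also have "\<dots> = vec_index (A *\<^sub>v v) i"
      using ik v(1) A by (simp add: scalar_prod_def)
    finally show ?thesis using v(3) ik by simp
  qed
  moreover have "\<exists>j\<in>I. c j \<noteq> 0"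
  proof
    show "f i \<in> I" using f i(1) by (auto simp: bij_betw_def)
    show "c (f i) \<noteq> 0" using i cf by simp
  qed
  moreover have "\<forall>j. j \<notin> I \<longrightarrow> c j = 0" by (simp add: c_def)
  ultimately show ?thesis by (intro exI[of _ c]) simp
qed

text \<open>For the diagonalization below only the shape of a Jordan matrix matters: a nonzero superdiagonal entry
  lies inside one block, hence joins equal eigenvalues.\<close>

lemma jordan_matrix_entries:
  assumes "i < sum_list (map fst n_as)" "j < sum_list (map fst n_as)"
  shows "(i \<noteq> j \<and> Suc i \<noteq> j \<longrightarrow> jordan_matrix n_as $$ (i, j) = 0) \<and>
    (Suc i = j \<and> jordan_matrix n_as $$ (i, j) \<noteq> 0 \<longrightarrow>
       jordan_matrix n_as $$ (i, i) = jordan_matrix n_as $$ (j, j))"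
  using assms
proof (induction n_as arbitrary: i j)
  case Nil then show ?case by simp
next
  case (Cons na n_as)
  obtain n a where na: "na = (n, a)" by force
  show ?case
  proof (cases "n \<le> i \<and> n \<le> j")
    case True
    then obtain i' j' where "i = n + i'" "j = n + j'" by (auto simp: le_iff_add)
    then show ?thesis
      using Cons.prems Cons.IH[of i' j'] by (simp add: na jordan_matrix_Cons)
  next
    case False
    then show ?thesis using Cons.prems by (auto simp: na jordan_matrix_Cons)
  qed
qed

definition herm_form :: "nat \<Rightarrow> complex mat \<Rightarrow> (nat \<Rightarrow> complex) \<Rightarrow> complex" where
  "herm_form n M v = (\<Sum>i<n. \<Sum>j<n. cnj (v i) * M $$ (i, j) * v j)"

definition hermitian_mat :: "nat \<Rightarrow> complex mat \<Rightarrow> bool" where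
  "hermitian_mat n M \<longleftrightarrow> M \<in> carrier_mat n n \<and> (\<forall>i<n. \<forall>j<n. M $$ (j, i) = cnj (M $$ (i, j)))"

lemma hermitian_matD:
  assumes "hermitian_mat n M"
  shows "M \<in> carrier_mat n n" and "i < n \<Longrightarrow> j < n \<Longrightarrow> cnj (M $$ (i, j)) = M $$ (j, i)"
  using assms unfolding hermitian_mat_def by metis+

definition positive_definite_form :: "nat \<Rightarrow> complex mat \<Rightarrow> bool" where
  "positive_definite_form n M \<longleftrightarrow> (\<forall>v. (\<exists>i<n. v i \<noteq> 0) \<longrightarrow> 0 < Re (herm_form n M v))"

lemma positive_definite_formD:
  "positive_definite_form n M \<Longrightarrow> \<exists>i<n. v i \<noteq> 0 \<Longrightarrow> 0 < Re (herm_form n M v)"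
  by (simp add: positive_definite_form_def)

definition conj_transpose :: "complex mat \<Rightarrow> complex mat" where
  "conj_transpose Q = Matrix.mat (dim_col Q) (dim_row Q) (\<lambda>(i, j). cnj (Q $$ (j, i)))"

lemma congruence_entry:
  assumes "Q \<in> carrier_mat n n" "M \<in> carrier_mat n n" "i < n" "j < n"
  shows "(conj_transpose Q * M * Q) $$ (i, j) =
    (\<Sum>p<n. \<Sum>q<n. cnj (Q $$ (p, i)) * M $$ (p, q) * Q $$ (q, j))"
proof -
  have "(conj_transpose Q * M * Q) $$ (i, j)
      = (\<Sum>q<n. (\<Sum>p<n. cnj (Q $$ (p, i)) * M $$ (p, q)) * Q $$ (q, j))"
    using assms by (simp add: conj_transpose_def scalar_prod_def atLeast0LessThan carrier_matD)
  then show ?thesis by (simp add: sum_distrib_right) (rule sum.swap)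
qed

lemma sum_times_sum:
  fixes f g :: "'b \<Rightarrow> 'a::semiring_0"
  shows "sum f I * m * sum g J = (\<Sum>i\<in>I. \<Sum>j\<in>J. f i * m * g j)"
  by (simp only: sum_distrib_right[where r=m] sum_product)

lemma herm_form_congruence:
  assumes "Q \<in> carrier_mat n n" "M \<in> carrier_mat n n"
  shows "herm_form n M (\<lambda>p. \<Sum>k<n. Q $$ (p, k) * c k) = herm_form n (conj_transpose Q * M * Q) c"
proof -
  let ?t = "\<lambda>i j p q. cnj (c i) * (cnj (Q $$ (p, i)) * M $$ (p, q) * Q $$ (q, j)) * c j"
  have "herm_form n M (\<lambda>p. \<Sum>k<n. Q $$ (p, k) * c k) =
     (\<Sum>p<n. \<Sum>q<n. \<Sum>i<n. \<Sum>j<n. ?t i j p q)"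
    unfolding herm_form_def cnj_sum complex_cnj_mult sum_times_sum
    by (intro sum.cong refl) (simp only: mult_ac)
  also have "\<dots> = (\<Sum>p<n. \<Sum>i<n. \<Sum>q<n. \<Sum>j<n. ?t i j p q)"
    by (rule sum.cong[OF refl]) (rule sum.swap)
  also have "\<dots> = (\<Sum>p<n. \<Sum>i<n. \<Sum>j<n. \<Sum>q<n. ?t i j p q)"
    by (rule sum.cong[OF refl], rule sum.cong[OF refl]) (rule sum.swap)
  also have "\<dots> = (\<Sum>i<n. \<Sum>p<n. \<Sum>j<n. \<Sum>q<n. ?t i j p q)"
    by (rule sum.swap)
  also have "\<dots> = (\<Sum>i<n. \<Sum>j<n. \<Sum>p<n. \<Sum>q<n. ?t i j p q)"
    by (rule sum.cong[OF refl]) (rule sum.swap)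
  also have "\<dots> = herm_form n (conj_transpose Q * M * Q) c"
    unfolding herm_form_def
    by (intro sum.cong refl) (simp only: congruence_entry[OF assms] lessThan_iff sum_distrib_left sum_distrib_right)
  finally show ?thesis .
qed

lemma hermitian_congruence:
  assumes "Q \<in> carrier_mat n n" "hermitian_mat n M"
  shows "hermitian_mat n (conj_transpose Q * M * Q)"
proof -
  note M = hermitian_matD(1)[OF assms(2)]
  have "(conj_transpose Q * M * Q) $$ (j, i) = cnj ((conj_transpose Q * M * Q) $$ (i, j))" if "i < n" "j < n" for i j
  proof -
    have "(\<Sum>p<n. \<Sum>q<n. cnj (Q $$ (p, j)) * M $$ (p, q) * Q $$ (q, i))
        = (\<Sum>q<n. \<Sum>p<n. cnj (cnj (Q $$ (q, i)) * M $$ (q, p) * Q $$ (p, j)))"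
      by (subst sum.swap, intro sum.cong refl)
         (simp add: hermitian_matD(2)[OF assms(2)] mult_ac)
    then show ?thesis by (simp add: congruence_entry[OF assms(1) M] that)
  qed
  moreover have "conj_transpose Q * M * Q \<in> carrier_mat n n"
    using assms(1) by (intro mult_carrier_mat[of _ n n] M) (auto simp: conj_transpose_def)
  ultimately show ?thesis unfolding hermitian_mat_def by blast
qed

lemma herm_form_unit_vec:
  assumes "i < n"
  shows "herm_form n M (\<lambda>k. if k = i then 1 else 0) = M $$ (i, i)"
proof -
  have "herm_form n M (\<lambda>k. if k = i then 1 else 0)
      = (\<Sum>p<n. \<Sum>q<n. if p = i then (if q = i then M $$ (i, i) else 0) else 0)"
    unfolding herm_form_def by (intro sum.cong) auto
  also have "\<dots> = (\<Sum>p<n. if p = i then M $$ (i, i) else 0)"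
    using assms by (intro sum.cong) auto
  finally show ?thesis using assms by simp
qed

lemma proots_char_poly_similar_jordan:
  fixes A :: "complex mat"
  assumes sim: "similar_mat A (jordan_matrix n_as)" and A: "A \<in> carrier_mat n n"
  shows "proots (char_poly A) = mset (map (\<lambda>i. jordan_matrix n_as $$ (i, i)) [0..<n])"
proof -
  let ?J = "jordan_matrix n_as"
  from similar_matD[OF sim] A have "?J \<in> carrier_mat n n" by auto
  then have n: "sum_list (map fst n_as) = n" by (metis carrier_matD(1) jordan_matrix_dim(1))
  have ut: "upper_triangular ?J"
    using jordan_matrix_upper_triangular[of _ n_as] by (auto simp: upper_triangular_def)
  have "char_poly A = (\<Prod>a\<leftarrow>diag_mat ?J. [:- a, 1:])"
    using char_poly_similar[OF sim] char_poly_upper_triangular[OF _ ut, of n] n by auto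
  also have "proots \<dots> = sum_list (map proots (map (\<lambda>a. [:- a, 1:]) (diag_mat ?J)))"
  proof -
    have "0 \<notin> set (map (\<lambda>a. [:- a, 1:]) (diag_mat ?J))" by auto
    from proots_prod_list[OF this] show ?thesis by simp
  qed
  also have "\<dots> = mset (diag_mat ?J)"
  proof -
    have "proots [:- a, 1:] = {#a#}" for a :: complex
      using proots_linear_factor[of "- a"] by simp
    then have "sum_list (map proots (map (\<lambda>a. [:- a, 1:]) xs)) = mset xs" for xs :: "complex list"
      by (induction xs) simp_all
    then show ?thesis .
  qed
  finally show ?thesis by (simp add: diag_mat_def n)
qed

text \<open>If \<open>P A\<close> is Hermitian, then \<open>A\<close> is self-adjoint for the inner product of \<open>P\<close>, so its Jordan form \<open>J\<close> is
  diagonal and real.  With \<open>A = Q J Q\<^sup>-\<^sup>1\<close> and \<open>G = Q\<^sup>* P Q\<close> the matrix \<open>G J = Q\<^sup>* B Q\<close> is Hermitian; a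
  superdiagonal entry in column \<open>i + 1\<close> of \<open>J\<close>, where column \<open>i\<close> is already diagonal, would force
  \<open>G\<^sub>i\<^sub>i = 0\<close>.  The columns of \<open>Q\<close> need not be orthogonal within an eigenspace; that \<open>G\<close> couples only
  equal eigenvalues is enough for what follows.\<close>

lemma pencil_diagonalization:
  assumes P: "hermitian_mat n P" and B: "hermitian_mat n B"
    and pos: "positive_definite_form n P"
    and A: "A \<in> carrier_mat n n" and PA: "P * A = B"
  obtains Q G :: "complex mat" and l :: "nat \<Rightarrow> real"
  where "Q \<in> carrier_mat n n"
    and "\<And>c. \<exists>i<n. c i \<noteq> 0 \<Longrightarrow> \<exists>p<n. (\<Sum>k<n. Q $$ (p, k) * c k) \<noteq> 0"
    and "proots (char_poly A) = mset (map (\<lambda>i. complex_of_real (l i)) [0..<n])"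
    and "\<And>c. herm_form n P (\<lambda>p. \<Sum>k<n. Q $$ (p, k) * c k)
            = (\<Sum>i<n. \<Sum>j<n. cnj (c i) * G $$ (i, j) * c j)"
    and "\<And>c. herm_form n B (\<lambda>p. \<Sum>k<n. Q $$ (p, k) * c k)
            = (\<Sum>i<n. \<Sum>j<n. cnj (c i) * G $$ (i, j) * (of_real (l j) * c j))"
    and "\<And>i j. i < n \<Longrightarrow> j < n \<Longrightarrow> l i \<noteq> l j \<Longrightarrow> G $$ (i, j) = 0"
proof -
  have Pc: "P \<in> carrier_mat n n" and Bc: "B \<in> carrier_mat n n" using P B by (simp_all add: hermitian_matD(1))
  obtain as where "char_poly A = (\<Prod>a\<leftarrow>as. [:- a, 1:])" using char_poly_factorized[OF A] by auto
  from jordan_nf_exists[OF A this] obtain n_as where "jordan_nf A n_as" by blast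
  then have sim: "similar_mat A (jordan_matrix n_as)" by (simp add: jordan_nf_def)
  define J where "J = jordan_matrix n_as"
  from sim obtain Q R where "similar_mat_wit A J Q R" by (auto simp: similar_mat_def J_def)
  then have J: "J \<in> carrier_mat n n" and Q: "Q \<in> carrier_mat n n" and R: "R \<in> carrier_mat n n"
    and RQ: "R * Q = 1\<^sub>m n" and AQ: "A = Q * J * R"
    using A by (auto simp: similar_mat_wit_def Let_def)
  have n: "sum_list (map fst n_as) = n" using J by (metis carrier_matD(1) jordan_matrix_dim(1) J_def)
  let ?H = "conj_transpose Q"
  have H: "?H \<in> carrier_mat n n" using Q by (auto simp: conj_transpose_def)
  define G where "G = ?H * P * Q"
  have G: "hermitian_mat n G" unfolding G_def by (rule hermitian_congruence[OF Q P])
  note Gc = hermitian_matD(1)[OF G]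
  have "A * Q = Q * J * (R * Q)" unfolding AQ using Q J R by (simp add: assoc_mult_mat[of _ n n _ n _ n])
  then have "A * Q = Q * J" using RQ Q J by simp
  then have "G * J = ?H * P * (A * Q)" unfolding G_def using H Pc Q J by (simp add: assoc_mult_mat[of _ n n _ n _ n])
  also have "\<dots> = ?H * B * Q" unfolding PA[symmetric] using H Pc Q A by (simp add: assoc_mult_mat[of _ n n _ n _ n])
  finally have GJ: "G * J = ?H * B * Q" .
  have K: "hermitian_mat n (G * J)" unfolding GJ by (rule hermitian_congruence[OF Q B])
  have inj: "\<exists>p<n. (\<Sum>k<n. Q $$ (p, k) * c k) \<noteq> 0" if c: "\<exists>i<n. c i \<noteq> 0" for c
  proof (rule ccontr)
    assume "\<not> ?thesis"
    then have "Q *\<^sub>v Matrix.vec n c = 0\<^sub>v n"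
      using Q by (auto intro!: eq_vecI simp: scalar_prod_def atLeast0LessThan)
    then have "(R * Q) *\<^sub>v Matrix.vec n c = 0\<^sub>v n"
      using R Q by (simp add: assoc_mult_mat_vec[of R n n Q n]) (intro eq_vecI; simp)
    then have "Matrix.vec n c = 0\<^sub>v n" by (simp add: RQ)
    then show False using c by (metis index_vec index_zero_vec(1))
  qed
  have Gpos: "0 < Re (G $$ (i, i))" if "i < n" for i
  proof -
    let ?e = "\<lambda>k. if k = i then 1 else 0 :: complex"
    have "0 < Re (herm_form n P (\<lambda>p. \<Sum>k<n. Q $$ (p, k) * ?e k))"
      by (rule positive_definite_formD[OF pos inj]) (use that in auto)
    then show ?thesis
      unfolding herm_form_congruence[OF Q Pc] G_def[symmetric] herm_form_unit_vec[OF that] .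
  qed
  have Gsym: "G $$ (j, i) = cnj (G $$ (i, j))" if "i < n" "j < n" for i j
    using hermitian_matD(2)[OF G that] ..
  have Ksym: "(G * J) $$ (j, i) = cnj ((G * J) $$ (i, j))" if "i < n" "j < n" for i j
    using hermitian_matD(2)[OF K that] ..
  have Kentry: "(G * J) $$ (i, j) = (\<Sum>k<n. G $$ (i, k) * J $$ (k, j))" if "i < n" "j < n" for i j
    using Gc J that by (simp add: scalar_prod_def atLeast0LessThan)
  have Jz: "J $$ (i, j) = 0" if "i < n" "j < n" "i \<noteq> j" "Suc i \<noteq> j" for i j
    using jordan_matrix_entries[of i n_as j] that n by (auto simp: J_def)
  have Jd: "J $$ (i, Suc i) = 0 \<or> J $$ (i, i) = J $$ (Suc i, Suc i)" if "Suc i < n" for i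
    using jordan_matrix_entries[of i n_as "Suc i"] that n by (auto simp: J_def)
  have real_if: "J $$ (j, j) = cnj (J $$ (j, j))"
    if j: "j < n" and col: "\<And>k. k < n \<Longrightarrow> k \<noteq> j \<Longrightarrow> J $$ (k, j) = 0" for j
  proof -
    have "(G * J) $$ (j, j) = (\<Sum>k<n. if k = j then G $$ (j, j) * J $$ (j, j) else 0)"
      unfolding Kentry[OF j j] by (intro sum.cong) (use col in auto)
    then have e: "(G * J) $$ (j, j) = G $$ (j, j) * J $$ (j, j)" using j by simp
    have "G $$ (j, j) * J $$ (j, j) = cnj (G $$ (j, j) * J $$ (j, j))"
      using Ksym[OF j j] unfolding e .
    then have "G $$ (j, j) * J $$ (j, j) = G $$ (j, j) * cnj (J $$ (j, j))"
      using Gsym[OF j j] by simp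
    then show ?thesis using Gpos[OF j] by auto
  qed
  \<comment> \<open>induction over the columns: compare the entries \<open>(i, i + 1)\<close> and \<open>(i + 1, i)\<close> of the Hermitian matrix \<open>G J\<close>\<close>
  have sup: "J $$ (i, Suc i) = 0" if "Suc i < n" for i
    using that
  proof (induction i rule: less_induct)
    case (less i)
    have i: "i < n" and si: "Suc i < n" using less.prems by auto
    have col: "J $$ (k, i) = 0" if "k < n" "k \<noteq> i" for k
      using that less.IH[of k] Jz[of k i] i by (cases "Suc k = i") auto
    have real: "J $$ (i, i) = cnj (J $$ (i, i))" by (rule real_if[OF i col])
    show ?case
    proof (rule ccontr)
      assume nz: "J $$ (i, Suc i) \<noteq> 0"
      with Jd[OF si] have eq: "J $$ (Suc i, Suc i) = J $$ (i, i)" by auto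
      have "(G * J) $$ (Suc i, i) = (\<Sum>k<n. if k = i then G $$ (Suc i, i) * J $$ (i, i) else 0)"
        unfolding Kentry[OF si i] by (intro sum.cong) (use col in auto)
      then have 1: "(G * J) $$ (Suc i, i) = G $$ (Suc i, i) * J $$ (i, i)" using i by simp
      have "(G * J) $$ (i, Suc i) = (\<Sum>k<n. (if k = i then G $$ (i, i) * J $$ (i, Suc i) else 0)
              + (if k = Suc i then G $$ (i, Suc i) * J $$ (i, i) else 0))"
        unfolding Kentry[OF i si] by (intro sum.cong) (use Jz[of _ "Suc i"] si eq in auto)
      then have 2: "(G * J) $$ (i, Suc i) = G $$ (i, i) * J $$ (i, Suc i) + G $$ (i, Suc i) * J $$ (i, i)"
        using i si by (simp add: sum.distrib)
      have "(G * J) $$ (i, Suc i) = G $$ (i, Suc i) * J $$ (i, i)"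
        using Ksym[OF si i] Gsym[OF si i] real unfolding 1 by simp
      with 2 have "G $$ (i, i) * J $$ (i, Suc i) = 0" by simp
      then show False using nz Gpos[OF i] by auto
    qed
  qed
  have offdiag: "J $$ (k, j) = 0" if "k < n" "j < n" "k \<noteq> j" for k j
    using Jz[OF that] sup[of k] that by auto
  define l where "l i = Re (J $$ (i, i))" for i
  have Jl: "J $$ (i, i) = of_real (l i)" if "i < n" for i
    using real_if[OF that] offdiag that unfolding l_def by (metis Reals_cnj_iff of_real_Re)
  have Kl: "(G * J) $$ (i, j) = G $$ (i, j) * of_real (l j)" if "i < n" "j < n" for i j
  proof -
    have "(G * J) $$ (i, j) = (\<Sum>k<n. if k = j then G $$ (i, j) * of_real (l j) else 0)"
      unfolding Kentry[OF that] by (intro sum.cong) (use offdiag Jl that in auto)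
    then show ?thesis using that by simp
  qed
  show ?thesis
  proof (rule that[of Q l G])
    show "Q \<in> carrier_mat n n" by (rule Q)
    show "\<exists>p<n. (\<Sum>k<n. Q $$ (p, k) * c k) \<noteq> 0" if "\<exists>i<n. c i \<noteq> 0" for c
      by (rule inj[OF that])
    show "proots (char_poly A) = mset (map (\<lambda>i. complex_of_real (l i)) [0..<n])"
    proof -
      have "map (\<lambda>i. jordan_matrix n_as $$ (i, i)) [0..<n] = map (\<lambda>i. complex_of_real (l i)) [0..<n]"
        using Jl by (simp add: J_def)
      then show ?thesis by (simp only: proots_char_poly_similar_jordan[OF sim A])
    qed
    show "herm_form n P (\<lambda>p. \<Sum>k<n. Q $$ (p, k) * c k)
            = (\<Sum>i<n. \<Sum>j<n. cnj (c i) * G $$ (i, j) * c j)" for c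
      unfolding herm_form_congruence[OF Q Pc] G_def[symmetric] by (simp add: herm_form_def)
    show "herm_form n B (\<lambda>p. \<Sum>k<n. Q $$ (p, k) * c k)
            = (\<Sum>i<n. \<Sum>j<n. cnj (c i) * G $$ (i, j) * (of_real (l j) * c j))" for c
      unfolding herm_form_congruence[OF Q Bc] GJ[symmetric] herm_form_def[of n "G * J" c]
      by (intro sum.cong refl) (simp add: Kl)
    show "G $$ (i, j) = 0" if "i < n" "j < n" "l i \<noteq> l j" for i j
    proof -
      have "G $$ (j, i) * of_real (l i) = cnj (G $$ (i, j)) * of_real (l j)"
        using Ksym[OF that(1,2)] Kl that by simp
      then have "G $$ (j, i) * of_real (l i) = G $$ (j, i) * of_real (l j)"
        using Gsym[OF that(1,2)] by simp
      then have "G $$ (j, i) = 0" using that(3) by simp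
      then show ?thesis using Gsym[of j i] that by simp
    qed
  qed
qed

text \<open>The Courant-Fischer argument.  If more than \<open>r\<close> eigenvalues were \<open>\<ge> e\<close>, the span of their eigenvectors
  would contain a nonzero vector \<open>v\<close> satisfying the \<open>r\<close> constraints.  On this span \<open>B - e P\<close> is
  nonnegative: since \<open>G\<close> couples only equal eigenvalues \<open>l\<close>, the form \<open>B - e P\<close> at coordinates \<open>c\<close> is the
  form \<open>P\<close> at coordinates \<open>sqrt(l - e) c\<close>.  This contradicts the smallness of \<open>B\<close> on the
  constrained vectors.  The eigenvalues \<open>\<le> -e\<close> are treated in the same way through a sign \<open>s\<close>.\<close>

lemma eigenvalues_of_pencil_outside_bound:
  assumes P: "hermitian_mat n P" and B: "hermitian_mat n B"
    and pos: "positive_definite_form n P"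
    and A: "A \<in> carrier_mat n n" and PA: "P * A = B"
    and small: "\<And>v. \<lbrakk>\<exists>i<n. v i \<noteq> 0; \<And>p. p < r \<Longrightarrow> (\<Sum>j<n. L p j * v j) = 0\<rbrakk> \<Longrightarrow>
       cmod (herm_form n B v) < e * Re (herm_form n P v)"
  shows "eigenvalues_outside A 0 e \<le> 2 * r"
proof -
  obtain Q G l
    where Q: "Q \<in> carrier_mat n n"
      and inj: "\<And>c. \<exists>i<n. c i \<noteq> 0 \<Longrightarrow> \<exists>p<n. (\<Sum>k<n. Q $$ (p, k) * c k) \<noteq> 0"
      and ev: "proots (char_poly A) = mset (map (\<lambda>i. complex_of_real (l i)) [0..<n])"
      and fP: "\<And>c. herm_form n P (\<lambda>p. \<Sum>k<n. Q $$ (p, k) * c k)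
              = (\<Sum>i<n. \<Sum>j<n. cnj (c i) * G $$ (i, j) * c j)"
      and fB: "\<And>c. herm_form n B (\<lambda>p. \<Sum>k<n. Q $$ (p, k) * c k)
              = (\<Sum>i<n. \<Sum>j<n. cnj (c i) * G $$ (i, j) * (of_real (l j) * c j))"
      and blk: "\<And>i j. i < n \<Longrightarrow> j < n \<Longrightarrow> l i \<noteq> l j \<Longrightarrow> G $$ (i, j) = 0"
    by (rule pencil_diagonalization[OF P B pos A PA]) (rule that; assumption)
  have Pnn: "0 \<le> Re (\<Sum>i<n. \<Sum>j<n. cnj (c i) * G $$ (i, j) * c j)" for c
  proof (cases "\<exists>i<n. c i \<noteq> 0")
    case True
    from positive_definite_formD[OF pos inj[OF this]] show ?thesis by (simp add: fP)
  qed auto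
  have card_le: "card {i. i < n \<and> e \<le> s * l i} \<le> r" (is "card ?I \<le> r") if s: "s = 1 \<or> s = - 1" for s :: real
  proof (rule ccontr)
    assume "\<not> card ?I \<le> r"
    then have "finite ?I" "r < card ?I" by simp_all
    from homogeneous_system_nontrivial_solution[OF this,
        of "\<lambda>p k. \<Sum>j<n. L p j * Q $$ (j, k)"]
    obtain c where c: "\<exists>j\<in>?I. c j \<noteq> 0" "\<forall>j. j \<notin> ?I \<longrightarrow> c j = 0"
      "\<forall>p<r. (\<Sum>k\<in>?I. (\<Sum>j<n. L p j * Q $$ (j, k)) * c k) = 0" by blast
    define v where "v p = (\<Sum>k<n. Q $$ (p, k) * c k)" for p
    have v: "v = (\<lambda>p. \<Sum>k<n. Q $$ (p, k) * c k)" by (rule ext) (rule v_def)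
    have formP: "herm_form n P v = (\<Sum>i<n. \<Sum>j<n. cnj (c i) * G $$ (i, j) * c j)"
      unfolding v by (rule fP)
    have formB: "herm_form n B v = (\<Sum>i<n. \<Sum>j<n. cnj (c i) * G $$ (i, j) * (of_real (l j) * c j))"
      unfolding v by (rule fB)
    have nz: "\<exists>i<n. v i \<noteq> 0" unfolding v_def by (rule inj) (use c(1) in auto)
    have "(\<Sum>j<n. L p j * v j) = 0" if "p < r" for p
    proof -
      have "(\<Sum>j<n. L p j * v j) = (\<Sum>j<n. \<Sum>k<n. L p j * Q $$ (j, k) * c k)"
        by (simp add: v_def sum_distrib_left mult.assoc)
      also have "\<dots> = (\<Sum>k<n. \<Sum>j<n. L p j * Q $$ (j, k) * c k)" by (rule sum.swap)
      also have "\<dots> = (\<Sum>k<n. (\<Sum>j<n. L p j * Q $$ (j, k)) * c k)" by (simp add: sum_distrib_right)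
      also have "\<dots> = (\<Sum>k\<in>?I. (\<Sum>j<n. L p j * Q $$ (j, k)) * c k)"
        by (rule sum.mono_neutral_right) (use c(2) in auto)
      finally show ?thesis using c(3) that by simp
    qed
    from small[OF nz this] have lt: "cmod (herm_form n B v) < e * Re (herm_form n P v)" .
    \<comment> \<open>outside the chosen eigenvalues \<open>c\<close> vanishes, so negative radicands do no harm\<close>
    define d where "d i = of_real (sqrt (s * l i - e)) * c i" for i
    have "Re (\<Sum>i<n. \<Sum>j<n. cnj (d i) * G $$ (i, j) * d j)
        = s * Re (herm_form n B v) - e * Re (herm_form n P v)"
    proof -
      have summand: "cnj (d i) * G $$ (i, j) * d j =
          of_real s * (cnj (c i) * G $$ (i, j) * (of_real (l j) * c j)) - of_real e * (cnj (c i) * G $$ (i, j) * c j)"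
        if ij: "i < n" "j < n" for i j
      proof (cases "c i = 0 \<or> l i \<noteq> l j")
        case True
        then show ?thesis
        proof
          assume "c i = 0"
          then show ?thesis by (simp add: d_def)
        next
          assume "l i \<noteq> l j"
          then show ?thesis by (simp add: blk[OF ij])
        qed
      next
        case False
        then have lj: "l j = l i" by simp
        from False c(2) have "i \<in> ?I" by blast
        then have "sqrt (s * l i - e) * sqrt (s * l i - e) = s * l i - e" by simp
        then have "complex_of_real (sqrt (s * l i - e)) * of_real (sqrt (s * l i - e)) = of_real (s * l i - e)"
          unfolding of_real_mult[symmetric] by (simp only:)
        moreover have "cnj (d i) * G $$ (i, j) * d j = (of_real (sqrt (s * l i - e)) * of_real (sqrt (s * l i - e)))
           * (cnj (c i) * G $$ (i, j) * c j)"
          unfolding d_def lj complex_cnj_mult complex_cnj_complex_of_real by (simp only: mult_ac)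
        ultimately have "cnj (d i) * G $$ (i, j) * d j = of_real (s * l i - e) * (cnj (c i) * G $$ (i, j) * c j)"
          by (simp only:)
        also have "\<dots> = of_real s * (cnj (c i) * G $$ (i, j) * (of_real (l j) * c j))
            - of_real e * (cnj (c i) * G $$ (i, j) * c j)"
          unfolding lj of_real_diff of_real_mult by (simp only: left_diff_distrib right_diff_distrib mult_ac)
        finally show ?thesis .
      qed
      have "(\<Sum>i<n. \<Sum>j<n. cnj (d i) * G $$ (i, j) * d j)
          = (\<Sum>i<n. \<Sum>j<n. of_real s * (cnj (c i) * G $$ (i, j) * (of_real (l j) * c j))
              - of_real e * (cnj (c i) * G $$ (i, j) * c j))"
        by (intro sum.cong refl summand) simp_all
      also have "\<dots> = of_real s * herm_form n B v - of_real e * herm_form n P v"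
        unfolding formP formB by (simp only: sum_distrib_left sum_subtractf)
      finally show ?thesis by simp
    qed
    with Pnn[of d] have "e * Re (herm_form n P v) \<le> s * Re (herm_form n B v)" by simp
    also have "\<dots> \<le> cmod (herm_form n B v)"
      using s abs_Re_le_cmod[of "herm_form n B v"] by auto
    finally show False using lt by simp
  qed
  have "eigenvalues_outside A 0 e
      = length (filter (\<lambda>z. z \<notin> complex_of_real ` {- e<..<e}) (map (\<lambda>i. complex_of_real (l i)) [0..<n]))"
    unfolding eigenvalues_outside_def ev by (simp only: mset_filter[symmetric] size_mset diff_0 add_0_left)
  also have "\<dots> = length (filter (\<lambda>i. \<not> (- e < l i \<and> l i < e)) [0..<n])"
    unfolding filter_map length_map by (intro arg_cong[where f=length] filter_cong) auto
  also have "\<dots> = card {i. i < n \<and> \<not> (- e < l i \<and> l i < e)}"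
    unfolding length_filter_conv_card by (intro arg_cong[where f=card]) auto
  also have "\<dots> \<le> card ({i. i < n \<and> e \<le> 1 * l i} \<union> {i. i < n \<and> e \<le> - 1 * l i})"
    by (rule card_mono) auto
  also have "\<dots> \<le> card {i. i < n \<and> e \<le> 1 * l i} + card {i. i < n \<and> e \<le> - 1 * l i}" by (rule card_Un_le)
  also have "\<dots> \<le> r + r" by (intro add_mono card_le) auto
  finally show ?thesis by simp
qed

lemma eigenvalue_of_pencil_bound:
  assumes P: "P \<in> carrier_mat n n"
    and pos: "positive_definite_form n P"
    and A: "A \<in> carrier_mat n n" and PA: "P * A = B"
    and bound: "\<And>v. cmod (herm_form n B v) \<le> C * Re (herm_form n P v)"
    and z: "eigenvalue A z"
  shows "cmod z \<le> C"
proof -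
  from z obtain w where w: "w \<in> carrier_vec n" "w \<noteq> 0\<^sub>v n" "A *\<^sub>v w = z \<cdot>\<^sub>v w"
    unfolding eigenvalue_def eigenvector_def carrier_matD(1)[OF A] by blast
  define v where "v i = vec_index w i" for i
  have nz: "\<exists>i<n. v i \<noteq> 0" using w unfolding v_def by (metis eq_vecI index_zero_vec carrier_vecD)
  have eq: "B *\<^sub>v w = z \<cdot>\<^sub>v (P *\<^sub>v w)"
    unfolding PA[symmetric] using P A w by (simp add: assoc_mult_mat_vec[of P n n A n] mult_mat_vec)
  have form: "herm_form n M v = (\<Sum>i<n. cnj (v i) * vec_index (M *\<^sub>v w) i)" if "M \<in> carrier_mat n n" for M
    unfolding herm_form_def using that w(1)
    by (intro sum.cong refl) (simp add: v_def scalar_prod_def atLeast0LessThan sum_distrib_left mult.assoc)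
  have Bc: "B \<in> carrier_mat n n" using P A PA by auto
  have "herm_form n B v = z * herm_form n P v"
    unfolding form[OF Bc] form[OF P] eq sum_distrib_left
    by (intro sum.cong refl) (use P in simp)
  then have "cmod z * cmod (herm_form n P v) \<le> C * Re (herm_form n P v)"
    using bound[of v] by (simp add: norm_mult)
  moreover have "cmod z * Re (herm_form n P v) \<le> cmod z * cmod (herm_form n P v)"
    by (intro mult_left_mono complex_Re_le_cmod) auto
  ultimately have "cmod z * Re (herm_form n P v) \<le> C * Re (herm_form n P v)" by linarith
  then show ?thesis using positive_definite_formD[OF pos nz] by simp
qed

section \<open>Discrete Poincare inequalities on a square grid\<close>

text \<open>An edge between two cells contributes to both of them.  The diagonals do not enter, so that the same
  quantity serves both of their directions.\<close>

definition cell_energy :: "(nat \<Rightarrow> nat \<Rightarrow> real) \<Rightarrow> nat \<Rightarrow> nat \<Rightarrow> real" where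
  "cell_energy c k l =
     (c (Suc k) l - c k l)\<^sup>2 + (c (Suc k) (Suc l) - c k (Suc l))\<^sup>2 +
     (c k (Suc l) - c k l)\<^sup>2 + (c (Suc k) (Suc l) - c (Suc k) l)\<^sup>2"

definition grid_energy :: "nat \<Rightarrow> (nat \<Rightarrow> nat \<Rightarrow> real) \<Rightarrow> real" where
  "grid_energy m c = (\<Sum>k\<le>m. \<Sum>l\<le>m. cell_energy c k l)"

text \<open>The points with an index \<open>m + 1\<close> are left out: the grid functions of interest vanish there.\<close>

definition grid_sumsq :: "nat \<Rightarrow> (nat \<Rightarrow> nat \<Rightarrow> real) \<Rightarrow> real" where
  "grid_sumsq m c = (\<Sum>k\<le>m. \<Sum>l\<le>m. (c k l)\<^sup>2)"

definition zero_boundary :: "nat \<Rightarrow> (nat \<Rightarrow> nat \<Rightarrow> real) \<Rightarrow> bool" where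
  "zero_boundary m c \<longleftrightarrow> (\<forall>k l. \<not> (1 \<le> k \<and> k \<le> m \<and> 1 \<le> l \<and> l \<le> m) \<longrightarrow> c k l = 0)"

lemma grid_energy_nonneg: "0 \<le> grid_energy m c"
  unfolding grid_energy_def cell_energy_def by (intro sum_nonneg add_nonneg_nonneg) auto

lemma edge_sums_le_grid_energy:
  "(\<Sum>k\<le>m. \<Sum>l\<le>m. (c (Suc k) l - c k l)\<^sup>2) + (\<Sum>k\<le>m. \<Sum>l\<le>m. (c k (Suc l) - c k l)\<^sup>2)
    \<le> grid_energy m c"
  unfolding grid_energy_def sum.distrib[symmetric]
  by (intro sum_mono) (simp add: cell_energy_def)

text \<open>Cauchy-Schwarz for a telescoping sum.  The sum on the right runs over all of \<open>I\<close>, so that it does not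
  depend on \<open>k\<close> and \<open>k'\<close>.\<close>

lemma telescope_square_le:
  fixes f :: "nat \<Rightarrow> real"
  assumes "finite I" "card I \<le> b" "k \<le> k'" "{k..<k'} \<subseteq> I"
  shows "(f k' - f k)\<^sup>2 \<le> real b * (\<Sum>j\<in>I. (f (Suc j) - f j)\<^sup>2)"
proof -
  have "f k' - f k = (\<Sum>j=k..<k'. f (Suc j) - f j)"
    using assms(3) by (simp add: sum_Suc_diff')
  then have "(f k' - f k)\<^sup>2 \<le> (\<Sum>j=k..<k'. (f (Suc j) - f j)\<^sup>2) * real (card {k..<k'})"
    using sum_squared_le_sum_of_squares[of "\<lambda>j. f (Suc j) - f j" "{k..<k'}"] by simp
  also have "\<dots> \<le> (\<Sum>j\<in>I. (f (Suc j) - f j)\<^sup>2) * real b"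
  proof (rule mult_mono)
    show "(\<Sum>j=k..<k'. (f (Suc j) - f j)\<^sup>2) \<le> (\<Sum>j\<in>I. (f (Suc j) - f j)\<^sup>2)"
      by (rule sum_mono2) (use assms in auto)
    have "card {k..<k'} \<le> card I" by (rule card_mono) (use assms in auto)
    then show "real (card {k..<k'}) \<le> real b" using assms(2) by linarith
  qed (auto intro!: sum_nonneg)
  finally show ?thesis by (simp only: mult.commute)
qed

text \<open>Sum the differences along each row, starting from the boundary value 0.\<close>

lemma grid_poincare:
  assumes "zero_boundary m c"
  shows "grid_sumsq m c \<le> (real (m + 1))\<^sup>2 * grid_energy m c"
proof -
  let ?H = "\<lambda>l. \<Sum>j\<le>m. (c (Suc j) l - c j l)\<^sup>2"
  have "(c k l)\<^sup>2 \<le> real (m + 1) * ?H l" if "k \<le> m" for k l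
  proof -
    have "c 0 l = 0" using assms by (simp add: zero_boundary_def)
    moreover have "{0..<k} \<subseteq> {..m}" using that by auto
    ultimately show ?thesis
      using telescope_square_le[of "{..m}" "m + 1" 0 k "\<lambda>j. c j l"] by simp
  qed
  then have "grid_sumsq m c \<le> (\<Sum>k\<le>m. \<Sum>l\<le>m. real (m + 1) * ?H l)"
    unfolding grid_sumsq_def by (intro sum_mono) auto
  also have "\<dots> = (real (m + 1))\<^sup>2 * (\<Sum>l\<le>m. ?H l)"
    by (simp add: sum_distrib_left power2_eq_square mult.assoc)
  also have "(\<Sum>l\<le>m. ?H l) = (\<Sum>j\<le>m. \<Sum>l\<le>m. (c (Suc j) l - c j l)\<^sup>2)"
    by (rule sum.swap)
  also have "\<dots> \<le> grid_energy m c"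
  proof -
    have "0 \<le> (\<Sum>k\<le>m. \<Sum>l\<le>m. (c k (Suc l) - c k l)\<^sup>2)" by (intro sum_nonneg) auto
    then show ?thesis using edge_sums_le_grid_energy[where c=c and m=m] by linarith
  qed
  finally show ?thesis by (simp add: mult_left_mono)
qed

lemma interval_oscillation:
  fixes f :: "nat \<Rightarrow> real"
  assumes "finite I" "card I \<le> b" "k \<in> I" "k' \<in> I"
    and "\<And>i j. i \<in> I \<Longrightarrow> j \<in> I \<Longrightarrow> {i..<j} \<subseteq> I"
  shows "(f k - f k')\<^sup>2 \<le> real b * (\<Sum>j\<in>I. (f (Suc j) - f j)\<^sup>2)"
proof (cases "k \<le> k'")
  case True
  have "(f k' - f k)\<^sup>2 \<le> real b * (\<Sum>j\<in>I. (f (Suc j) - f j)\<^sup>2)"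
    by (rule telescope_square_le) (use assms True in auto)
  then show ?thesis by (simp only: power2_commute)
next
  case False
  show ?thesis by (rule telescope_square_le) (use assms False in auto)
qed

text \<open>As the mean over the block vanishes, \<open>\<Sum> (c - a)\<^sup>2\<close> is smallest at \<open>a = 0\<close>.  Averaging over \<open>a = c k' l'\<close>
  bounds \<open>\<Sum> c\<^sup>2\<close> by the mean square difference of two values in the block, and two points of the block are
  joined by a path that moves first within a row and then within a column.\<close>

lemma block_poincare_single:
  fixes c :: "nat \<Rightarrow> nat \<Rightarrow> real"
  assumes I: "finite I" "card I \<le> b" "\<And>i j. i \<in> I \<Longrightarrow> j \<in> I \<Longrightarrow> {i..<j} \<subseteq> I"
    and J: "finite J" "card J \<le> b" "\<And>i j. i \<in> J \<Longrightarrow> j \<in> J \<Longrightarrow> {i..<j} \<subseteq> J"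
    and zero: "(\<Sum>k\<in>I. \<Sum>l\<in>J. c k l) = 0"
  shows "(\<Sum>k\<in>I. \<Sum>l\<in>J. (c k l)\<^sup>2) \<le> 2 * (real b)\<^sup>2 *
    ((\<Sum>k\<in>I. \<Sum>l\<in>J. (c (Suc k) l - c k l)\<^sup>2) + (\<Sum>k\<in>I. \<Sum>l\<in>J. (c k (Suc l) - c k l)\<^sup>2))"
proof (cases "I = {} \<or> J = {}")
  case True
  then show ?thesis by auto
next
  case False
  define H where "H l = (\<Sum>j\<in>I. (c (Suc j) l - c j l)\<^sup>2)" for l
  define V where "V k = (\<Sum>j\<in>J. (c k (Suc j) - c k j)\<^sup>2)" for k
  let ?S = "\<Sum>k\<in>I. \<Sum>l\<in>J. (c k l)\<^sup>2"
  have VH: "0 \<le> (\<Sum>l\<in>J. H l)" "0 \<le> (\<Sum>k\<in>I. V k)"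
    unfolding H_def V_def by (intro sum_nonneg; simp)+
  have shift: "?S \<le> (\<Sum>k\<in>I. \<Sum>l\<in>J. (c k l - a)\<^sup>2)" for a
  proof -
    have "(\<Sum>k\<in>I. \<Sum>l\<in>J. (c k l - a)\<^sup>2)
        = (\<Sum>k\<in>I. \<Sum>l\<in>J. (c k l)\<^sup>2 - 2 * a * c k l + a\<^sup>2)"
      by (intro sum.cong refl) (simp add: power2_diff)
    also have "\<dots> = ?S - 2 * a * (\<Sum>k\<in>I. \<Sum>l\<in>J. c k l) + real (card I) * (real (card J) * a\<^sup>2)"
      by (simp add: sum.distrib sum_subtractf sum_distrib_left)
    finally show ?thesis using zero by simp
  qed
  have diff: "(c k l - c k' l')\<^sup>2 \<le> 2 * real b * (H l + V k')"
    if "k \<in> I" "k' \<in> I" "l \<in> J" "l' \<in> J" for k k' l l'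
  proof -
    have 1: "(c k l - c k' l)\<^sup>2 \<le> real b * H l"
      unfolding H_def by (rule interval_oscillation[of I b k k' "\<lambda>j. c j l"]) (use I that in auto)
    have 2: "(c k' l - c k' l')\<^sup>2 \<le> real b * V k'"
      unfolding V_def by (rule interval_oscillation[of J b l l' "\<lambda>j. c k' j"]) (use J that in auto)
    have "0 \<le> ((c k l - c k' l) - (c k' l - c k' l'))\<^sup>2" by simp
    then have "(c k l - c k' l')\<^sup>2 \<le> 2 * (c k l - c k' l)\<^sup>2 + 2 * (c k' l - c k' l')\<^sup>2"
      by (simp add: power2_eq_square algebra_simps)
    with 1 2 show ?thesis by (simp add: algebra_simps)
  qed
  have "real (card I) * (real (card J) * ?S) = (\<Sum>k'\<in>I. \<Sum>l'\<in>J. ?S)" by simp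
  also have "\<dots> \<le> (\<Sum>k'\<in>I. \<Sum>l'\<in>J. \<Sum>k\<in>I. \<Sum>l\<in>J. (c k l - c k' l')\<^sup>2)"
    by (intro sum_mono shift)
  also have "\<dots> \<le> (\<Sum>k'\<in>I. \<Sum>l'\<in>J. \<Sum>k\<in>I. \<Sum>l\<in>J. 2 * real b * (H l + V k'))"
    by (intro sum_mono diff)
  also have "\<dots> = 2 * real b * (real (card I) * real (card J) * (real (card I) * (\<Sum>l\<in>J. H l)
       + real (card J) * (\<Sum>k\<in>I. V k)))"
    by (simp add: sum.distrib algebra_simps flip: sum_distrib_left sum_distrib_right)
  finally have "real (card I) * (real (card J) * ?S) \<le> real (card I) * (real (card J) *
      (2 * real b * (real (card I) * (\<Sum>l\<in>J. H l) + real (card J) * (\<Sum>k\<in>I. V k))))"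
    by (simp add: algebra_simps)
  moreover have "0 < real (card I)" "0 < real (card J)" using False I(1) J(1) by (auto simp: card_gt_0_iff)
  ultimately have "?S \<le> 2 * real b * (real (card I) * (\<Sum>l\<in>J. H l) + real (card J) * (\<Sum>k\<in>I. V k))"
    by simp
  also have "\<dots> \<le> 2 * real b * (real b * (\<Sum>l\<in>J. H l) + real b * (\<Sum>k\<in>I. V k))"
    using I(2) J(2) VH by (intro mult_left_mono add_mono mult_right_mono) auto
  also have "(\<Sum>l\<in>J. H l) = (\<Sum>k\<in>I. \<Sum>l\<in>J. (c (Suc k) l - c k l)\<^sup>2)"
    unfolding H_def by (rule sum.swap)
  finally show ?thesis unfolding V_def by (simp add: power2_eq_square algebra_simps)
qed

text \<open>The rows and the columns are cut into at most \<open>K\<close> intervals of \<open>b\<close> consecutive indices (the last one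
  may be shorter), and the inequalities for the resulting blocks are added.\<close>

lemma block_poincare:
  assumes b: "0 < b" and K: "m div b < K"
    and zero: "\<And>p q. p < K \<Longrightarrow> q < K \<Longrightarrow>
      (\<Sum>k | k \<le> m \<and> k div b = p. \<Sum>l | l \<le> m \<and> l div b = q. c k l) = 0"
  shows "grid_sumsq m c \<le> 2 * (real b)\<^sup>2 * grid_energy m c"
proof -
  define I where "I p = {k. k \<le> m \<and> k div b = p}" for p
  have fin: "finite (I p)" for p unfolding I_def by simp
  have card: "card (I p) \<le> b" for p
  proof -
    have "I p \<subseteq> {p * b..<p * b + b}"
    proof
      fix k assume "k \<in> I p"
      then have "k = p * b + k mod b" using div_mult_mod_eq[of k b] by (auto simp: I_def)
      then show "k \<in> {p * b..<p * b + b}" using mod_less_divisor[OF b, of k] by (simp only: atLeastLessThan_iff) linarith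
    qed
    then have "card (I p) \<le> card {p * b..<p * b + b}" by (intro card_mono) auto
    then show ?thesis by simp
  qed
  have convex: "{i..<j} \<subseteq> I p" if "i \<in> I p" "j \<in> I p" for i j p
  proof
    fix k assume "k \<in> {i..<j}"
    then have "i \<le> k" "k \<le> j" by auto
    then have "i div b \<le> k div b" "k div b \<le> j div b" by (simp_all add: div_le_mono)
    moreover have "k \<le> m" using \<open>k \<le> j\<close> that by (simp add: I_def)
    ultimately show "k \<in> I p" using that by (auto simp: I_def)
  qed
  have group: "(\<Sum>k\<le>m. \<Sum>l\<le>m. g k l) = (\<Sum>p<K. \<Sum>q<K. \<Sum>k\<in>I p. \<Sum>l\<in>I q. g k l)"
    for g :: "nat \<Rightarrow> nat \<Rightarrow> real"
  proof -
    have im: "(\<lambda>k. k div b) ` {..m} \<subseteq> {..<K}"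
      using K by (auto intro: le_less_trans[OF div_le_mono])
    have one: "(\<Sum>k\<le>m. h k) = (\<Sum>p<K. \<Sum>k\<in>I p. h k)" for h :: "nat \<Rightarrow> real"
      using sum.group[of "{..m}" "{..<K}" "\<lambda>k. k div b" h] im by (simp add: I_def)
    have "(\<Sum>k\<le>m. \<Sum>l\<le>m. g k l) = (\<Sum>p<K. \<Sum>k\<in>I p. \<Sum>q<K. \<Sum>l\<in>I q. g k l)"
      by (simp only: one)
    also have "\<dots> = (\<Sum>p<K. \<Sum>q<K. \<Sum>k\<in>I p. \<Sum>l\<in>I q. g k l)"
      by (rule sum.cong[OF refl]) (rule sum.swap)
    finally show ?thesis .
  qed
  let ?h = "\<lambda>k l. (c (Suc k) l - c k l)\<^sup>2" and ?v = "\<lambda>k l. (c k (Suc l) - c k l)\<^sup>2"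
  have "grid_sumsq m c = (\<Sum>p<K. \<Sum>q<K. \<Sum>k\<in>I p. \<Sum>l\<in>I q. (c k l)\<^sup>2)"
    unfolding grid_sumsq_def by (rule group)
  also have "\<dots> \<le> (\<Sum>p<K. \<Sum>q<K. 2 * (real b)\<^sup>2 *
      ((\<Sum>k\<in>I p. \<Sum>l\<in>I q. ?h k l) + (\<Sum>k\<in>I p. \<Sum>l\<in>I q. ?v k l)))"
    by (intro sum_mono block_poincare_single fin card convex)
       (use zero in \<open>simp_all add: I_def\<close>)
  also have "\<dots> = 2 * (real b)\<^sup>2 * ((\<Sum>k\<le>m. \<Sum>l\<le>m. ?h k l) + (\<Sum>k\<le>m. \<Sum>l\<le>m. ?v k l))"
    unfolding group[of ?h] group[of ?v] by (simp only: sum_distrib_left sum.distrib distrib_left)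
  also have "\<dots> \<le> 2 * (real b)\<^sup>2 * grid_energy m c"
    by (intro mult_left_mono edge_sums_le_grid_energy) auto
  finally show ?thesis .
qed

text \<open>The weights are controlled only where the values do not vanish: weights at boundary nodes have no
  meaning, and the values there are 0.\<close>

lemma weighted_difference_square_le:
  fixes w w' :: real
  assumes "w \<noteq> 0 \<Longrightarrow> \<bar>r\<bar> \<le> R" "w' \<noteq> 0 \<Longrightarrow> \<bar>r'\<bar> \<le> R"
    and "w \<noteq> 0 \<Longrightarrow> w' \<noteq> 0 \<Longrightarrow> \<bar>r' - r\<bar> \<le> e"
  shows "(r' * w' - r * w)\<^sup>2 \<le> 2 * R\<^sup>2 * (w' - w)\<^sup>2 + 2 * e\<^sup>2 * w\<^sup>2"
proof -
  have sq: "(t * x)\<^sup>2 \<le> T\<^sup>2 * x\<^sup>2" if "\<bar>t\<bar> \<le> T" for t T x :: real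
    unfolding power_mult_distrib using that by (intro mult_right_mono) (simp_all add: abs_le_square_iff[symmetric] order_trans[OF _ abs_ge_self])
  consider "w = 0" "w' = 0" | "w = 0" "w' \<noteq> 0" | "w \<noteq> 0" "w' = 0" | "w \<noteq> 0" "w' \<noteq> 0" by blast
  then show ?thesis
  proof cases
    case 2
    have "(r' * w')\<^sup>2 \<le> R\<^sup>2 * w'\<^sup>2" "0 \<le> R\<^sup>2 * w'\<^sup>2" using sq[OF assms(2)[OF 2(2)]] by simp_all
    then show ?thesis unfolding 2(1) mult_zero_right diff_zero zero_power2 by linarith
  next
    case 3
    have "(r * w)\<^sup>2 \<le> R\<^sup>2 * w\<^sup>2" "0 \<le> R\<^sup>2 * w\<^sup>2" "0 \<le> e\<^sup>2 * w\<^sup>2"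
      using sq[OF assms(1)[OF 3(1)]] by simp_all
    then show ?thesis unfolding 3(2) mult_zero_right diff_0 power2_minus by linarith
  next
    case 4
    have 1: "(r' * (w' - w))\<^sup>2 \<le> R\<^sup>2 * (w' - w)\<^sup>2" by (rule sq[OF assms(2)[OF 4(2)]])
    have 2: "((r' - r) * w)\<^sup>2 \<le> e\<^sup>2 * w\<^sup>2" by (rule sq[OF assms(3)[OF 4]])
    have "r' * w' - r * w = r' * (w' - w) + (r' - r) * w" by (simp add: algebra_simps)
    moreover have "(x + y)\<^sup>2 \<le> 2 * x\<^sup>2 + 2 * y\<^sup>2" for x y :: real
      using zero_le_power2[of "x - y"] by (simp add: power2_eq_square algebra_simps)
    ultimately have "(r' * w' - r * w)\<^sup>2 \<le> 2 * (r' * (w' - w))\<^sup>2 + 2 * ((r' - r) * w)\<^sup>2" by simp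
    with 1 2 show ?thesis by linarith
  qed simp
qed

lemma grid_sumsq_shift:
  assumes "zero_boundary m c"
  shows "(\<Sum>k\<le>m. \<Sum>l\<le>m. (c k (Suc l))\<^sup>2) \<le> grid_sumsq m c"
    and "(\<Sum>k\<le>m. \<Sum>l\<le>m. (c (Suc k) l)\<^sup>2) \<le> grid_sumsq m c"
    and "(\<Sum>k\<le>m. \<Sum>l\<le>m. (c (Suc k) (Suc l))\<^sup>2) \<le> grid_sumsq m c"
proof -
  have shift: "(\<Sum>k\<le>m. f (Suc k)) \<le> (\<Sum>k\<le>m. f k)" if "f (Suc m) = 0" "0 \<le> f 0" for f :: "nat \<Rightarrow> real"
    using sum.atMost_Suc_shift[of f m] that by simp
  have zero: "c (Suc m) l = 0" "c k (Suc m) = 0" for k l using assms by (simp_all add: zero_boundary_def)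
  have row: "(\<Sum>l\<le>m. (c k (Suc l))\<^sup>2) \<le> (\<Sum>l\<le>m. (c k l)\<^sup>2)" for k
    by (rule shift[of "\<lambda>l. (c k l)\<^sup>2"]) (simp_all add: zero)
  show "(\<Sum>k\<le>m. \<Sum>l\<le>m. (c k (Suc l))\<^sup>2) \<le> grid_sumsq m c"
    unfolding grid_sumsq_def by (intro sum_mono row)
  show 2: "(\<Sum>k\<le>m. \<Sum>l\<le>m. (c (Suc k) l)\<^sup>2) \<le> grid_sumsq m c"
    unfolding grid_sumsq_def by (rule shift[of "\<lambda>k. \<Sum>l\<le>m. (c k l)\<^sup>2"]) (auto simp: zero intro: sum_nonneg)
  show "(\<Sum>k\<le>m. \<Sum>l\<le>m. (c (Suc k) (Suc l))\<^sup>2) \<le> grid_sumsq m c"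
    by (rule order_trans[OF sum_mono[OF row] 2])
qed

text \<open>The product rule for differences leaves a zero-order term with the factor \<open>L\<^sup>2 / (m + 1)\<^sup>2\<close>, which
  \<open>grid_poincare\<close> absorbs.\<close>

lemma grid_energy_weighted_le:
  assumes w: "zero_boundary m w"
    and R: "\<And>k l. \<lbrakk>1 \<le> k; k \<le> m; 1 \<le> l; l \<le> m\<rbrakk> \<Longrightarrow> \<bar>r k l\<bar> \<le> R"
    and h: "\<And>k l. \<lbrakk>1 \<le> k; k < m; 1 \<le> l; l \<le> m\<rbrakk> \<Longrightarrow> \<bar>r (Suc k) l - r k l\<bar> \<le> L / real (m + 1)"
    and v: "\<And>k l. \<lbrakk>1 \<le> k; k \<le> m; 1 \<le> l; l < m\<rbrakk> \<Longrightarrow> \<bar>r k (Suc l) - r k l\<bar> \<le> L / real (m + 1)"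
  shows "grid_energy m (\<lambda>k l. r k l * w k l) \<le> (2 * R\<^sup>2 + 8 * L\<^sup>2) * grid_energy m w"
proof -
  define e where "e = L / real (m + 1)"
  have inside: "1 \<le> k \<and> k \<le> m \<and> 1 \<le> l \<and> l \<le> m" if "w k l \<noteq> 0" for k l
    using w that by (auto simp: zero_boundary_def)
  have H: "(r (Suc k) l * w (Suc k) l - r k l * w k l)\<^sup>2
      \<le> 2 * R\<^sup>2 * (w (Suc k) l - w k l)\<^sup>2 + 2 * e\<^sup>2 * (w k l)\<^sup>2" for k l
    using inside[of k l] inside[of "Suc k" l] R[of k l] R[of "Suc k" l] h[of k l, folded e_def]
    by (intro weighted_difference_square_le) simp_all
  have V: "(r k (Suc l) * w k (Suc l) - r k l * w k l)\<^sup>2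
      \<le> 2 * R\<^sup>2 * (w k (Suc l) - w k l)\<^sup>2 + 2 * e\<^sup>2 * (w k l)\<^sup>2" for k l
    using inside[of k l] inside[of k "Suc l"] R[of k l] R[of k "Suc l"] v[of k l, folded e_def]
    by (intro weighted_difference_square_le) simp_all
  have cell: "cell_energy (\<lambda>k l. r k l * w k l) k l \<le> 2 * R\<^sup>2 * cell_energy w k l
      + 2 * e\<^sup>2 * ((w k l)\<^sup>2 + (w k (Suc l))\<^sup>2 + (w k l)\<^sup>2 + (w (Suc k) l)\<^sup>2)" for k l
    using H[of k l] H[of k "Suc l"] V[of k l] V[of "Suc k" l]
    unfolding cell_energy_def by (simp add: algebra_simps)
  have "grid_energy m (\<lambda>k l. r k l * w k l) \<le> (\<Sum>k\<le>m. \<Sum>l\<le>m. 2 * R\<^sup>2 * cell_energy w k l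
      + 2 * e\<^sup>2 * ((w k l)\<^sup>2 + (w k (Suc l))\<^sup>2 + (w k l)\<^sup>2 + (w (Suc k) l)\<^sup>2))"
    unfolding grid_energy_def by (intro sum_mono cell)
  also have "\<dots> = 2 * R\<^sup>2 * grid_energy m w + 2 * e\<^sup>2 * (grid_sumsq m w
      + (\<Sum>k\<le>m. \<Sum>l\<le>m. (w k (Suc l))\<^sup>2) + grid_sumsq m w + (\<Sum>k\<le>m. \<Sum>l\<le>m. (w (Suc k) l)\<^sup>2))"
    unfolding grid_energy_def grid_sumsq_def by (simp only: sum.distrib sum_distrib_left distrib_left)
  also have "\<dots> \<le> 2 * R\<^sup>2 * grid_energy m w + 2 * e\<^sup>2 * (4 * grid_sumsq m w)"
    using grid_sumsq_shift(1,2)[OF w] by (intro add_left_mono mult_left_mono) auto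
  also have "\<dots> \<le> 2 * R\<^sup>2 * grid_energy m w + 2 * e\<^sup>2 * (4 * ((real (m + 1))\<^sup>2 * grid_energy m w))"
    by (intro add_left_mono mult_left_mono grid_poincare w) auto
  also have "\<dots> = (2 * R\<^sup>2 + 8 * L\<^sup>2) * grid_energy m w"
  proof -
    have "e * real (m + 1) = L" by (simp add: e_def)
    then have "e\<^sup>2 * (real (m + 1))\<^sup>2 = L\<^sup>2" unfolding power_mult_distrib[symmetric] by simp
    moreover have "2 * e\<^sup>2 * (4 * ((real (m + 1))\<^sup>2 * G)) = 8 * (e\<^sup>2 * (real (m + 1))\<^sup>2) * G" for G :: real
      by simp
    ultimately show ?thesis by (simp only: distrib_right)
  qed
  finally show ?thesis .
qed

section \<open>The triangulation and its nodal basis\<close>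

text \<open>Every triangle is a right triangle with legs parallel to the axes.  It is described by its cell
  \<open>(k, l)\<close> and a truth value \<open>b\<close>, which holds if the right angle is at a lower corner of the cell.  The
  right angle sits at \<open>(corner_col, corner_row)\<close>, the legs lead to \<open>other_col\<close> and \<open>other_row\<close>, in the
  directions \<open>sgn_x\<close> and \<open>sgn_y\<close>.  This treats both directions of the diagonals uniformly.\<close>

definition corner_on_right :: "diagonal \<Rightarrow> bool \<Rightarrow> bool" where
  "corner_on_right d b \<longleftrightarrow> ((d = Rising) = b)"

definition corner_col :: "diagonal \<Rightarrow> bool \<Rightarrow> nat \<Rightarrow> nat" where
  "corner_col d b k = (if corner_on_right d b then Suc k else k)"

definition corner_row :: "bool \<Rightarrow> nat \<Rightarrow> nat" where
  "corner_row b l = (if b then l else Suc l)"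

definition other_col :: "diagonal \<Rightarrow> bool \<Rightarrow> nat \<Rightarrow> nat" where
  "other_col d b k = (if corner_on_right d b then k else Suc k)"

definition other_row :: "bool \<Rightarrow> nat \<Rightarrow> nat" where
  "other_row b l = (if b then Suc l else l)"

definition sgn_x :: "diagonal \<Rightarrow> bool \<Rightarrow> real" where
  "sgn_x d b = (if corner_on_right d b then - 1 else 1)"

definition sgn_y :: "bool \<Rightarrow> real" where
  "sgn_y b = (if b then 1 else - 1)"

text \<open>Together with \<open>bary_y\<close>: the barycentric coordinates that belong to the ends of the horizontal and
  the vertical leg.\<close>

definition bary_x :: "diagonal \<Rightarrow> nat \<Rightarrow> nat \<Rightarrow> bool \<Rightarrow> real \<times> real \<Rightarrow> real" where
  "bary_x d m k b x = sgn_x d b * (real (m + 1) * fst x - real (corner_col d b k))"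

definition bary_y :: "nat \<Rightarrow> nat \<Rightarrow> bool \<Rightarrow> real \<times> real \<Rightarrow> real" where
  "bary_y m l b x = sgn_y b * (real (m + 1) * snd x - real (corner_row b l))"

definition tri :: "diagonal \<Rightarrow> nat \<Rightarrow> nat \<Rightarrow> nat \<Rightarrow> bool \<Rightarrow> (real \<times> real) set" where
  "tri d m k l b = {x. 0 \<le> bary_x d m k b x \<and> 0 \<le> bary_y m l b x \<and> bary_x d m k b x + bary_y m l b x \<le> 1}"

text \<open>The numbers \<open>s\<close> and \<open>t\<close> give the directions of the two legs of length \<open>1/N\<close>.\<close>

lemma convex_hull_right_triangle:
  fixes N p q s t :: real
  assumes N: "0 < N" and s: "s = 1 \<or> s = - 1" and t: "t = 1 \<or> t = - 1"
  shows "convex hull {(p / N, q / N), ((p + s) / N, q / N), (p / N, (q + t) / N)}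
     = {x. 0 \<le> s * (N * fst x - p) \<and> 0 \<le> t * (N * snd x - q) \<and>
           s * (N * fst x - p) + t * (N * snd x - q) \<le> 1}" (is "?L = ?R")
proof (intro equalityI subsetI)
  have ss: "s * s = 1" and tt: "t * t = 1" using s t by auto
  fix x :: "real \<times> real"
  {
    assume "x \<in> ?L"
    then obtain u v w where uvw: "0 \<le> u" "0 \<le> v" "0 \<le> w" "u + v + w = 1"
      and x: "x = u *\<^sub>R (p / N, q / N) + v *\<^sub>R ((p + s) / N, q / N) + w *\<^sub>R (p / N, (q + t) / N)"
      unfolding convex_hull_3 by blast
    have "N * fst x = (u + v + w) * p + v * s" "N * snd x = (u + v + w) * q + w * t"
      using N by (simp_all add: x field_simps)
    then have "s * (N * fst x - p) = v" "t * (N * snd x - q) = w"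
      using ss tt by (simp_all add: uvw(4))
    then show "x \<in> ?R" using uvw by simp
  next
    assume R: "x \<in> ?R"
    define v where "v = s * (N * fst x - p)"
    define w where "w = t * (N * snd x - q)"
    have "s * v = N * fst x - p" "t * w = N * snd x - q"
      unfolding v_def w_def by (simp_all add: ss tt flip: mult.assoc)
    then have "fst x = (p + s * v) / N" "snd x = (q + t * w) / N" using N by (simp_all add: field_simps)
    then have "x = (1 - v - w) *\<^sub>R (p / N, q / N) + v *\<^sub>R ((p + s) / N, q / N) + w *\<^sub>R (p / N, (q + t) / N)"
      using N by (simp add: prod_eq_iff field_simps)
    moreover have "0 \<le> v" "0 \<le> w" "0 \<le> 1 - v - w" using R by (auto simp: v_def w_def)
    ultimately show "x \<in> ?L" unfolding convex_hull_3
      by (intro CollectI exI[of _ "1 - v - w"] exI[of _ v] exI[of _ w]) simp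
  }
qed

lemma tri_eq_convex_hull:
  "tri d m k l b = convex hull {grid_point m (corner_col d b k) (corner_row b l),
     grid_point m (other_col d b k) (corner_row b l), grid_point m (corner_col d b k) (other_row b l)}"
proof -
  have "real (other_col d b k) = real (corner_col d b k) + sgn_x d b"
    "real (other_row b l) = real (corner_row b l) + sgn_y b"
    by (simp_all add: other_col_def corner_col_def other_row_def corner_row_def sgn_x_def sgn_y_def)
  then show ?thesis
    unfolding tri_def bary_x_def bary_y_def grid_point_def
    by (subst convex_hull_right_triangle[symmetric]) (simp_all add: sgn_x_def sgn_y_def)
qed

lemma cell_triangles_eq: "cell_triangles d m k l = range (tri d m k l)"
proof -
  have "cell_triangles d m k l = {tri d m k l True, tri d m k l False}"
    by (cases d) (simp_all add: tri_eq_convex_hull corner_col_def other_col_def corner_row_def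
        other_row_def corner_on_right_def insert_commute)
  then show ?thesis by (simp only: UNIV_bool image_insert image_empty insert_commute)
qed

lemma mesh_iff: "T \<in> mesh d m \<longleftrightarrow> (\<exists>k l b. k \<le> m \<and> l \<le> m \<and> T = tri d m k l b)"
  unfolding mesh_def cell_triangles_eq UN_iff atMost_iff by blast

lemma triangles_cover:
  assumes "x \<in> Omega"
  obtains k l b where "k \<le> m" "l \<le> m" "x \<in> tri d m k l b"
proof -
  let ?N = "real (m + 1)"
  have cell: "\<exists>k\<le>m. real k \<le> ?N * y \<and> ?N * y \<le> real k + 1" if "0 < y" "y < 1" for y
  proof -
    let ?k = "nat \<lfloor>?N * y\<rfloor>"
    have "0 \<le> ?N * y" "?N * y < ?N" using that by simp_all
    then have "real ?k \<le> ?N * y" "?N * y \<le> real ?k + 1" "real ?k < ?N" by linarith+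
    then show ?thesis by (intro exI[of _ ?k]) auto
  qed
  obtain k l where k: "k \<le> m" "real k \<le> ?N * fst x" "?N * fst x \<le> real k + 1"
    and l: "l \<le> m" "real l \<le> ?N * snd x" "?N * snd x \<le> real l + 1"
    using cell[of "fst x"] cell[of "snd x"] assms by (auto simp: Omega_def)
  have "x \<in> tri d m k l True \<or> x \<in> tri d m k l False"
    using k l by (cases d) (auto simp: tri_def bary_x_def bary_y_def sgn_x_def sgn_y_def
        corner_col_def corner_row_def corner_on_right_def)
  then show ?thesis using that k l by blast
qed

text \<open>The affine function that takes the values of the grid function \<open>c\<close> at the vertices of one triangle.\<close>

definition interpolant :: "diagonal \<Rightarrow> nat \<Rightarrow> nat \<Rightarrow> nat \<Rightarrow> bool \<Rightarrow> (nat \<Rightarrow> nat \<Rightarrow> real) \<Rightarrow> real \<times> real \<Rightarrow> real" where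
  "interpolant d m k l b c x =
     (1 - bary_x d m k b x - bary_y m l b x) * c (corner_col d b k) (corner_row b l)
     + bary_x d m k b x * c (other_col d b k) (corner_row b l)
     + bary_y m l b x * c (corner_col d b k) (other_row b l)"

lemma bary_at_vertices:
  "bary_x d m k b (grid_point m (corner_col d b k) q) = 0"
  "bary_x d m k b (grid_point m (other_col d b k) q) = 1"
  "bary_y m l b (grid_point m p (corner_row b l)) = 0"
  "bary_y m l b (grid_point m p (other_row b l)) = 1"
  by (auto simp: bary_x_def bary_y_def grid_point_def sgn_x_def sgn_y_def corner_col_def other_col_def
      corner_row_def other_row_def)

lemma fe_space_interpolates:
  assumes v: "v \<in> fe_space d m" and "k \<le> m" "l \<le> m" and xT: "x \<in> tri d m k l b"
  shows "v x = interpolant d m k l b (\<lambda>p q. v (grid_point m p q)) x"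
proof -
  have "tri d m k l b \<in> mesh d m" unfolding mesh_iff using assms(2,3) by blast
  then obtain c e where aff: "\<And>x. x \<in> tri d m k l b \<Longrightarrow> v x = inner c x + e"
    using v unfolding fe_space_def by blast
  define K L K' L' where "K = corner_col d b k" and "L = corner_row b l"
    and "K' = other_col d b k" and "L' = other_row b l"
  have vert: "grid_point m K L \<in> tri d m k l b" "grid_point m K' L \<in> tri d m k l b"
    "grid_point m K L' \<in> tri d m k l b"
    unfolding tri_def K_def L_def K'_def L'_def by (simp_all add: bary_at_vertices)
  define \<xi> \<eta> where "\<xi> = bary_x d m k b x" and "\<eta> = bary_y m l b x"
  have K': "real K' = real K + sgn_x d b" and L': "real L' = real L + sgn_y b"
    by (simp_all add: K_def K'_def L_def L'_def other_col_def corner_col_def other_row_def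
        corner_row_def sgn_x_def sgn_y_def)
  have x1: "real (m + 1) * fst x = real K + \<xi> * sgn_x d b" and x2: "real (m + 1) * snd x = real L + \<eta> * sgn_y b"
    by (auto simp: \<xi>_def \<eta>_def bary_x_def bary_y_def K_def L_def sgn_x_def sgn_y_def)
  have x: "x = (1 - \<xi> - \<eta>) *\<^sub>R grid_point m K L + \<xi> *\<^sub>R grid_point m K' L + \<eta> *\<^sub>R grid_point m K L'"
  proof -
    have "fst x = (real K + \<xi> * sgn_x d b) / real (m + 1)" "snd x = (real L + \<eta> * sgn_y b) / real (m + 1)"
      using x1 x2 by (simp_all add: field_simps)
    moreover have "(1 - \<xi> - \<eta>) * (k / n) + \<xi> * ((k + s) / n) + \<eta> * (k / n) = (k + \<xi> * s) / n"
      "(1 - \<xi> - \<eta>) * (k / n) + \<xi> * (k / n) + \<eta> * ((k + s) / n) = (k + \<eta> * s) / n" for k n s :: real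
      by (simp_all add: add_divide_distrib algebra_simps)
    ultimately show ?thesis unfolding prod_eq_iff by (simp only: grid_point_def K' L' fst_add snd_add fst_scaleR snd_scaleR fst_conv snd_conv real_scaleR_def)
  qed
  have "inner c x = (1 - \<xi> - \<eta>) * inner c (grid_point m K L)
      + \<xi> * inner c (grid_point m K' L) + \<eta> * inner c (grid_point m K L')"
    by (subst x) (simp only: inner_add_right inner_scaleR_right)
  then have "inner c x + e = (1 - \<xi> - \<eta>) * (inner c (grid_point m K L) + e)
      + \<xi> * (inner c (grid_point m K' L) + e) + \<eta> * (inner c (grid_point m K L') + e)"
    by (simp add: algebra_simps)
  then show ?thesis
    using aff[OF xT] aff[OF vert(1)] aff[OF vert(2)] aff[OF vert(3)]
    by (simp add: interpolant_def K_def L_def K'_def L'_def \<xi>_def \<eta>_def)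
qed

lemma grid_point_notin_Omega:
  "\<not> (1 \<le> k \<and> k \<le> m \<and> 1 \<le> l \<and> l \<le> m) \<Longrightarrow> grid_point m k l \<notin> Omega"
  by (auto simp: grid_point_def Omega_def field_simps)

lemma fe_space_zero_outside: "v \<in> fe_space d m \<Longrightarrow> x \<notin> Omega \<Longrightarrow> v x = 0"
  unfolding fe_space_def by blast

text \<open>This is the uniqueness behind the definite description of the nodal basis: boundary nodes carry the
  value 0, and nodal values determine the function on each triangle.\<close>

lemma fe_space_eqI:
  assumes v: "v \<in> fe_space d m" and w: "w \<in> fe_space d m"
    and nodes: "\<And>k l. \<lbrakk>1 \<le> k; k \<le> m; 1 \<le> l; l \<le> m\<rbrakk> \<Longrightarrow> v (grid_point m k l) = w (grid_point m k l)"
  shows "v = w"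
proof
  fix x
  have grid: "v (grid_point m k l) = w (grid_point m k l)" for k l
    using nodes[of k l] fe_space_zero_outside[OF v, OF grid_point_notin_Omega[of k m l]]
      fe_space_zero_outside[OF w, OF grid_point_notin_Omega[of k m l]]
    by (cases "1 \<le> k \<and> k \<le> m \<and> 1 \<le> l \<and> l \<le> m") simp_all
  show "v x = w x"
  proof (cases "x \<in> Omega")
    case True
    then obtain k l b where klb: "k \<le> m" "l \<le> m" "x \<in> tri d m k l b" by (rule triangles_cover)
    show ?thesis
      unfolding fe_space_interpolates[OF v klb] fe_space_interpolates[OF w klb] by (simp add: grid)
  next
    case False
    then show ?thesis using fe_space_zero_outside[OF v] fe_space_zero_outside[OF w] by simp
  qed
qed

text \<open>The hexagonal pyramid around the node with indices \<open>(p, q)\<close>: in the scaled coordinates \<open>s\<close> and \<open>t\<close> its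
  support is bounded by \<open>\<bar>s\<bar> = 1\<close>, \<open>\<bar>t\<bar> = 1\<close> and by two lines parallel to the diagonals.\<close>

definition hat_fun :: "diagonal \<Rightarrow> nat \<Rightarrow> nat \<Rightarrow> nat \<Rightarrow> real \<times> real \<Rightarrow> real" where
  "hat_fun d m p q x =
     (let s = real (m + 1) * fst x - real p; t = real (m + 1) * snd x - real q in
      max 0 (1 - max (max \<bar>s\<bar> \<bar>t\<bar>) \<bar>s + (if d = Rising then - t else t)\<bar>))"

text \<open>On one triangle, with barycentric coordinates \<open>u\<close> and \<open>v\<close> and with the right-angled vertex displaced from
  the node by the integers \<open>(A, B)\<close>, measured in the directions of the legs, the pyramid is the barycentric coordinate of the vertex that
  coincides with the node, and 0 if there is none.\<close>

lemma hexagonal_hat_values: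
  fixes A B :: int and u v :: real
  assumes "0 \<le> u" "0 \<le> v" "u + v \<le> 1"
  shows "max 0 (1 - max (max \<bar>A + u\<bar> \<bar>B + v\<bar>) \<bar>A + u + (B + v)\<bar>) =
     (1 - u - v) * of_bool (A = 0 \<and> B = 0) + u * of_bool (A = - 1 \<and> B = 0) + v * of_bool (A = 0 \<and> B = - 1)"
proof -
  consider "1 \<le> \<bar>A + u\<bar>" "A \<noteq> 0" "A \<noteq> - 1" | "1 \<le> \<bar>B + v\<bar>" "B \<noteq> 0" "B \<noteq> - 1"
    | "A = 0" "B = 0" | "A = - 1" "B = 0" | "A = 0" "B = - 1" | "A = - 1" "B = - 1"
  proof -
    have far: "1 \<le> \<bar>C + w\<bar>" if "C \<noteq> 0" "C \<noteq> - 1" "0 \<le> w" "w \<le> 1" for C :: int and w :: real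
    proof -
      from that have "1 \<le> C \<or> C \<le> - 2" by linarith
      then have "1 \<le> real_of_int C \<or> real_of_int C \<le> - 2" by linarith
      then show ?thesis using that by linarith
    qed
    have "u \<le> 1" "v \<le> 1" using assms by auto
    then show ?thesis using that far[of A u] far[of B v] assms by blast
  qed
  then show ?thesis using assms by cases auto
qed

lemma hat_fun_on_triangle:
  assumes "x \<in> tri d m k l b"
  shows "hat_fun d m p q x = interpolant d m k l b (\<lambda>i j. of_bool (i = p \<and> j = q)) x"
proof -
  define A B where "A = (if corner_on_right d b then int p - int (corner_col d b k) else int (corner_col d b k) - int p)"
    and "B = (if b then int (corner_row b l) - int q else int q - int (corner_row b l))"
  define u v where "u = bary_x d m k b x" and "v = bary_y m l b x"
  let ?s = "real (m + 1) * fst x - real p" and ?t = "real (m + 1) * snd x - real q"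
  have s: "?s = sgn_x d b * (real_of_int A + u)"
    by (cases "corner_on_right d b") (simp_all add: A_def u_def bary_x_def sgn_x_def)
  have t: "?t = sgn_y b * (real_of_int B + v)"
    by (cases b) (simp_all add: B_def v_def bary_y_def sgn_y_def)
  have sgn: "(if d = Rising then - sgn_y b else sgn_y b) = sgn_x d b"
    by (cases d; cases b) (simp_all add: sgn_x_def sgn_y_def corner_on_right_def)
  have abs_sgn: "\<bar>sgn_x d b * z\<bar> = \<bar>z\<bar>" "\<bar>sgn_y b * z\<bar> = \<bar>z\<bar>" for z :: real
    by (simp_all add: abs_mult sgn_x_def sgn_y_def)
  have "\<bar>?s\<bar> = \<bar>A + u\<bar>" "\<bar>?t\<bar> = \<bar>B + v\<bar>" unfolding s t abs_sgn by simp_all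
  moreover have "\<bar>?s + (if d = Rising then - ?t else ?t)\<bar> = \<bar>A + u + (B + v)\<bar>"
  proof -
    have "(if d = Rising then - ?t else ?t) = sgn_x d b * (real_of_int B + v)"
      unfolding t sgn[symmetric] by simp
    then have "?s + (if d = Rising then - ?t else ?t) = sgn_x d b * (A + u + (B + v))"
      unfolding s by (simp only: distrib_left)
    then show ?thesis by (simp only: abs_sgn)
  qed
  ultimately have "hat_fun d m p q x = max 0 (1 - max (max \<bar>A + u\<bar> \<bar>B + v\<bar>) \<bar>A + u + (B + v)\<bar>)"
    unfolding hat_fun_def Let_def by (simp only:)
  also have "\<dots> = (1 - u - v) * of_bool (A = 0 \<and> B = 0) + u * of_bool (A = - 1 \<and> B = 0) + v * of_bool (A = 0 \<and> B = - 1)"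
    by (rule hexagonal_hat_values) (use assms in \<open>auto simp: tri_def u_def v_def\<close>)
  also have "\<dots> = interpolant d m k l b (\<lambda>i j. of_bool (i = p \<and> j = q)) x"
  proof -
    have "(A = 0) = (corner_col d b k = p)" "(A = - 1) = (other_col d b k = p)"
      "(B = 0) = (corner_row b l = q)" "(B = - 1) = (other_row b l = q)"
      by (auto simp: A_def B_def corner_col_def other_col_def corner_row_def other_row_def)
    then show ?thesis unfolding interpolant_def u_def v_def by simp
  qed
  finally show ?thesis .
qed

lemma interpolant_affine: "\<exists>g e. \<forall>x. interpolant d m k l b c x = inner g x + e"
proof -
  define \<alpha> \<beta> \<gamma> where "\<alpha> = c (corner_col d b k) (corner_row b l)"
    and "\<beta> = sgn_x d b * (c (other_col d b k) (corner_row b l) - \<alpha>)"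
    and "\<gamma> = sgn_y b * (c (corner_col d b k) (other_row b l) - \<alpha>)"
  have "interpolant d m k l b c x = inner (real (m + 1) * \<beta>, real (m + 1) * \<gamma>) x
      + (\<alpha> - \<beta> * real (corner_col d b k) - \<gamma> * real (corner_row b l))" for x
    unfolding interpolant_def bary_x_def bary_y_def \<beta>_def \<gamma>_def \<alpha>_def[symmetric]
    by (cases x) (simp add: algebra_simps)
  then show ?thesis by blast
qed

lemma hat_fun_in_fe_space:
  assumes "1 \<le> p" "p \<le> m" "1 \<le> q" "q \<le> m"
  shows "hat_fun d m p q \<in> fe_space d m"
proof -
  have "continuous_on (closure Omega) (hat_fun d m p q)"
    unfolding hat_fun_def Let_def by (cases d) (auto intro!: continuous_intros)
  moreover have "\<exists>c e. \<forall>x\<in>T. hat_fun d m p q x = inner c x + e" if "T \<in> mesh d m" for T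
  proof -
    from that obtain k l b where T: "T = tri d m k l b" unfolding mesh_iff by blast
    show ?thesis
      using interpolant_affine[of d m k l b "\<lambda>i j. of_bool (i = p \<and> j = q)"]
      unfolding T by (metis hat_fun_on_triangle)
  qed
  moreover have "hat_fun d m p q x = 0" if x: "x \<notin> Omega" for x
  proof -
    have *: "1 \<le> \<bar>real (m + 1) * y - real i\<bar>" if "y \<le> 0 \<or> 1 \<le> y" "1 \<le> i" "i \<le> m" for y i
    proof -
      have "real (m + 1) * y \<le> 0 \<or> real (m + 1) \<le> real (m + 1) * y"
        using that(1) mult_left_mono[of y 0 "real (m + 1)"] mult_left_mono[of 1 y "real (m + 1)"] by auto
      moreover have "1 \<le> real i" "real i + 1 \<le> real (m + 1)" using that by auto
      ultimately show ?thesis by linarith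
    qed
    from x have "(fst x \<le> 0 \<or> 1 \<le> fst x) \<or> (snd x \<le> 0 \<or> 1 \<le> snd x)"
      by (cases x) (auto simp: Omega_def)
    then have "1 \<le> \<bar>real (m + 1) * fst x - real p\<bar> \<or> 1 \<le> \<bar>real (m + 1) * snd x - real q\<bar>"
      using * assms by blast
    then show ?thesis unfolding hat_fun_def Let_def by linarith
  qed
  ultimately show ?thesis unfolding fe_space_def by blast
qed

lemma hat_fun_at_grid_point:
  "hat_fun d m p q (grid_point m i j) = of_bool (i = p \<and> j = q)"
proof (cases "i = p \<and> j = q")
  case True
  then show ?thesis by (simp add: hat_fun_def grid_point_def)
next
  case False
  have "1 \<le> \<bar>real i - real p\<bar> \<or> 1 \<le> \<bar>real j - real q\<bar>" using False by linarith
  then show ?thesis using False unfolding hat_fun_def Let_def grid_point_def by auto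
qed

definition col_of :: "nat \<Rightarrow> nat \<Rightarrow> nat" where "col_of m i = i mod m + 1"
definition row_of :: "nat \<Rightarrow> nat \<Rightarrow> nat" where "row_of m i = i div m + 1"

lemma node_index_bounds:
  assumes "i < m\<^sup>2"
  shows "1 \<le> col_of m i" "col_of m i \<le> m" "1 \<le> row_of m i" "row_of m i \<le> m"
proof -
  have m: "0 < m" using assms by (cases m) auto
  then have "i mod m < m" "i div m < m"
    using assms by (simp_all add: power2_eq_square less_mult_imp_div_less)
  then show "1 \<le> col_of m i" "col_of m i \<le> m" "1 \<le> row_of m i" "row_of m i \<le> m"
    by (simp_all add: col_of_def row_of_def Suc_leI)
qed

lemma node_index_surj:
  assumes "1 \<le> k" "k \<le> m" "1 \<le> l" "l \<le> m"
  obtains i where "i < m\<^sup>2" "col_of m i = k" "row_of m i = l"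
proof -
  obtain k' l' where k: "k = Suc k'" and l: "l = Suc l'"
    using assms by (cases k; cases l) auto
  let ?i = "l' * m + k'"
  have km: "k' < m" using assms(2) k by simp
  then have "?i < Suc l' * m" by simp
  also have "\<dots> \<le> m\<^sup>2" unfolding power2_eq_square using assms(4) l by (intro mult_le_mono1) simp
  finally have "?i < m\<^sup>2" .
  moreover have "col_of m ?i = k" "row_of m ?i = l" using km by (simp_all add: col_of_def row_of_def k l)
  ultimately show ?thesis by (rule that)
qed

lemma node_index_inj: "col_of m i = col_of m j \<Longrightarrow> row_of m i = row_of m j \<Longrightarrow> i = j"
  unfolding col_of_def row_of_def by (metis add_right_cancel div_mult_mod_eq)

lemma node_eq: "node m i = grid_point m (col_of m i) (row_of m i)"
  by (simp add: node_def col_of_def row_of_def)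

lemma hat_fun_at_node:
  "hat_fun d m (col_of m i) (row_of m i) (node m j) = (if j = i then 1 else 0)"
  using node_index_inj[of m j i] by (auto simp: node_eq hat_fun_at_grid_point)

lemma hat_eq:
  assumes "i < m\<^sup>2"
  shows "hat d m i = hat_fun d m (col_of m i) (row_of m i)"
  unfolding hat_def
proof (rule the_equality)
  note b = node_index_bounds[OF assms]
  show "hat_fun d m (col_of m i) (row_of m i) \<in> fe_space d m \<and>
    (\<forall>j<m\<^sup>2. hat_fun d m (col_of m i) (row_of m i) (node m j) = (if j = i then 1 else 0))"
    using hat_fun_in_fe_space[OF b] hat_fun_at_node by blast
  fix v
  assume v: "v \<in> fe_space d m \<and> (\<forall>j<m\<^sup>2. v (node m j) = (if j = i then 1 else 0))"
  show "v = hat_fun d m (col_of m i) (row_of m i)"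
  proof (rule fe_space_eqI)
    show "v \<in> fe_space d m" using v by simp
    show "hat_fun d m (col_of m i) (row_of m i) \<in> fe_space d m" by (rule hat_fun_in_fe_space[OF b])
    fix k l assume kl: "1 \<le> k" "k \<le> m" "1 \<le> l" "l \<le> m"
    then obtain j where "j < m\<^sup>2" "col_of m j = k" "row_of m j = l" by (rule node_index_surj)
    then have "j < m\<^sup>2" and kl: "grid_point m k l = node m j" by (simp_all add: node_eq)
    then show "v (grid_point m k l) = hat_fun d m (col_of m i) (row_of m i) (grid_point m k l)"
      using v by (simp add: kl hat_fun_at_node)
  qed
qed

section \<open>Gradients of finite element functions\<close>

text \<open>The gradient of a finite element function exists on the open triangles; what is left of the square
  is a null set.\<close>

definition tri_interior :: "diagonal \<Rightarrow> nat \<Rightarrow> nat \<Rightarrow> nat \<Rightarrow> bool \<Rightarrow> (real \<times> real) set" where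
  "tri_interior d m k l b = {x. 0 < bary_x d m k b x \<and> 0 < bary_y m l b x \<and> bary_x d m k b x + bary_y m l b x < 1}"

definition mesh_interior :: "diagonal \<Rightarrow> nat \<Rightarrow> (real \<times> real) set" where
  "mesh_interior d m = (\<Union>(k, l, b)\<in>{..m} \<times> {..m} \<times> UNIV. tri_interior d m k l b)"

lemma mesh_interiorE:
  assumes "x \<in> mesh_interior d m"
  obtains k l b where "k \<le> m" "l \<le> m" "x \<in> tri_interior d m k l b"
  using assms unfolding mesh_interior_def by blast

lemma tri_interior_subset_mesh_interior: "k \<le> m \<Longrightarrow> l \<le> m \<Longrightarrow> tri_interior d m k l b \<subseteq> mesh_interior d m"
  unfolding mesh_interior_def by blast

lemma tri_interior_subset_tri: "tri_interior d m k l b \<subseteq> tri d m k l b"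
  unfolding tri_interior_def tri_def by auto

lemma open_tri_interior: "open (tri_interior d m k l b)"
proof -
  have "tri_interior d m k l b = {x. 0 < bary_x d m k b x} \<inter> {x. 0 < bary_y m l b x}
      \<inter> {x. bary_x d m k b x + bary_y m l b x < 1}"
    unfolding tri_interior_def by blast
  also have "open \<dots>"
    unfolding bary_x_def bary_y_def by (intro open_Int open_Collect_less continuous_intros)
  finally show ?thesis .
qed

lemma open_mesh_interior: "open (mesh_interior d m)"
  unfolding mesh_interior_def by (auto intro: open_tri_interior)

lemma tri_interior_cell:
  assumes "x \<in> tri_interior d m k l b"
  shows "real k < real (m + 1) * fst x" "real (m + 1) * fst x < real k + 1"
    "real l < real (m + 1) * snd x" "real (m + 1) * snd x < real l + 1"
proof -
  have *: "0 < bary_x d m k b x" "bary_x d m k b x < 1" "0 < bary_y m l b x" "bary_y m l b x < 1"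
    using assms by (auto simp: tri_interior_def)
  show "real k < real (m + 1) * fst x" "real (m + 1) * fst x < real k + 1"
    using *(1,2) unfolding bary_x_def sgn_x_def corner_col_def
    by (cases "corner_on_right d b"; simp)+
  show "real l < real (m + 1) * snd x" "real (m + 1) * snd x < real l + 1"
    using *(3,4) unfolding bary_y_def sgn_y_def corner_row_def by (cases b; simp)+
qed

lemma mesh_interior_subset_Omega: "mesh_interior d m \<subseteq> Omega"
proof
  fix x assume "x \<in> mesh_interior d m"
  then obtain k l b where kl: "k \<le> m" "l \<le> m" and x: "x \<in> tri_interior d m k l b" by (rule mesh_interiorE)
  have unit: "0 < y \<and> y < 1" if "real i < real (m + 1) * y" "real (m + 1) * y < real i + 1" "i \<le> m" for y i
  proof -
    have "0 < real (m + 1) * y" using that(1) by linarith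
    moreover have "real i + 1 \<le> real (m + 1)" using that(3) by simp
    then have "real (m + 1) * y < real (m + 1) * 1" using that(2) by (simp only: mult_1_right)
    ultimately show ?thesis by (simp add: zero_less_mult_iff del: of_nat_add)
  qed
  show "x \<in> Omega"
    using unit[OF tri_interior_cell(1,2)[OF x] kl(1)] unit[OF tri_interior_cell(3,4)[OF x] kl(2)]
    by (cases x) (simp add: Omega_def)
qed

lemma tri_interior_unique:
  assumes x: "x \<in> tri_interior d m k l b" and y: "x \<in> tri_interior d m k' l' b'"
  shows "k = k' \<and> l = l' \<and> b = b'"
proof -
  have k: "k = k'" using tri_interior_cell(1,2)[OF x] tri_interior_cell(1,2)[OF y] by linarith
  have l: "l = l'" using tri_interior_cell(3,4)[OF x] tri_interior_cell(3,4)[OF y] by linarith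
  have False if "b \<noteq> b'"
  proof -
    from that x y k l have "x \<in> tri_interior d m k l True" "x \<in> tri_interior d m k l False" by (cases b; cases b'; simp)+
    then show False
      by (cases d) (simp_all add: tri_interior_def bary_x_def bary_y_def sgn_x_def sgn_y_def corner_on_right_def
          corner_col_def corner_row_def)
  qed
  then show ?thesis using k l by blast
qed

lemma negligible_coordinate_line:
  assumes "a \<noteq> 0 \<or> b \<noteq> 0"
  shows "negligible {x :: real \<times> real. a * fst x + b * snd x = e}"
proof -
  have "{x :: real \<times> real. a * fst x + b * snd x = e} = {x. inner (a, b) x = e}"
    by (auto simp: inner_prod_def)
  then show ?thesis using assms negligible_hyperplane[of "(a, b)" e] by (simp add: zero_prod_def)
qed

lemma negligible_tri_boundary: "negligible (tri d m k l b - tri_interior d m k l b)"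
proof -
  define N where "N = real (m + 1)"
  have N: "N \<noteq> 0" by (simp add: N_def)
  have "tri d m k l b - tri_interior d m k l b \<subseteq>
      {x. N * fst x + 0 * snd x = real (corner_col d b k)} \<union> {x. 0 * fst x + N * snd x = real (corner_row b l)}
      \<union> {x. (sgn_x d b * N) * fst x + (sgn_y b * N) * snd x
              = 1 + sgn_x d b * real (corner_col d b k) + sgn_y b * real (corner_row b l)}"
  proof
    fix x assume "x \<in> tri d m k l b - tri_interior d m k l b"
    then have "bary_x d m k b x = 0 \<or> bary_y m l b x = 0 \<or> bary_x d m k b x + bary_y m l b x = 1"
      by (auto simp: tri_def tri_interior_def)
    moreover have "sgn_x d b \<noteq> 0" "sgn_y b \<noteq> 0" by (simp_all add: sgn_x_def sgn_y_def)
    ultimately show "x \<in> {x. N * fst x + 0 * snd x = real (corner_col d b k)} \<union> {x. 0 * fst x + N * snd x = real (corner_row b l)}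
      \<union> {x. (sgn_x d b * N) * fst x + (sgn_y b * N) * snd x
              = 1 + sgn_x d b * real (corner_col d b k) + sgn_y b * real (corner_row b l)}"
      unfolding bary_x_def bary_y_def N_def[symmetric] by (simp add: right_diff_distrib mult.assoc) linarith
  qed
  moreover have "negligible \<dots>"
    using N by (intro negligible_Un negligible_coordinate_line) (auto simp: sgn_x_def)
  ultimately show ?thesis by (rule negligible_subset[rotated])
qed

lemma negligible_mesh_skeleton: "negligible (Omega - mesh_interior d m)"
proof -
  let ?S = "\<Union>(k, l, b)\<in>{..m} \<times> {..m} \<times> UNIV. tri d m k l b - tri_interior d m k l b"
  have "negligible ?S" by (intro negligible_Union) (auto intro: negligible_tri_boundary)
  moreover have "Omega - mesh_interior d m \<subseteq> ?S"
  proof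
    fix x assume x: "x \<in> Omega - mesh_interior d m"
    then obtain k l b where "k \<le> m" "l \<le> m" "x \<in> tri d m k l b" by (metis triangles_cover DiffD1)
    moreover from this x have "x \<notin> tri_interior d m k l b" using tri_interior_subset_mesh_interior by blast
    ultimately show "x \<in> ?S" by blast
  qed
  ultimately show ?thesis by (rule negligible_subset)
qed

text \<open>The difference quotients along the two legs.  They are oriented by increasing coordinates, so the signs
  of the barycentric coordinates drop out.\<close>

definition tri_grad :: "diagonal \<Rightarrow> nat \<Rightarrow> nat \<Rightarrow> nat \<Rightarrow> bool \<Rightarrow> (nat \<Rightarrow> nat \<Rightarrow> real) \<Rightarrow> real \<times> real" where
  "tri_grad d m k l b c =
     (real (m + 1) * (c (Suc k) (corner_row b l) - c k (corner_row b l)),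
      real (m + 1) * (c (corner_col d b k) (Suc l) - c (corner_col d b k) l))"

lemma grad_eqI:
  assumes "GDERIV f x :> D"
  shows "grad f x = D"
  unfolding grad_def
proof (rule the_equality)
  show "GDERIV f x :> D" by (rule assms)
  fix D' assume "GDERIV f x :> D'"
  then have "(\<lambda>h. inner h D') = (\<lambda>h. inner h D)"
    using assms unfolding gderiv_def by (rule has_derivative_unique)
  then have "inner (D' - D) (D' - D) = 0" by (metis cancel_comm_monoid_add_class.diff_cancel inner_diff_right)
  then show "D' = D" by simp
qed

lemma interpolant_GDERIV: "GDERIV (interpolant d m k l b c) x :> tri_grad d m k l b c"
proof -
  let ?K = "corner_col d b k" and ?L = "corner_row b l"
  let ?g = "tri_grad d m k l b c"
  have sx: "sgn_x d b * (c (other_col d b k) ?L - c ?K ?L) = c (Suc k) ?L - c k ?L"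
    by (simp add: sgn_x_def other_col_def corner_col_def)
  have sy: "sgn_y b * (c ?K (other_row b l) - c ?K ?L) = c ?K (Suc l) - c ?K l"
    by (simp add: sgn_y_def other_row_def corner_row_def)
  have "interpolant d m k l b c y = inner y ?g + interpolant d m k l b c (0, 0)" for y
  proof -
    have "interpolant d m k l b c y - interpolant d m k l b c (0, 0)
        = real (m + 1) * fst y * (sgn_x d b * (c (other_col d b k) ?L - c ?K ?L))
          + real (m + 1) * snd y * (sgn_y b * (c ?K (other_row b l) - c ?K ?L))"
      unfolding interpolant_def bary_x_def bary_y_def fst_conv snd_conv by (simp add: algebra_simps)
    then show ?thesis unfolding sx sy by (simp add: tri_grad_def inner_prod_def mult.assoc mult.left_commute)
  qed
  then have "interpolant d m k l b c = (\<lambda>y. inner y ?g + interpolant d m k l b c (0, 0))" by blast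
  moreover have "((\<lambda>y. inner y ?g + e) has_derivative (\<lambda>h. inner h ?g)) (at x)" for e
    by (auto intro!: derivative_eq_intros)
  ultimately show ?thesis unfolding gderiv_def by metis
qed

lemma fe_space_grad:
  assumes v: "v \<in> fe_space d m" and kl: "k \<le> m" "l \<le> m" and x: "x \<in> tri_interior d m k l b"
  shows "grad v x = tri_grad d m k l b (\<lambda>p q. v (grid_point m p q))"
proof (rule grad_eqI)
  let ?c = "\<lambda>p q. v (grid_point m p q)"
  have "((\<lambda>y. interpolant d m k l b ?c y) has_derivative (\<lambda>h. inner h (tri_grad d m k l b ?c))) (at x)"
    using interpolant_GDERIV[of d m k l b ?c x] by (simp add: gderiv_def)
  then have "(v has_derivative (\<lambda>h. inner h (tri_grad d m k l b ?c))) (at x)"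
  proof (rule has_derivative_transform_within_open[OF _ open_tri_interior x])
    fix y assume "y \<in> tri_interior d m k l b"
    then show "interpolant d m k l b ?c y = v y"
      using fe_space_interpolates[OF v kl subsetD[OF tri_interior_subset_tri]] by simp
  qed
  then show "GDERIV v x :> tri_grad d m k l b ?c" by (simp add: gderiv_def)
qed

lemma hat_in_fe_space: "i < m\<^sup>2 \<Longrightarrow> hat d m i \<in> fe_space d m"
  using hat_eq[of i m d] hat_fun_in_fe_space[OF node_index_bounds] by simp

definition unit_grid :: "nat \<Rightarrow> nat \<Rightarrow> nat \<Rightarrow> nat \<Rightarrow> real" where
  "unit_grid m i p q = of_bool (p = col_of m i \<and> q = row_of m i)"

text \<open>The coefficient vector \<open>c\<close> as a function on all grid points, with the value 0 at boundary points.\<close>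

definition grid_fun :: "nat \<Rightarrow> (nat \<Rightarrow> real) \<Rightarrow> nat \<Rightarrow> nat \<Rightarrow> real" where
  "grid_fun m c p q = (\<Sum>i<m\<^sup>2. c i * unit_grid m i p q)"

lemma hat_grad:
  assumes "i < m\<^sup>2" "k \<le> m" "l \<le> m" "x \<in> tri_interior d m k l b"
  shows "grad (hat d m i) x = tri_grad d m k l b (unit_grid m i)"
  using fe_space_grad[OF hat_in_fe_space[OF assms(1)] assms(2-4)]
  by (simp add: hat_eq[OF assms(1)] hat_fun_at_grid_point unit_grid_def[abs_def])

lemma hat_value:
  assumes "i < m\<^sup>2" "x \<in> tri_interior d m k l b"
  shows "hat d m i x = interpolant d m k l b (unit_grid m i) x"
  using hat_fun_on_triangle[OF subsetD[OF tri_interior_subset_tri assms(2)]]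
  by (simp add: hat_eq[OF assms(1)] unit_grid_def[abs_def])

lemma tri_grad_sum:
  "(\<Sum>i<n. c i *\<^sub>R tri_grad d m k l b (g i)) = tri_grad d m k l b (\<lambda>p q. \<Sum>i<n. c i * g i p q)"
  by (simp add: prod_eq_iff fst_sum snd_sum tri_grad_def sum_distrib_left sum_subtractf[symmetric] algebra_simps)

lemma interpolant_sum:
  "(\<Sum>i<n. c i * interpolant d m k l b (g i) x) = interpolant d m k l b (\<lambda>p q. \<Sum>i<n. c i * g i p q) x"
  unfolding interpolant_def by (simp only: sum_distrib_left sum.distrib[symmetric]) (simp add: algebra_simps)

lemma sum_hat_grad:
  assumes "k \<le> m" "l \<le> m" "x \<in> tri_interior d m k l b"
  shows "(\<Sum>i<m\<^sup>2. c i *\<^sub>R grad (hat d m i) x) = tri_grad d m k l b (grid_fun m c)"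
proof -
  have "(\<Sum>i<m\<^sup>2. c i *\<^sub>R grad (hat d m i) x) = (\<Sum>i<m\<^sup>2. c i *\<^sub>R tri_grad d m k l b (unit_grid m i))"
    by (intro sum.cong refl) (simp add: hat_grad[OF _ assms])
  then show ?thesis by (simp only: tri_grad_sum grid_fun_def[abs_def])
qed

lemma sum_hat_value:
  assumes "x \<in> tri_interior d m k l b"
  shows "(\<Sum>i<m\<^sup>2. c i * hat d m i x) = interpolant d m k l b (grid_fun m c) x"
proof -
  have "(\<Sum>i<m\<^sup>2. c i * hat d m i x) = (\<Sum>i<m\<^sup>2. c i * interpolant d m k l b (unit_grid m i) x)"
    by (intro sum.cong refl) (simp add: hat_value[OF _ assms])
  then show ?thesis by (simp only: interpolant_sum grid_fun_def[abs_def])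
qed

section \<open>Integrals over the triangulation\<close>

lemma bounded_Omega: "bounded Omega"
proof (rule bounded_subset)
  show "bounded (cbox (0, 0) (1, 1) :: (real \<times> real) set)" by (rule bounded_cbox)
  show "Omega \<subseteq> cbox (0, 0) (1, 1)" by (auto simp: Omega_def cbox_Pair_eq)
qed

lemma mesh_interior_lmeasurable: "mesh_interior d m \<in> lmeasurable"
  by (intro lmeasurable_open open_mesh_interior bounded_subset[OF bounded_Omega mesh_interior_subset_Omega])

lemma mesh_interior_sets: "mesh_interior d m \<in> sets lebesgue"
  using mesh_interior_lmeasurable by blast

text \<open>On the mesh skeleton the integrands involve unspecified gradients, but it is a null set, and Lebesgue
  measure is complete; so the integrals may be taken over the open triangles, where all integrands are
  continuous.\<close>

lemma set_integral_Omega_eq: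
  fixes g :: "real \<times> real \<Rightarrow> real"
  assumes g: "continuous_on (mesh_interior d m) g"
  shows "(LINT x:Omega|lebesgue. g x) = (LINT x|lebesgue_on (mesh_interior d m). g x)"
proof -
  let ?U = "mesh_interior d m"
  have "?U \<in> sets borel" using open_mesh_interior by (rule borel_open)
  then have "(\<lambda>x. indicator ?U x *\<^sub>R g x) \<in> borel_measurable borel"
    using g by (rule borel_measurable_continuous_on_indicator)
  then have meas: "(\<lambda>x. indicator ?U x *\<^sub>R g x) \<in> borel_measurable lebesgue"
    by (intro measurable_completion) simp
  have "AE x in lebesgue. x \<notin> Omega - ?U"
    using negligible_mesh_skeleton by (intro AE_not_in) (simp add: negligible_iff_null_sets)
  then have ae: "AE x in lebesgue. indicator ?U x *\<^sub>R g x = indicator Omega x *\<^sub>R g x"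
    by eventually_elim (use mesh_interior_subset_Omega[of d m] in \<open>auto simp: indicator_def\<close>)
  have "(LINT x:Omega|lebesgue. g x) = (LINT x|lebesgue. indicator ?U x *\<^sub>R g x)"
    unfolding set_lebesgue_integral_def
    by (rule integral_cong_AE[symmetric]) (rule meas, rule borel_measurable_AE[OF meas ae], rule ae)
  also have "\<dots> = (LINT x|lebesgue_on ?U. g x)"
    using mesh_interior_sets by (intro integral_restrict_space[symmetric]) simp
  finally show ?thesis .
qed

text \<open>A class of integrable functions that contains the integrands of all matrix entries and has simple
  closure properties.\<close>

definition bounded_cont :: "diagonal \<Rightarrow> nat \<Rightarrow> (real \<times> real \<Rightarrow> 'a::real_normed_vector) \<Rightarrow> bool" where
  "bounded_cont d m f \<longleftrightarrow> continuous_on (mesh_interior d m) f \<and> (\<exists>B. \<forall>x\<in>mesh_interior d m. norm (f x) \<le> B)"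

lemma bounded_cont_integrable:
  fixes f :: "real \<times> real \<Rightarrow> real"
  assumes "bounded_cont d m f"
  shows "integrable (lebesgue_on (mesh_interior d m)) f"
proof -
  interpret finite_measure "lebesgue_on (mesh_interior d m)"
    by (rule finite_measure_lebesgue_on[OF mesh_interior_lmeasurable])
  obtain B where B: "\<And>x. x \<in> mesh_interior d m \<Longrightarrow> norm (f x) \<le> B"
    using assms unfolding bounded_cont_def by blast
  show ?thesis
  proof (rule integrable_const_bound[where B=B])
    show "AE x in lebesgue_on (mesh_interior d m). norm (f x) \<le> B"
      by (rule AE_I2) (use B in simp)
    show "f \<in> borel_measurable (lebesgue_on (mesh_interior d m))"
      using assms by (intro continuous_imp_measurable_on_sets_lebesgue mesh_interior_sets) (simp add: bounded_cont_def)
  qed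
qed

lemma bounded_cont_const: "bounded_cont d m (\<lambda>_. c)"
  unfolding bounded_cont_def by (auto intro: continuous_on_const exI[of _ "norm c"])

lemma bounded_cont_add:
  assumes "bounded_cont d m f" "bounded_cont d m g"
  shows "bounded_cont d m (\<lambda>x. f x + g x)"
proof -
  from assms obtain A B where "\<And>x. x \<in> mesh_interior d m \<Longrightarrow> norm (f x) \<le> A"
    "\<And>x. x \<in> mesh_interior d m \<Longrightarrow> norm (g x) \<le> B" unfolding bounded_cont_def by blast
  then have "\<forall>x\<in>mesh_interior d m. norm (f x + g x) \<le> A + B" by (blast intro: norm_add_rule_thm add_mono order_trans norm_triangle_ineq)
  then show ?thesis using assms unfolding bounded_cont_def by (blast intro: continuous_on_add)
qed

lemma bounded_cont_inner:
  assumes "bounded_cont d m f" "bounded_cont d m g"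
  shows "bounded_cont d m (\<lambda>x. inner (f x) (g x))"
proof -
  from assms obtain A B where A: "\<And>x. x \<in> mesh_interior d m \<Longrightarrow> norm (f x) \<le> A"
    and B: "\<And>x. x \<in> mesh_interior d m \<Longrightarrow> norm (g x) \<le> B" unfolding bounded_cont_def by blast
  have "norm (inner (f x) (g x)) \<le> A * B" if "x \<in> mesh_interior d m" for x
  proof -
    have "norm (inner (f x) (g x)) \<le> norm (f x) * norm (g x)"
      using Cauchy_Schwarz_ineq2[of "f x" "g x"] by simp
    also have "\<dots> \<le> A * B"
      using A[OF that] B[OF that] order_trans[OF norm_ge_zero A[OF that]] by (intro mult_mono) auto
    finally show ?thesis .
  qed
  then show ?thesis using assms unfolding bounded_cont_def by (blast intro: continuous_on_inner)
qed

lemma bounded_cont_mult: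
  fixes f g :: "real \<times> real \<Rightarrow> real"
  assumes "bounded_cont d m f" "bounded_cont d m g"
  shows "bounded_cont d m (\<lambda>x. f x * g x)"
  using bounded_cont_inner[OF assms] by simp

lemma bounded_cont_scaleR: "bounded_cont d m f \<Longrightarrow> bounded_cont d m (\<lambda>x. c *\<^sub>R f x)"
  unfolding bounded_cont_def by (auto intro!: continuous_intros) (metis mult_left_mono abs_ge_zero)

lemma bounded_cont_sum:
  assumes "\<And>i. i < n \<Longrightarrow> bounded_cont d m (f i)"
  shows "bounded_cont d m (\<lambda>x. \<Sum>i<(n::nat). f i x)"
  using assms by (induction n) (auto intro: bounded_cont_const bounded_cont_add)

abbreviation triangle_index :: "nat \<Rightarrow> (nat \<times> nat \<times> bool) set" where
  "triangle_index m \<equiv> {..m} \<times> {..m} \<times> UNIV"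

text \<open>Continuous because locally constant on an open set, bounded because there are finitely many triangles.\<close>

lemma bounded_cont_piecewise_constant:
  assumes f: "\<And>k l b x. k \<le> m \<Longrightarrow> l \<le> m \<Longrightarrow> x \<in> tri_interior d m k l b \<Longrightarrow> f x = g k l b"
  shows "bounded_cont d m f"
proof -
  have "continuous_on (mesh_interior d m) f"
    unfolding mesh_interior_def
  proof (rule continuous_on_open_UN)
    fix t assume t: "t \<in> triangle_index m"
    obtain k l b where tt: "t = (k, l, b)" by (cases t)
    show "open (case t of (k, l, b) \<Rightarrow> tri_interior d m k l b)" by (simp add: tt open_tri_interior)
    have "continuous_on (tri_interior d m k l b) (\<lambda>_. g k l b)" by (rule continuous_on_const)
    then have "continuous_on (tri_interior d m k l b) f"
      using t tt f by (subst continuous_on_cong[OF refl, of _ f "\<lambda>_. g k l b"]) auto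
    then show "continuous_on (case t of (k, l, b) \<Rightarrow> tri_interior d m k l b) f" by (simp add: tt)
  qed
  moreover have "norm (f x) \<le> (\<Sum>(k, l, b)\<in>triangle_index m. norm (g k l b))" if "x \<in> mesh_interior d m" for x
  proof -
    from that obtain k l b where klb: "k \<le> m" "l \<le> m" "x \<in> tri_interior d m k l b" by (rule mesh_interiorE)
    have "(case (k, l, b) of (k, l, b) \<Rightarrow> norm (g k l b)) \<le> (\<Sum>(k, l, b)\<in>triangle_index m. norm (g k l b))"
      by (rule member_le_sum) (use klb in auto)
    then show ?thesis by (simp add: f[OF klb])
  qed
  ultimately show ?thesis unfolding bounded_cont_def by blast
qed

lemma bounded_cont_hat_grad: "i < m\<^sup>2 \<Longrightarrow> bounded_cont d m (grad (hat d m i))"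
  by (rule bounded_cont_piecewise_constant) (rule hat_grad)

lemma bounded_cont_hat:
  assumes "i < m\<^sup>2"
  shows "bounded_cont d m (hat d m i)"
proof -
  have c: "continuous_on (closure Omega) (hat d m i)"
    using hat_in_fe_space[OF assms] unfolding fe_space_def by blast
  have "continuous_on (mesh_interior d m) (hat d m i)"
    by (rule continuous_on_subset[OF c order_trans[OF mesh_interior_subset_Omega closure_subset]])
  moreover have "norm (hat d m i x) \<le> 1" for x
  proof -
    have "norm (max 0 (1 - z)) \<le> 1" if "0 \<le> z" for z :: real using that by simp
    moreover have "0 \<le> max (max \<bar>s\<bar> t) r" for s t r :: real by (simp add: le_max_iff_disj)
    ultimately show ?thesis unfolding hat_eq[OF assms] hat_fun_def Let_def by blast
  qed
  ultimately show ?thesis unfolding bounded_cont_def by blast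
qed

lemma integral_piecewise_constant:
  fixes f :: "real \<times> real \<Rightarrow> real"
  assumes f: "\<And>k l b x. k \<le> m \<Longrightarrow> l \<le> m \<Longrightarrow> x \<in> tri_interior d m k l b \<Longrightarrow> f x = g k l b"
  shows "(LINT x|lebesgue_on (mesh_interior d m). f x)
    = (\<Sum>(k, l, b)\<in>triangle_index m. g k l b * measure lebesgue (tri_interior d m k l b))"
proof -
  let ?U = "mesh_interior d m"
  have ind: "indicat_real (tri_interior d m k' l' b') x = of_bool ((k', l', b') = (k, l, b))"
    if "x \<in> tri_interior d m k l b" for x k l b k' l' b'
  proof (cases "(k', l', b') = (k, l, b)")
    case False
    then have "x \<notin> tri_interior d m k' l' b'" using tri_interior_unique[OF that] by blast
    then show ?thesis using False by (simp add: indicator_def)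
  qed (use that in simp)
  define h where "h t x = (case t of (k, l, b) \<Rightarrow> g k l b * indicat_real (tri_interior d m k l b) x)" for t x
  have h: "h (k, l, b) = (\<lambda>x. g k l b * indicat_real (tri_interior d m k l b) x)" for k l b
    by (simp add: h_def fun_eq_iff)
  have "(LINT x|lebesgue_on ?U. f x) = (LINT x|lebesgue_on ?U. (\<Sum>t\<in>triangle_index m. h t x))"
  proof (rule Bochner_Integration.integral_cong[OF refl])
    fix x assume "x \<in> space (lebesgue_on ?U)"
    then have "x \<in> ?U" by simp
    then obtain k l b where klb: "k \<le> m" "l \<le> m" "x \<in> tri_interior d m k l b" by (rule mesh_interiorE)
    have "h t x = (if t = (k, l, b) then g k l b else 0)" for t
    proof -
      obtain k' l' b' where t: "t = (k', l', b')" by (cases t)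
      show ?thesis unfolding t h ind[OF klb(3)] by auto
    qed
    then have "(\<Sum>t\<in>triangle_index m. h t x) = g k l b" using klb by simp
    then show "f x = (\<Sum>t\<in>triangle_index m. h t x)" by (simp only: f[OF klb])
  qed
  also have "\<dots> = (\<Sum>t\<in>triangle_index m. (LINT x|lebesgue_on ?U. h t x))"
  proof (rule Bochner_Integration.integral_sum)
    fix t assume "t \<in> triangle_index m"
    obtain k l b where t: "t = (k, l, b)" by (cases t)
    have "bounded_cont d m (h t)"
      unfolding t h
      by (rule bounded_cont_piecewise_constant[where g="\<lambda>k' l' b'. g k l b * of_bool ((k, l, b) = (k', l', b'))"])
         (rule arg_cong[OF ind])
    then show "integrable (lebesgue_on ?U) (h t)" by (rule bounded_cont_integrable)
  qed
  also have "\<dots> = (\<Sum>(k, l, b)\<in>triangle_index m. g k l b * measure lebesgue (tri_interior d m k l b))"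
  proof (rule sum.cong[OF refl])
    fix t assume t: "t \<in> triangle_index m"
    obtain k l b where tt: "t = (k, l, b)" by (cases t)
    have sub: "tri_interior d m k l b \<subseteq> ?U" using t tt by (intro tri_interior_subset_mesh_interior) auto
    have "measure (lebesgue_on ?U) (tri_interior d m k l b \<inter> ?U) = measure lebesgue (tri_interior d m k l b)"
      using sub mesh_interior_sets by (subst measure_restrict_space) (auto simp: Int_absorb2)
    then have "(LINT x|lebesgue_on ?U. indicat_real (tri_interior d m k l b) x) = measure lebesgue (tri_interior d m k l b)"
      by simp
    then show "(LINT x|lebesgue_on ?U. h t x)
        = (case t of (k, l, b) \<Rightarrow> g k l b * measure lebesgue (tri_interior d m k l b))"
      unfolding tt h prod.case by (simp only: integral_mult_right_zero)
  qed
  finally show ?thesis .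
qed

lemma tri_interior_lmeasurable:
  assumes "k \<le> m" "l \<le> m"
  shows "tri_interior d m k l b \<in> lmeasurable"
  by (rule lmeasurable_open[OF bounded_subset[OF bounded_Omega] open_tri_interior])
     (rule order_trans[OF tri_interior_subset_mesh_interior[OF assms] mesh_interior_subset_Omega])

lemma measure_square:
  fixes p q w :: real
  assumes "0 \<le> w"
  shows "measure lebesgue (cbox (p, q) (p + w, q + w)) = w\<^sup>2"
proof -
  have "measure lebesgue (cbox (p, q) (p + w, q + w)) = measure lborel (cbox (p, q) (p + w, q + w))" by simp
  also have "\<dots> = measure lborel {p..p + w} * measure lborel {q..q + w}"
    unfolding content_Pair by simp
  finally show ?thesis using assms by (simp add: power2_eq_square)
qed

text \<open>The area is \<open>1/(2 N\<^sup>2)\<close>, but two-sided bounds up to constants suffice.  They come from boxes: the cell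
  around the triangle, and a square of side \<open>1/(4 N)\<close> inside it.\<close>

lemma tri_interior_measure_le:
  assumes "k \<le> m" "l \<le> m"
  shows "measure lebesgue (tri_interior d m k l b) \<le> 1 / (real (m + 1))\<^sup>2"
proof -
  define N where "N = real (m + 1)"
  have N: "0 < N" by (simp add: N_def)
  let ?B = "cbox (real k / N, real l / N) (real k / N + 1 / N, real l / N + 1 / N)"
  have "tri_interior d m k l b \<subseteq> ?B"
  proof
    fix x assume "x \<in> tri_interior d m k l b"
    note c = tri_interior_cell[OF this, folded N_def]
    have "real k / N \<le> fst x" "fst x \<le> (real k + 1) / N" "real l / N \<le> snd x" "snd x \<le> (real l + 1) / N"
      using c N by (simp_all add: pos_divide_le_eq pos_le_divide_eq mult.commute)
    then show "x \<in> ?B" by (cases x) (simp add: cbox_Pair_eq add_divide_distrib)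
  qed
  then have "measure lebesgue (tri_interior d m k l b) \<le> measure lebesgue ?B"
    by (intro measure_mono_fmeasurable lmeasurable_cbox fmeasurableD[OF tri_interior_lmeasurable[OF assms]])
  also have "\<dots> = (1 / N)\<^sup>2" by (rule measure_square) (use N in simp)
  finally show ?thesis by (simp add: N_def power_one_over)
qed

text \<open>The square is centred at the point whose barycentric coordinates along the legs are both \<open>1/4\<close>.\<close>

lemma tri_interior_measure_ge:
  assumes "k \<le> m" "l \<le> m"
  shows "1 / (16 * (real (m + 1))\<^sup>2) \<le> measure lebesgue (tri_interior d m k l b)"
proof -
  define N where "N = real (m + 1)"
  have N: "0 < N" by (simp add: N_def)
  define p where "p = real (corner_col d b k) + sgn_x d b / 4 - 1 / 8"
  define q where "q = real (corner_row b l) + sgn_y b / 4 - 1 / 8"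
  let ?B = "cbox (p / N, q / N) (p / N + 1 / (4 * N), q / N + 1 / (4 * N))"
  have "?B \<subseteq> tri_interior d m k l b"
  proof
    fix x assume "x \<in> ?B"
    moreover have "z / N + 1 / (4 * N) = (z + 1 / 4) / N" for z using N by (simp add: field_simps)
    ultimately have "p / N \<le> fst x" "fst x \<le> (p + 1 / 4) / N" "q / N \<le> snd x" "snd x \<le> (q + 1 / 4) / N"
      by (cases x; simp add: cbox_Pair_eq)+
    then have c: "p \<le> N * fst x" "N * fst x \<le> p + 1 / 4" "q \<le> N * snd x" "N * snd x \<le> q + 1 / 4"
      using N by (simp_all add: pos_divide_le_eq pos_le_divide_eq mult.commute)
    have "1 / 8 \<le> bary_x d m k b x \<and> bary_x d m k b x \<le> 3 / 8"
      using c(1,2) unfolding bary_x_def N_def[symmetric] p_def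
      by (cases "corner_on_right d b") (simp_all add: sgn_x_def)
    moreover have "1 / 8 \<le> bary_y m l b x \<and> bary_y m l b x \<le> 3 / 8"
      using c(3,4) unfolding bary_y_def N_def[symmetric] q_def
      by (cases b) (simp_all add: sgn_y_def)
    ultimately show "x \<in> tri_interior d m k l b" unfolding tri_interior_def mem_Collect_eq by linarith
  qed
  then have "measure lebesgue ?B \<le> measure lebesgue (tri_interior d m k l b)"
    by (intro measure_mono_fmeasurable tri_interior_lmeasurable[OF assms]) auto
  moreover have "measure lebesgue ?B = (1 / (4 * N))\<^sup>2" by (rule measure_square) (use N in simp)
  moreover have "(1 / (4 * N))\<^sup>2 = 1 / (16 * N\<^sup>2)" by (simp add: power_divide power_mult_distrib)
  ultimately show ?thesis unfolding N_def by (simp only:)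
qed

lemma unit_grid_zero: "i < m\<^sup>2 \<Longrightarrow> \<not> (1 \<le> k \<and> k \<le> m \<and> 1 \<le> l \<and> l \<le> m) \<Longrightarrow> unit_grid m i k l = 0"
  using node_index_bounds[of i m] by (auto simp: unit_grid_def)

lemma grid_fun_zero_boundary: "zero_boundary m (grid_fun m c)"
  unfolding zero_boundary_def grid_fun_def by (intro allI impI sum.neutral ballI) (simp add: unit_grid_zero)

lemma grid_fun_node:
  assumes "i < m\<^sup>2"
  shows "grid_fun m c (col_of m i) (row_of m i) = c i"
proof -
  have "unit_grid m j (col_of m i) (row_of m i) = of_bool (j = i)" for j
    using node_index_inj[of m i j] by (auto simp: unit_grid_def)
  then have "grid_fun m c (col_of m i) (row_of m i) = (\<Sum>j<m\<^sup>2. if j = i then c i else 0)"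
    unfolding grid_fun_def by (intro sum.cong refl) auto
  then show ?thesis using assms by simp
qed

lemma triangle_sum:
  "(\<Sum>(k, l, b)\<in>triangle_index m. f k l b) = (\<Sum>k\<le>m. \<Sum>l\<le>m. f k l True + f k l False)"
  by (simp add: sum.cartesian_product[symmetric] UNIV_bool add.commute)

lemma triangle_sum_mono:
  fixes f g :: "nat \<Rightarrow> nat \<Rightarrow> bool \<Rightarrow> real"
  assumes "\<And>k l b. k \<le> m \<Longrightarrow> l \<le> m \<Longrightarrow> f k l b \<le> g k l b"
  shows "(\<Sum>(k, l, b)\<in>triangle_index m. f k l b) \<le> (\<Sum>(k, l, b)\<in>triangle_index m. g k l b)"
  using assms by (intro sum_mono) auto

lemma triangle_sum_mult:
  fixes f :: "nat \<Rightarrow> nat \<Rightarrow> bool \<Rightarrow> real"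
  shows "(\<Sum>(k, l, b)\<in>triangle_index m. f k l b * r) = (\<Sum>(k, l, b)\<in>triangle_index m. f k l b) * r"
  by (simp add: sum_distrib_right case_prod_beta)

lemma integral_le_piecewise_constant:
  fixes f :: "real \<times> real \<Rightarrow> real"
  assumes f: "bounded_cont d m f"
    and le: "\<And>k l b x. k \<le> m \<Longrightarrow> l \<le> m \<Longrightarrow> x \<in> tri_interior d m k l b \<Longrightarrow> f x \<le> g k l b"
  shows "(LINT x|lebesgue_on (mesh_interior d m). f x)
    \<le> (\<Sum>(k, l, b)\<in>triangle_index m. g k l b * measure lebesgue (tri_interior d m k l b))"
proof -
  \<comment> \<open>the piecewise constant majorant; the triangle that contains \<open>x\<close> is unique\<close>
  define G where "G x = (case (SOME t. case t of (k, l, b) \<Rightarrow> x \<in> tri_interior d m k l b) of (k, l, b) \<Rightarrow> g k l b)" for x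
  have G: "G x = g k l b" if "x \<in> tri_interior d m k l b" for k l b x
  proof -
    have "(SOME t. case t of (k, l, b) \<Rightarrow> x \<in> tri_interior d m k l b) = (k, l, b)"
    proof (rule some_equality)
      show "case (k, l, b) of (k, l, b) \<Rightarrow> x \<in> tri_interior d m k l b" using that by simp
      fix t assume "case t of (k, l, b) \<Rightarrow> x \<in> tri_interior d m k l b"
      then show "t = (k, l, b)" using tri_interior_unique[OF that] by (cases t) auto
    qed
    then show ?thesis by (simp add: G_def)
  qed
  have "(LINT x|lebesgue_on (mesh_interior d m). f x) \<le> (LINT x|lebesgue_on (mesh_interior d m). G x)"
  proof (rule integral_mono)
    show "integrable (lebesgue_on (mesh_interior d m)) f" by (rule bounded_cont_integrable[OF f])
    show "integrable (lebesgue_on (mesh_interior d m)) G"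
      by (rule bounded_cont_integrable[OF bounded_cont_piecewise_constant]) (rule G)
    fix x assume "x \<in> space (lebesgue_on (mesh_interior d m))"
    then have "x \<in> mesh_interior d m" by simp
    then obtain k l b where klb: "k \<le> m" "l \<le> m" "x \<in> tri_interior d m k l b" by (rule mesh_interiorE)
    show "f x \<le> G x" unfolding G[OF klb(3)] by (rule le[OF klb])
  qed
  also have "\<dots> = (\<Sum>(k, l, b)\<in>triangle_index m. g k l b * measure lebesgue (tri_interior d m k l b))"
    by (rule integral_piecewise_constant) (rule G)
  finally show ?thesis .
qed

definition fe_grad :: "diagonal \<Rightarrow> nat \<Rightarrow> (nat \<Rightarrow> real) \<Rightarrow> real \<times> real \<Rightarrow> real \<times> real" where
  "fe_grad d m c x = (\<Sum>i<m\<^sup>2. c i *\<^sub>R grad (hat d m i) x)"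

definition fe_fun :: "diagonal \<Rightarrow> nat \<Rightarrow> (nat \<Rightarrow> real) \<Rightarrow> real \<times> real \<Rightarrow> real" where
  "fe_fun d m c x = (\<Sum>i<m\<^sup>2. c i * hat d m i x)"

definition dirichlet :: "diagonal \<Rightarrow> nat \<Rightarrow> (nat \<Rightarrow> real) \<Rightarrow> real" where
  "dirichlet d m c = (LINT x|lebesgue_on (mesh_interior d m). (norm (fe_grad d m c x))\<^sup>2)"

lemma bounded_cont_fe_grad: "bounded_cont d m (fe_grad d m c)"
  unfolding fe_grad_def[abs_def] by (intro bounded_cont_sum bounded_cont_scaleR bounded_cont_hat_grad)

lemma bounded_cont_fe_fun: "bounded_cont d m (fe_fun d m c)"
  unfolding fe_fun_def[abs_def] by (intro bounded_cont_sum bounded_cont_mult bounded_cont_const bounded_cont_hat)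

lemma norm_tri_grad_square:
  "(norm (tri_grad d m k l b c))\<^sup>2 = (real (m + 1))\<^sup>2 *
     ((c (Suc k) (corner_row b l) - c k (corner_row b l))\<^sup>2 + (c (corner_col d b k) (Suc l) - c (corner_col d b k) l)\<^sup>2)"
  by (simp add: tri_grad_def norm_Pair power_mult_distrib distrib_left del: of_nat_add)

text \<open>For either direction of the diagonals, the legs of the two triangles of a cell are the four sides of the
  cell.\<close>

lemma tri_grads_cell_energy:
  "(norm (tri_grad d m k l True c))\<^sup>2 + (norm (tri_grad d m k l False c))\<^sup>2 = (real (m + 1))\<^sup>2 * cell_energy c k l"
  unfolding norm_tri_grad_square cell_energy_def
  by (cases d) (simp_all add: corner_row_def corner_col_def corner_on_right_def algebra_simps)

lemma dirichlet_eq: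
  "dirichlet d m c = (\<Sum>(k, l, b)\<in>triangle_index m.
     (norm (tri_grad d m k l b (grid_fun m c)))\<^sup>2 * measure lebesgue (tri_interior d m k l b))"
  unfolding dirichlet_def by (rule integral_piecewise_constant) (simp add: fe_grad_def sum_hat_grad)

lemma triangle_sum_tri_grad:
  "(\<Sum>(k, l, b)\<in>triangle_index m. (norm (tri_grad d m k l b c))\<^sup>2) = (real (m + 1))\<^sup>2 * grid_energy m c"
  unfolding triangle_sum tri_grads_cell_energy grid_energy_def by (simp only: sum_distrib_left)

lemma dirichlet_le: "dirichlet d m c \<le> grid_energy m (grid_fun m c)"
proof -
  have "dirichlet d m c \<le> (\<Sum>(k, l, b)\<in>triangle_index m.
      (norm (tri_grad d m k l b (grid_fun m c)))\<^sup>2 * (1 / (real (m + 1))\<^sup>2))"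
    unfolding dirichlet_eq by (intro triangle_sum_mono mult_left_mono tri_interior_measure_le) simp_all
  also have "\<dots> = (\<Sum>(k, l, b)\<in>triangle_index m. (norm (tri_grad d m k l b (grid_fun m c)))\<^sup>2) * (1 / (real (m + 1))\<^sup>2)"
    by (rule triangle_sum_mult)
  finally show ?thesis unfolding triangle_sum_tri_grad by simp
qed

lemma dirichlet_ge: "grid_energy m (grid_fun m c) / 16 \<le> dirichlet d m c"
proof -
  have "(\<Sum>(k, l, b)\<in>triangle_index m. (norm (tri_grad d m k l b (grid_fun m c)))\<^sup>2) * (1 / (16 * (real (m + 1))\<^sup>2))
      = (\<Sum>(k, l, b)\<in>triangle_index m. (norm (tri_grad d m k l b (grid_fun m c)))\<^sup>2 * (1 / (16 * (real (m + 1))\<^sup>2)))"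
    by (rule triangle_sum_mult[symmetric])
  also have "\<dots> \<le> dirichlet d m c"
    unfolding dirichlet_eq by (intro triangle_sum_mono mult_left_mono tri_interior_measure_ge) simp_all
  finally show ?thesis unfolding triangle_sum_tri_grad by simp
qed

lemma convex_combination_square_le:
  fixes A B C :: real
  assumes "0 \<le> u" "0 \<le> v" "u + v \<le> 1"
  shows "((1 - u - v) * A + u * B + v * C)\<^sup>2 \<le> A\<^sup>2 + B\<^sup>2 + C\<^sup>2"
proof -
  have "((1 - u - v) * A + u * B + v * C)\<^sup>2 + ((1 - u - v) * u * (A - B)\<^sup>2 + (1 - u - v) * v * (A - C)\<^sup>2 + u * v * (B - C)\<^sup>2)
      = (1 - u - v) * A\<^sup>2 + u * B\<^sup>2 + v * C\<^sup>2"
    by (simp add: power2_eq_square algebra_simps)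
  moreover have "0 \<le> (1 - u - v) * u * (A - B)\<^sup>2 + (1 - u - v) * v * (A - C)\<^sup>2 + u * v * (B - C)\<^sup>2"
    using assms by (intro add_nonneg_nonneg mult_nonneg_nonneg) auto
  moreover have "(1 - u - v) * A\<^sup>2 \<le> 1 * A\<^sup>2" "u * B\<^sup>2 \<le> 1 * B\<^sup>2" "v * C\<^sup>2 \<le> 1 * C\<^sup>2"
    using assms by (intro mult_right_mono; simp)+
  ultimately show ?thesis by linarith
qed

text \<open>On a triangle the function is a convex combination of three of the four values at the corners of the
  cell.\<close>

lemma L2_norm_fe_fun_le:
  "(LINT x|lebesgue_on (mesh_interior d m). (fe_fun d m c x)\<^sup>2)
     \<le> 8 / (real (m + 1))\<^sup>2 * grid_sumsq m (grid_fun m c)"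
proof -
  let ?c = "grid_fun m c"
  define g where "g k l = (?c k l)\<^sup>2 + (?c k (Suc l))\<^sup>2 + (?c (Suc k) l)\<^sup>2 + (?c (Suc k) (Suc l))\<^sup>2" for k l
  have "(LINT x|lebesgue_on (mesh_interior d m). (fe_fun d m c x)\<^sup>2)
      \<le> (\<Sum>(k, l, b)\<in>triangle_index m. g k l * measure lebesgue (tri_interior d m k l b))"
  proof (rule integral_le_piecewise_constant)
    show "bounded_cont d m (\<lambda>x. (fe_fun d m c x)\<^sup>2)"
      unfolding power2_eq_square by (intro bounded_cont_mult bounded_cont_fe_fun)
    fix k l b x assume x: "x \<in> tri_interior d m k l b"
    have "(fe_fun d m c x)\<^sup>2 \<le> (?c (corner_col d b k) (corner_row b l))\<^sup>2
        + (?c (other_col d b k) (corner_row b l))\<^sup>2 + (?c (corner_col d b k) (other_row b l))\<^sup>2"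
      unfolding fe_fun_def sum_hat_value[OF x] interpolant_def
      by (rule convex_combination_square_le) (use x in \<open>simp_all add: tri_interior_def\<close>)
    also have "\<dots> \<le> g k l"
      by (cases d; cases b) (simp_all add: g_def corner_col_def other_col_def corner_row_def other_row_def corner_on_right_def)
    finally show "(fe_fun d m c x)\<^sup>2 \<le> g k l" .
  qed
  also have "\<dots> \<le> (\<Sum>(k, l, b)\<in>triangle_index m. g k l * (1 / (real (m + 1))\<^sup>2))"
    by (intro triangle_sum_mono mult_left_mono tri_interior_measure_le) (simp_all add: g_def)
  also have "\<dots> = 2 / (real (m + 1))\<^sup>2 * (\<Sum>k\<le>m. \<Sum>l\<le>m. g k l)"
    unfolding triangle_sum sum_distrib_left by (intro sum.cong refl) simp
  also have "(\<Sum>k\<le>m. \<Sum>l\<le>m. g k l) \<le> 4 * grid_sumsq m ?c"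
    using grid_sumsq_shift[OF grid_fun_zero_boundary[of m c]] unfolding g_def sum.distrib
    by (simp add: grid_sumsq_def)
  finally show ?thesis by (simp add: mult_left_mono field_simps del: of_nat_add)
qed

text \<open>Used for the diagonal entries: they only see values of the coefficient near the node.\<close>

lemma hat_grad_local:
  assumes i: "i < m\<^sup>2" and x: "x \<in> mesh_interior d m" and nz: "grad (hat d m i) x \<noteq> 0"
  shows "dist x (node m i) \<le> 2 / real (m + 1)"
proof -
  define N where "N = real (m + 1)"
  have N: "0 < N" by (simp add: N_def)
  from x obtain k l b where klb: "k \<le> m" "l \<le> m" "x \<in> tri_interior d m k l b" by (rule mesh_interiorE)
  let ?p = "col_of m i" and ?q = "row_of m i"
  have "tri_grad d m k l b (unit_grid m i) \<noteq> 0" using nz hat_grad[OF i klb] by simp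
  moreover have "tri_grad d m k l b (unit_grid m i) = 0" if far: "\<not> ((?p = k \<or> ?p = Suc k) \<and> (?q = l \<or> ?q = Suc l))"
  proof -
    have "unit_grid m i k' l' = 0" if "k' = k \<or> k' = Suc k" "l' = l \<or> l' = Suc l" for k' l'
      using that far by (auto simp: unit_grid_def)
    then show ?thesis by (simp add: tri_grad_def zero_prod_def corner_row_def corner_col_def)
  qed
  ultimately have "(?p = k \<or> ?p = Suc k) \<and> (?q = l \<or> ?q = Suc l)" by blast
  then have "\<bar>N * fst x - real ?p\<bar> \<le> 1" "\<bar>N * snd x - real ?q\<bar> \<le> 1"
    using tri_interior_cell[OF klb(3), folded N_def] by auto
  then have "\<bar>fst x - real ?p / N\<bar> \<le> 1 / N" "\<bar>snd x - real ?q / N\<bar> \<le> 1 / N"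
    using N by (simp_all add: abs_le_iff field_simps)
  moreover have "dist x (node m i) \<le> \<bar>fst x - real ?p / N\<bar> + \<bar>snd x - real ?q / N\<bar>"
  proof -
    have "x - node m i = (fst x - real ?p / N, snd x - real ?q / N)"
      by (simp add: node_eq grid_point_def N_def prod_eq_iff)
    then show ?thesis unfolding dist_norm using norm_Pair_le[of "fst x - real ?p / N" "snd x - real ?q / N"] by simp
  qed
  ultimately show ?thesis unfolding N_def[symmetric] by linarith
qed

section \<open>Quadratic forms of the finite element matrices\<close>

lemma Theta_entry:
  assumes "i < m\<^sup>2" "j < m\<^sup>2" "bounded_cont d m a"
  shows "Theta_mat d m a $$ (i, j) =
    (LINT x|lebesgue_on (mesh_interior d m). a x * inner (grad (hat d m i) x) (grad (hat d m j) x))"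
proof -
  have "bounded_cont d m (\<lambda>x. a x * inner (grad (hat d m i) x) (grad (hat d m j) x))"
    by (intro bounded_cont_mult bounded_cont_inner bounded_cont_hat_grad assms)
  then have "continuous_on (mesh_interior d m) (\<lambda>x. a x * inner (grad (hat d m i) x) (grad (hat d m j) x))"
    by (simp only: bounded_cont_def)
  from set_integral_Omega_eq[OF this] show ?thesis using assms(1,2) by (simp add: Theta_mat_def)
qed

lemma Psi_entry:
  assumes "i < m\<^sup>2" "j < m\<^sup>2" "bounded_cont d m \<beta>"
  shows "Psi_mat d m \<beta> $$ (i, j) =
    - (LINT x|lebesgue_on (mesh_interior d m). inner (grad (hat d m i) x) (\<beta> x) * hat d m j x)"
proof -
  have "bounded_cont d m (\<lambda>x. inner (grad (hat d m i) x) (\<beta> x) * hat d m j x)"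
    by (intro bounded_cont_mult bounded_cont_inner bounded_cont_hat_grad bounded_cont_hat assms)
  then have "continuous_on (mesh_interior d m) (\<lambda>x. inner (grad (hat d m i) x) (\<beta> x) * hat d m j x)"
    by (simp only: bounded_cont_def)
  from set_integral_Omega_eq[OF this] show ?thesis using assms(1,2) by (simp add: Psi_mat_def)
qed

definition mat_form :: "nat \<Rightarrow> real mat \<Rightarrow> (nat \<Rightarrow> real) \<Rightarrow> (nat \<Rightarrow> real) \<Rightarrow> real" where
  "mat_form n A x y = (\<Sum>i<n. \<Sum>j<n. x i * A $$ (i, j) * y j)"

lemma mat_form_integral:
  assumes g: "\<And>i j. i < n \<Longrightarrow> j < n \<Longrightarrow> bounded_cont d m (g i j)"
    and A: "\<And>i j. i < n \<Longrightarrow> j < n \<Longrightarrow> A $$ (i, j) = (LINT x|lebesgue_on (mesh_interior d m). g i j x)"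
  shows "mat_form n A c e = (LINT x|lebesgue_on (mesh_interior d m). (\<Sum>i<n. \<Sum>j<n. c i * g i j x * e j))"
proof -
  let ?M = "lebesgue_on (mesh_interior d m)"
  have bc: "bounded_cont d m (\<lambda>x. c i * g i j x * e j)" if "i < n" "j < n" for i j
    by (intro bounded_cont_mult bounded_cont_const g that)
  have "(LINT x|?M. (\<Sum>i<n. \<Sum>j<n. c i * g i j x * e j)) = (\<Sum>i<n. (LINT x|?M. (\<Sum>j<n. c i * g i j x * e j)))"
    by (rule Bochner_Integration.integral_sum) (intro bounded_cont_integrable bounded_cont_sum bc, simp_all)
  also have "\<dots> = (\<Sum>i<n. \<Sum>j<n. (LINT x|?M. c i * g i j x * e j))"
    by (intro sum.cong refl Bochner_Integration.integral_sum bounded_cont_integrable bc) simp_all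
  also have "\<dots> = mat_form n A c e"
    unfolding mat_form_def by (intro sum.cong refl) (simp add: A)
  finally show ?thesis ..
qed

lemma Theta_one_form:
  "mat_form (m\<^sup>2) (Theta_mat d m (\<lambda>_. 1)) c c = dirichlet d m c"
proof -
  have "mat_form (m\<^sup>2) (Theta_mat d m (\<lambda>_. 1)) c c = (LINT x|lebesgue_on (mesh_interior d m).
      (\<Sum>i<m\<^sup>2. \<Sum>j<m\<^sup>2. c i * inner (grad (hat d m i) x) (grad (hat d m j) x) * c j))"
    by (rule mat_form_integral)
       (auto intro: bounded_cont_inner bounded_cont_hat_grad simp: Theta_entry bounded_cont_const)
  also have "\<dots> = dirichlet d m c"
    unfolding dirichlet_def
  proof (rule Bochner_Integration.integral_cong[OF refl])
    fix x
    show "(\<Sum>i<m\<^sup>2. \<Sum>j<m\<^sup>2. c i * inner (grad (hat d m i) x) (grad (hat d m j) x) * c j) = (norm (fe_grad d m c x))\<^sup>2"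
      unfolding fe_grad_def power2_norm_eq_inner inner_sum_left inner_sum_right
      by (intro sum.cong refl) (simp add: mult_ac inner_commute)
  qed
  finally show ?thesis .
qed

text \<open>Young's inequality \<open>2 p q \<le> t p\<^sup>2 + q\<^sup>2 / t\<close> is applied pointwise; the parameter \<open>t\<close> is matched
  later to the ratio of the two norms.\<close>

lemma Psi_form_bound:
  assumes \<beta>: "bounded_cont d m \<beta>" and M: "\<And>x. x \<in> mesh_interior d m \<Longrightarrow> norm (\<beta> x) \<le> M" "0 \<le> M" and t: "0 < t"
  shows "\<bar>mat_form (m\<^sup>2) (Psi_mat d m \<beta>) c e\<bar>
    \<le> M / 2 * (t * dirichlet d m c + 8 / (t * (real (m + 1))\<^sup>2) * grid_sumsq m (grid_fun m e))"
proof -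
  let ?M = "lebesgue_on (mesh_interior d m)"
  let ?f = "\<lambda>x. - inner (fe_grad d m c x) (\<beta> x) * fe_fun d m e x"
  let ?g = "\<lambda>x. M / 2 * (t * (norm (fe_grad d m c x))\<^sup>2 + 1 / t * (fe_fun d m e x)\<^sup>2)"
  have "mat_form (m\<^sup>2) (Psi_mat d m \<beta>) c e = (LINT x|?M.
      (\<Sum>i<m\<^sup>2. \<Sum>j<m\<^sup>2. c i * (- 1 * (inner (grad (hat d m i) x) (\<beta> x) * hat d m j x)) * e j))"
  proof (rule mat_form_integral)
    fix i j assume ij: "i < m\<^sup>2" "j < m\<^sup>2"
    show "bounded_cont d m (\<lambda>x. - 1 * (inner (grad (hat d m i) x) (\<beta> x) * hat d m j x))"
      by (intro bounded_cont_mult bounded_cont_const bounded_cont_inner bounded_cont_hat_grad bounded_cont_hat ij \<beta>)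
    show "Psi_mat d m \<beta> $$ (i, j) = (LINT x|?M. - 1 * (inner (grad (hat d m i) x) (\<beta> x) * hat d m j x))"
      unfolding Psi_entry[OF ij \<beta>] integral_mult_right_zero by simp
  qed
  also have "\<dots> = (LINT x|?M. ?f x)"
  proof (rule Bochner_Integration.integral_cong[OF refl])
    fix x
    show "(\<Sum>i<m\<^sup>2. \<Sum>j<m\<^sup>2. c i * (- 1 * (inner (grad (hat d m i) x) (\<beta> x) * hat d m j x)) * e j) = ?f x"
      unfolding fe_grad_def fe_fun_def inner_sum_left sum_negf[symmetric] sum_product
      by (intro sum.cong refl) (simp add: mult_ac)
  qed
  finally have eq: "mat_form (m\<^sup>2) (Psi_mat d m \<beta>) c e = (LINT x|?M. ?f x)" .
  have ptw: "\<bar>?f x\<bar> \<le> ?g x" if "x \<in> mesh_interior d m" for x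
  proof -
    define p q where "p = norm (fe_grad d m c x)" and "q = \<bar>fe_fun d m e x\<bar>"
    have "\<bar>inner (fe_grad d m c x) (\<beta> x)\<bar> \<le> p * M"
      unfolding p_def using Cauchy_Schwarz_ineq2[of "fe_grad d m c x" "\<beta> x"] mult_left_mono[OF M(1)[OF that], of "norm (fe_grad d m c x)"]
      by simp
    then have "\<bar>?f x\<bar> \<le> p * M * q"
      unfolding abs_mult abs_minus_cancel q_def by (rule mult_right_mono) simp
    moreover have "2 * (p * q) \<le> t * p\<^sup>2 + 1 / t * q\<^sup>2"
    proof -
      have "0 \<le> (t * p - q)\<^sup>2 / t" using t by simp
      also have "\<dots> = t * p\<^sup>2 + 1 / t * q\<^sup>2 - 2 * (p * q)"
        using t by (simp add: power2_eq_square field_simps)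
      finally show ?thesis by simp
    qed
    then have "M / 2 * (2 * (p * q)) \<le> M / 2 * (t * p\<^sup>2 + 1 / t * q\<^sup>2)"
      using M(2) by (intro mult_left_mono) auto
    moreover have "q\<^sup>2 = (fe_fun d m e x)\<^sup>2" by (simp add: q_def)
    ultimately show ?thesis unfolding p_def by (simp add: mult_ac)
  qed
  have bcf: "bounded_cont d m ?f"
  proof -
    have "bounded_cont d m (\<lambda>x. - 1 * (inner (fe_grad d m c x) (\<beta> x) * fe_fun d m e x))"
      by (intro bounded_cont_mult bounded_cont_const bounded_cont_inner bounded_cont_fe_grad bounded_cont_fe_fun \<beta>)
    then show ?thesis by simp
  qed
  have bcD: "bounded_cont d m (\<lambda>x. (norm (fe_grad d m c x))\<^sup>2)"
    unfolding power2_norm_eq_inner by (intro bounded_cont_inner bounded_cont_fe_grad)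
  have bcL: "bounded_cont d m (\<lambda>x. (fe_fun d m e x)\<^sup>2)"
    unfolding power2_eq_square by (intro bounded_cont_mult bounded_cont_fe_fun)
  have "\<bar>LINT x|?M. ?f x\<bar> \<le> (LINT x|?M. \<bar>?f x\<bar>)" by (rule integral_abs_bound)
  also have "\<dots> \<le> (LINT x|?M. ?g x)"
  proof (rule integral_mono)
    show "integrable ?M (\<lambda>x. \<bar>?f x\<bar>)" by (rule integrable_abs[OF bounded_cont_integrable[OF bcf]])
    show "integrable ?M ?g"
      by (intro bounded_cont_integrable bounded_cont_mult bounded_cont_add bounded_cont_const bcD bcL)
  qed (use ptw in simp)
  also have "\<dots> = M / 2 * (t * dirichlet d m c + 1 / t * (LINT x|?M. (fe_fun d m e x)\<^sup>2))"
    unfolding integral_mult_right_zero dirichlet_def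
    by (subst Bochner_Integration.integral_add)
       (intro bounded_cont_integrable bounded_cont_mult bounded_cont_const bcD bcL
         | simp only: integral_mult_right_zero)+
  also have "\<dots> \<le> M / 2 * (t * dirichlet d m c + 1 / t * (8 / (real (m + 1))\<^sup>2 * grid_sumsq m (grid_fun m e)))"
    using M(2) t by (intro mult_left_mono add_left_mono L2_norm_fe_fun_le) auto
  finally show ?thesis unfolding eq by simp
qed

text \<open>The inequality between the coefficients is needed only where the gradient does not vanish, which is
  what makes local averages out of the diagonal entries.\<close>

lemma Theta_diag_mono:
  assumes i: "i < m\<^sup>2" and a: "bounded_cont d m a" and b: "bounded_cont d m b"
    and le: "\<And>x. x \<in> mesh_interior d m \<Longrightarrow> grad (hat d m i) x \<noteq> 0 \<Longrightarrow> a x \<le> b x"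
  shows "Theta_mat d m a $$ (i, i) \<le> Theta_mat d m b $$ (i, i)"
  unfolding Theta_entry[OF i i a] Theta_entry[OF i i b]
proof (rule integral_mono)
  let ?M = "lebesgue_on (mesh_interior d m)"
  show "integrable ?M (\<lambda>x. a x * inner (grad (hat d m i) x) (grad (hat d m i) x))"
    "integrable ?M (\<lambda>x. b x * inner (grad (hat d m i) x) (grad (hat d m i) x))"
    by (intro bounded_cont_integrable bounded_cont_mult bounded_cont_inner bounded_cont_hat_grad i a b)+
  fix x assume "x \<in> space ?M"
  then show "a x * inner (grad (hat d m i) x) (grad (hat d m i) x) \<le> b x * inner (grad (hat d m i) x) (grad (hat d m i) x)"
    using le[of x] by (cases "grad (hat d m i) x = 0") (simp_all add: mult_right_mono)
qed

lemma Theta_diag_const: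
  assumes i: "i < m\<^sup>2"
  shows "Theta_mat d m (\<lambda>_. e) $$ (i, i) = e * Theta_mat d m (\<lambda>_. 1) $$ (i, i)"
  unfolding Theta_entry[OF i i bounded_cont_const] by simp

text \<open>By the Poincare inequality the energy controls the sum of the squared nodal values.\<close>

lemma dirichlet_pos:
  assumes "\<exists>i<m\<^sup>2. c i \<noteq> 0"
  shows "0 < dirichlet d m c"
proof -
  from assms obtain i where i: "i < m\<^sup>2" "c i \<noteq> 0" by blast
  note b = node_index_bounds[OF i(1)]
  let ?c = "grid_fun m c"
  have "(?c (col_of m i) (row_of m i))\<^sup>2 \<le> (\<Sum>l\<le>m. (?c (col_of m i) l)\<^sup>2)"
    by (rule member_le_sum[of _ _ "\<lambda>l. (?c (col_of m i) l)\<^sup>2"]) (use b in auto)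
  also have "\<dots> \<le> grid_sumsq m ?c"
    unfolding grid_sumsq_def
    by (rule member_le_sum[of _ _ "\<lambda>k. \<Sum>l\<le>m. (?c k l)\<^sup>2"]) (use b in \<open>auto intro: sum_nonneg\<close>)
  finally have "(c i)\<^sup>2 \<le> grid_sumsq m ?c" unfolding grid_fun_node[OF i(1)] .
  moreover have "0 < (c i)\<^sup>2" using i(2) by simp
  ultimately have "0 < grid_sumsq m ?c" by linarith
  then have "0 < (real (m + 1))\<^sup>2 * grid_energy m ?c"
    using grid_poincare[OF grid_fun_zero_boundary, of m c] by linarith
  then have "0 < grid_energy m ?c" by (simp add: zero_less_mult_iff del: of_nat_add)
  then show ?thesis using dirichlet_ge[of m c d] by linarith
qed

lemma Theta_one_diag_pos:
  assumes i: "i < m\<^sup>2"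
  shows "0 < Theta_mat d m (\<lambda>_. 1) $$ (i, i)"
proof -
  let ?e = "\<lambda>k. if k = i then 1 else 0 :: real"
  have "mat_form (m\<^sup>2) (Theta_mat d m (\<lambda>_. 1)) ?e ?e
      = (\<Sum>p<m\<^sup>2. \<Sum>q<m\<^sup>2. if q = i then (if p = i then Theta_mat d m (\<lambda>_. 1) $$ (i, i) else 0) else 0)"
    unfolding mat_form_def by (intro sum.cong refl) auto
  also have "\<dots> = Theta_mat d m (\<lambda>_. 1) $$ (i, i)" using i by simp
  finally have "Theta_mat d m (\<lambda>_. 1) $$ (i, i) = dirichlet d m ?e" by (simp only: Theta_one_form)
  moreover have "0 < dirichlet d m ?e" by (rule dirichlet_pos) (use i in auto)
  ultimately show ?thesis by simp
qed

text \<open>The diagonal of \<open>D_mat\<close>: the average of \<open>a\<close> with respect to the weight \<open>\<bar>\<nabla>\<phi>\<^sub>i\<bar>\<^sup>2\<close>.\<close>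

definition diag_quot :: "diagonal \<Rightarrow> nat \<Rightarrow> (real \<times> real \<Rightarrow> real) \<Rightarrow> nat \<Rightarrow> real" where
  "diag_quot d m a i = Theta_mat d m a $$ (i, i) / Theta_mat d m (\<lambda>_. 1) $$ (i, i)"

lemma diag_quot_ge:
  assumes "i < m\<^sup>2" "bounded_cont d m a" and "\<And>x. x \<in> mesh_interior d m \<Longrightarrow> a0 \<le> a x"
  shows "a0 \<le> diag_quot d m a i"
  using Theta_diag_mono[OF assms(1) bounded_cont_const assms(2), of a0] assms(3) Theta_one_diag_pos[OF assms(1), of d]
  by (simp add: diag_quot_def Theta_diag_const[OF assms(1), of d a0] pos_le_divide_eq)

lemma node_in_Omega: "i < m\<^sup>2 \<Longrightarrow> node m i \<in> Omega"
  using node_index_bounds[of i m] by (auto simp: node_eq grid_point_def Omega_def)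

lemma diag_quot_near_node:
  assumes i: "i < m\<^sup>2" and a: "bounded_cont d m a" and lip: "L-lipschitz_on Omega a"
  shows "\<bar>diag_quot d m a i - a (node m i)\<bar> \<le> 2 * L / real (m + 1)"
proof -
  let ?y = "node m i" and ?r = "2 * L / real (m + 1)" and ?T = "Theta_mat d m (\<lambda>_. 1) $$ (i, i)"
  have near: "\<bar>a x - a ?y\<bar> \<le> ?r" if "x \<in> mesh_interior d m" "grad (hat d m i) x \<noteq> 0" for x
  proof -
    have "\<bar>a x - a ?y\<bar> \<le> L * dist x ?y"
      using lipschitz_onD[OF lip subsetD[OF mesh_interior_subset_Omega that(1)] node_in_Omega[OF i]]
      by (simp add: dist_real_def)
    also have "\<dots> \<le> L * (2 / real (m + 1))" by (intro mult_left_mono hat_grad_local[OF i that] lipschitz_on_nonneg[OF lip])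
    finally show ?thesis by (simp add: mult.commute)
  qed
  have "Theta_mat d m a $$ (i, i) \<le> (a ?y + ?r) * ?T"
    unfolding Theta_diag_const[OF i, symmetric]
    by (rule Theta_diag_mono[OF i a bounded_cont_const]) (use near in force)
  moreover have "(a ?y - ?r) * ?T \<le> Theta_mat d m a $$ (i, i)"
    unfolding Theta_diag_const[OF i, symmetric]
    by (rule Theta_diag_mono[OF i bounded_cont_const a]) (use near in force)
  ultimately have "diag_quot d m a i \<le> a ?y + ?r" "a ?y - ?r \<le> diag_quot d m a i"
    using Theta_one_diag_pos[OF i, of d] unfolding diag_quot_def
    by (simp_all add: pos_divide_le_eq pos_le_divide_eq del: of_nat_add)
  then show ?thesis by linarith
qed

section \<open>The preconditioner and the imaginary part as matrices\<close>

lemma inv_mat_works: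
  fixes A :: "'a::field mat"
  assumes A: "A \<in> carrier_mat n n" and det: "Determinant.det A \<noteq> 0"
  shows "inv_mat A \<in> carrier_mat n n" and "A * inv_mat A = 1\<^sub>m n"
proof -
  have "A \<in> Units (ring_mat TYPE('a) n n)" by (rule det_non_zero_imp_unit[OF A det])
  then obtain B where B: "mat_inverse A = Some B"
    using mat_inverse(1)[OF A, where b=n] by (cases "mat_inverse A") auto
  from mat_inverse(2)[OF A B] B
  show "inv_mat A \<in> carrier_mat n n" "A * inv_mat A = 1\<^sub>m n" by auto
qed

lemma inv_mat_unique:
  fixes A :: "'a::field mat"
  assumes A: "A \<in> carrier_mat n n" and B: "B \<in> carrier_mat n n" and BA: "B * A = 1\<^sub>m n"
  shows "inv_mat A = B"
proof -
  have "Determinant.det B * Determinant.det A = 1"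
    using Determinant.det_mult[OF B A] BA by simp
  then have "Determinant.det A \<noteq> 0" by auto
  note i = inv_mat_works[OF A this]
  have "inv_mat A = (B * A) * inv_mat A" using i(1) by (simp add: BA)
  also have "\<dots> = B * (A * inv_mat A)" using A B i(1) by (simp add: assoc_mult_mat)
  finally show ?thesis using i(2) B by simp
qed

lemma Theta_carrier: "Theta_mat d m a \<in> carrier_mat (m\<^sup>2) (m\<^sup>2)"
  by (simp add: Theta_mat_def)

lemma Psi_carrier: "Psi_mat d m \<beta> \<in> carrier_mat (m\<^sup>2) (m\<^sup>2)"
  by (simp add: Psi_mat_def)

lemma A_mat_zero: "A_mat d m a (\<lambda>_. 0) = Theta_mat d m a"
proof -
  have "Psi_mat d m (\<lambda>_. 0) = 0\<^sub>m (m\<^sup>2) (m\<^sup>2)"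
    by (intro eq_matI) (simp_all add: Psi_mat_def set_lebesgue_integral_def)
  then show ?thesis by (simp add: A_mat_def Theta_carrier)
qed

lemma D_mat_eq: "D_mat d m a = mat_diag (m\<^sup>2) (diag_quot d m a)"
proof -
  let ?n = "m\<^sup>2" and ?t = "\<lambda>i. Theta_mat d m (\<lambda>_. 1) $$ (i, i)"
  have dim: "dim_row (Theta_mat d m b) = ?n" for b using Theta_carrier by blast
  have "mat_diag ?n (\<lambda>i. 1 / ?t i) * mat_diag ?n ?t = 1\<^sub>m ?n"
    unfolding mat_diag_diag
    by (rule eq_matI) (auto simp: mat_diag_def dest: Theta_one_diag_pos[of _ m d])
  then have "inv_mat (mat_diag ?n ?t) = mat_diag ?n (\<lambda>i. 1 / ?t i)"
    by (intro inv_mat_unique[of _ ?n]) simp_all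
  then show ?thesis
    unfolding D_mat_def A_mat_zero diag_part_def dim by (simp add: diag_quot_def[abs_def])
qed

lemma P_mat_eq:
  "P_mat d m a = Matrix.mat (m\<^sup>2) (m\<^sup>2) (\<lambda>(i, j).
     sqrt (diag_quot d m a i) * Theta_mat d m (\<lambda>_. 1) $$ (i, j) * sqrt (diag_quot d m a j))"
proof -
  let ?n = "m\<^sup>2" and ?s = "\<lambda>i. sqrt (diag_quot d m a i)"
  have "diag_sqrt (D_mat d m a) = mat_diag ?n ?s"
    unfolding D_mat_eq diag_sqrt_def by (auto simp: mat_diag_def)
  then have "P_mat d m a = mat_diag ?n ?s * Theta_mat d m (\<lambda>_. 1) * mat_diag ?n ?s"
    by (simp add: P_mat_def A_mat_zero)
  also have "\<dots> = Matrix.mat ?n ?n (\<lambda>(i, j). ?s i * Theta_mat d m (\<lambda>_. 1) $$ (i, j) * ?s j)"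
    unfolding mat_diag_mult_left[OF Theta_carrier]
    by (subst mat_diag_mult_right[of _ ?n ?n]) (auto intro!: eq_matI)
  finally show ?thesis .
qed

lemma Theta_symmetric: "i < m\<^sup>2 \<Longrightarrow> j < m\<^sup>2 \<Longrightarrow> Theta_mat d m a $$ (i, j) = Theta_mat d m a $$ (j, i)"
  by (simp add: Theta_mat_def inner_commute)

lemma P_form:
  "mat_form (m\<^sup>2) (P_mat d m a) x x = dirichlet d m (\<lambda>i. sqrt (diag_quot d m a i) * x i)"
  unfolding Theta_one_form[symmetric] mat_form_def P_mat_eq
  by (intro sum.cong refl) (simp add: mult_ac)

lemma herm_form_of_real_mat:
  assumes "A \<in> carrier_mat n n"
  shows "Re (herm_form n (map_mat complex_of_real A) v)
    = mat_form n A (\<lambda>i. Re (v i)) (\<lambda>i. Re (v i)) + mat_form n A (\<lambda>i. Im (v i)) (\<lambda>i. Im (v i))"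
    and "Im (herm_form n (map_mat complex_of_real A) v)
    = mat_form n A (\<lambda>i. Re (v i)) (\<lambda>i. Im (v i)) - mat_form n A (\<lambda>i. Im (v i)) (\<lambda>i. Re (v i))"
proof -
  have e: "map_mat complex_of_real A $$ (i, j) = complex_of_real (A $$ (i, j))" if "i < n" "j < n" for i j
    using assms that by simp
  show "Re (herm_form n (map_mat complex_of_real A) v)
    = mat_form n A (\<lambda>i. Re (v i)) (\<lambda>i. Re (v i)) + mat_form n A (\<lambda>i. Im (v i)) (\<lambda>i. Im (v i))"
    unfolding herm_form_def mat_form_def Re_sum sum.distrib[symmetric]
    by (intro sum.cong refl) (simp add: e algebra_simps)
  show "Im (herm_form n (map_mat complex_of_real A) v)
    = mat_form n A (\<lambda>i. Re (v i)) (\<lambda>i. Im (v i)) - mat_form n A (\<lambda>i. Im (v i)) (\<lambda>i. Re (v i))"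
    unfolding herm_form_def mat_form_def Im_sum sum_subtractf[symmetric]
    by (intro sum.cong refl) (simp add: e algebra_simps)
qed

lemma Im_mat_entry:
  assumes "A \<in> carrier_mat n n" "i < n" "j < n"
  shows "Im_mat A $$ (i, j) = (complex_of_real (A $$ (i, j)) - complex_of_real (A $$ (j, i))) / (2 * \<i>)"
  using assms by (simp add: Im_mat_def)

lemma Im_mat_hermitian:
  assumes "A \<in> carrier_mat n n"
  shows "hermitian_mat n (Im_mat A)"
proof -
  have "Im_mat A \<in> carrier_mat n n" using assms unfolding Im_mat_def carrier_mat_def by simp
  moreover have "Im_mat A $$ (j, i) = cnj (Im_mat A $$ (i, j))" if "i < n" "j < n" for i j
    unfolding Im_mat_entry[OF assms that] Im_mat_entry[OF assms that(2,1)]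
    unfolding complex_cnj_divide complex_cnj_diff complex_cnj_complex_of_real complex_cnj_mult
      complex_cnj_numeral complex_cnj_i mult_minus_right
    by (metis minus_diff_eq minus_divide_divide)
  ultimately show ?thesis unfolding hermitian_mat_def by blast
qed

text \<open>For a real matrix \<open>A\<close> the form of the transpose is the complex conjugate of the form of \<open>A\<close>.\<close>

lemma herm_form_Im_mat:
  assumes A: "A \<in> carrier_mat n n"
  shows "herm_form n (Im_mat A) v = complex_of_real (Im (herm_form n (map_mat complex_of_real A) v))"
proof -
  let ?H = "herm_form n (map_mat complex_of_real A) v"
  have H: "?H = (\<Sum>i<n. \<Sum>j<n. cnj (v i) * complex_of_real (A $$ (i, j)) * v j)"
    unfolding herm_form_def using A by (intro sum.cong refl) simp
  have "cnj ?H = (\<Sum>i<n. \<Sum>j<n. cnj (v j) * complex_of_real (A $$ (i, j)) * v i)"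
    unfolding H cnj_sum by (intro sum.cong refl) simp
  also have "\<dots> = (\<Sum>i<n. \<Sum>j<n. cnj (v i) * complex_of_real (A $$ (j, i)) * v j)" by (rule sum.swap)
  finally have cH: "cnj ?H = (\<Sum>i<n. \<Sum>j<n. cnj (v i) * complex_of_real (A $$ (j, i)) * v j)" .
  have "?H - cnj ?H = (\<Sum>i<n. \<Sum>j<n. cnj (v i) * (complex_of_real (A $$ (i, j)) - complex_of_real (A $$ (j, i))) * v j)"
    unfolding cH unfolding H sum_subtractf[symmetric] by (simp only: left_diff_distrib right_diff_distrib)
  then have "(?H - cnj ?H) / (2 * \<i>) = herm_form n (Im_mat A) v"
    unfolding herm_form_def sum_divide_distrib
    by (simp only: sum_divide_distrib) (intro sum.cong refl, simp add: Im_mat_entry[OF A])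
  moreover have "(?H - cnj ?H) / (2 * \<i>) = complex_of_real (Im ?H)"
    by (simp add: complex_eq_iff)
  ultimately show ?thesis by simp
qed

lemma herm_form_Im_A_mat:
  "herm_form (m\<^sup>2) (Im_mat (A_mat d m a \<beta>)) v = complex_of_real
     (mat_form (m\<^sup>2) (Psi_mat d m \<beta>) (\<lambda>i. Re (v i)) (\<lambda>i. Im (v i))
      - mat_form (m\<^sup>2) (Psi_mat d m \<beta>) (\<lambda>i. Im (v i)) (\<lambda>i. Re (v i)))"
proof -
  let ?n = "m\<^sup>2" and ?A = "A_mat d m a \<beta>" and ?T = "Theta_mat d m a" and ?P = "Psi_mat d m \<beta>"
  have A: "?A \<in> carrier_mat ?n ?n" using Theta_carrier Psi_carrier by (simp add: A_mat_def)
  have split: "mat_form ?n ?A x y = mat_form ?n ?T x y + mat_form ?n ?P x y" for x y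
    unfolding mat_form_def sum.distrib[symmetric]
    using Theta_carrier[of d m a] Psi_carrier[of d m \<beta>]
    by (intro sum.cong refl) (simp add: A_mat_def algebra_simps)
  have "mat_form ?n ?T x y = mat_form ?n ?T y x" for x y
  proof -
    have "mat_form ?n ?T x y = (\<Sum>j<?n. \<Sum>i<?n. x i * ?T $$ (i, j) * y j)"
      unfolding mat_form_def by (rule sum.swap)
    also have "\<dots> = mat_form ?n ?T y x"
      unfolding mat_form_def
    proof (intro sum.cong refl)
      fix j i assume "j \<in> {..<?n}" "i \<in> {..<?n}"
      then have "?T $$ (i, j) = ?T $$ (j, i)" by (intro Theta_symmetric) auto
      then show "x i * ?T $$ (i, j) * y j = y j * ?T $$ (j, i) * x i" by simp
    qed
    finally show ?thesis .
  qed
  then have sym: "mat_form ?n ?T x y - mat_form ?n ?T y x = 0" for x y by simp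
  show ?thesis
    unfolding herm_form_Im_mat[OF A] herm_form_of_real_mat(2)[OF A] split
    using sym[of "\<lambda>i. Re (v i)" "\<lambda>i. Im (v i)"] by (intro arg_cong[where f=complex_of_real]) linarith
qed

lemma inverse_diff_le:
  fixes p q e :: real
  assumes "0 < e" "e \<le> p" "e \<le> q"
  shows "\<bar>1 / p - 1 / q\<bar> \<le> \<bar>p * p - q * q\<bar> / (2 * (e * e) * e)"
proof -
  have pos: "0 < p" "0 < q" using assms by linarith+
  have den: "2 * (e * e) * e \<le> p * q * (p + q)"
  proof -
    have "(e * e) * (e + e) \<le> (p * q) * (p + q)"
      using assms pos by (intro mult_mono add_mono mult_nonneg_nonneg add_nonneg_nonneg) auto
    then show ?thesis by (simp add: algebra_simps)
  qed
  have dpos: "0 < p * q * (p + q)" by (intro mult_pos_pos add_pos_pos pos)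
  have "1 / p - 1 / q = (q * q - p * p) / (p * q * (p + q))"
  proof (rule eq_divide_imp)
    show "p * q * (p + q) \<noteq> 0" by (rule less_imp_neq[OF dpos, symmetric])
    show "(1 / p - 1 / q) * (p * q * (p + q)) = q * q - p * p"
      using pos by (simp add: left_diff_distrib) (simp add: algebra_simps)
  qed
  then have "\<bar>1 / p - 1 / q\<bar> = \<bar>p * p - q * q\<bar> / (p * q * (p + q))"
    by (simp only: abs_divide abs_of_pos[OF dpos] abs_minus_commute)
  also have "\<dots> \<le> \<bar>p * p - q * q\<bar> / (2 * (e * e) * e)"
  proof (rule divide_left_mono[OF den])
    have "0 < 2 * (e * e) * e" using assms(1) by simp
    then show "0 < p * q * (p + q) * (2 * (e * e) * e)" by (rule mult_pos_pos[OF dpos])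
  qed simp
  finally show ?thesis .
qed

lemma inverse_sqrt_diff_le:
  fixes p q :: real
  assumes "0 < e" "e \<le> p" "e \<le> q"
  shows "\<bar>1 / sqrt p - 1 / sqrt q\<bar> \<le> \<bar>p - q\<bar> / (2 * e * sqrt e)"
proof -
  have "sqrt p * sqrt p = p" "sqrt q * sqrt q = q" "sqrt e * sqrt e = e" using assms by simp_all
  moreover have "0 < sqrt e" "sqrt e \<le> sqrt p" "sqrt e \<le> sqrt q" using assms by simp_all
  ultimately show ?thesis using inverse_diff_le[of "sqrt e" "sqrt p" "sqrt q"] by (simp only:)
qed

lemma continuous_on_closure_Omega_bounded:
  assumes "continuous_on (closure Omega) f"
  shows "bounded_cont d m f" and "\<exists>B\<ge>0. \<forall>x\<in>Omega. norm (f x) \<le> B"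
proof -
  have "compact (f ` closure Omega)"
    by (intro compact_continuous_image assms) (simp add: bounded_Omega)
  then obtain B where B: "\<And>x. x \<in> closure Omega \<Longrightarrow> norm (f x) \<le> B"
    using compact_imp_bounded bounded_iff by (metis imageI)
  then have O: "norm (f x) \<le> max 0 B" if "x \<in> Omega" for x
    using that closure_subset[of Omega] by (simp add: le_max_iff_disj subset_iff del: split_paired_All)
  then show "\<exists>B\<ge>0. \<forall>x\<in>Omega. norm (f x) \<le> B" by (intro exI[of _ "max 0 B"]) simp
  have "continuous_on (mesh_interior d m) f"
    by (rule continuous_on_subset[OF assms order_trans[OF mesh_interior_subset_Omega closure_subset]])
  moreover have "\<forall>x\<in>mesh_interior d m. norm (f x) \<le> max 0 B"
    using O mesh_interior_subset_Omega by blast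
  ultimately show "bounded_cont d m f" unfolding bounded_cont_def by blast
qed

lemma C2_closure_lipschitz:
  fixes a :: "real \<times> real \<Rightarrow> real"
  assumes "C2_closure Omega a"
  obtains L where "L-lipschitz_on Omega a"
proof -
  from assms obtain a' :: "real \<times> real \<Rightarrow> (real \<times> real) \<Rightarrow>\<^sub>L real" where a': "C1_closure Omega a'"
    and der: "\<And>x. x \<in> Omega \<Longrightarrow> (a has_derivative blinfun_apply (a' x)) (at x)"
    unfolding C2_closure_def by blast
  have "continuous_on (closure Omega) a'" using a' unfolding C1_closure_def by blast
  from continuous_on_closure_Omega_bounded(2)[OF this] obtain L where L: "0 \<le> L" "\<And>x. x \<in> Omega \<Longrightarrow> norm (a' x) \<le> L" by blast
  have "convex Omega" unfolding Omega_def by (intro convex_Times convex_real_interval)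
  moreover have "(a has_derivative blinfun_apply (a' x)) (at x within Omega)" if "x \<in> Omega" for x
    using der[OF that] by (rule has_derivative_at_withinI)
  moreover have "onorm (blinfun_apply (a' x)) \<le> L" if "x \<in> Omega" for x
    using L(2)[OF that] by (simp add: norm_blinfun.rep_eq)
  ultimately have "norm (a x - a y) \<le> L * norm (x - y)" if "x \<in> Omega" "y \<in> Omega" for x y
    using differentiable_bound[of Omega a "\<lambda>x. blinfun_apply (a' x)" L x y] that by blast
  then have "L-lipschitz_on Omega a" using L(1) by (intro lipschitz_onI) (simp_all add: dist_norm)
  then show ?thesis by (rule that)
qed

section \<open>The key estimate\<close>

lemma grid_fun_eqI:
  assumes g: "zero_boundary m g" and "\<And>i. i < m\<^sup>2 \<Longrightarrow> g (col_of m i) (row_of m i) = c i"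
  shows "grid_fun m c = g"
proof (intro ext)
  fix k l
  show "grid_fun m c k l = g k l"
  proof (cases "1 \<le> k \<and> k \<le> m \<and> 1 \<le> l \<and> l \<le> m")
    case True
    then obtain i where i: "i < m\<^sup>2" "col_of m i = k" "row_of m i = l" by (metis node_index_surj)
    then show ?thesis using grid_fun_node[OF i(1), of c] assms(2)[OF i(1)] by simp
  next
    case False
    then show ?thesis using g grid_fun_zero_boundary[of m c] by (simp add: zero_boundary_def)
  qed
qed

text \<open>The grid function of \<open>c\<close> is the product of the weights \<open>1 / s\<^sub>i\<close> and the grid function of \<open>s\<^sub>i c\<^sub>i\<close>.  Since
  \<open>s\<^sub>i\<^sup>2\<close> is within \<open>2 L / N\<close> of the value of \<open>a\<close> at the node, the weights of neighbouring nodes differ by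
  \<open>O(1/N)\<close>, and \<open>grid_energy_weighted_le\<close> applies.\<close>

lemma energy_le_scaled_energy:
  assumes a: "bounded_cont d m a" and a0: "0 < a0" "\<forall>x\<in>Omega. a0 \<le> a x"
    and lip: "L-lipschitz_on Omega a"
  shows "grid_energy m (grid_fun m c) \<le> 16 * (2 / a0 + 50 * L\<^sup>2 / a0 ^ 3) *
    dirichlet d m (\<lambda>i. sqrt (diag_quot d m a i) * c i)"
proof -
  let ?q = "diag_quot d m a" and ?N = "real (m + 1)"
  define r where "r = grid_fun m (\<lambda>i. 1 / sqrt (?q i))"
  define w where "w = grid_fun m (\<lambda>i. sqrt (?q i) * c i)"
  define R where "R = 1 / sqrt a0"
  define L' where "L' = 5 * L / (2 * a0 * sqrt a0)"
  have q: "a0 \<le> ?q i" if "i < m\<^sup>2" for i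
    using diag_quot_ge[OF that a] a0(2) mesh_interior_subset_Omega[of d m] by blast
  have c: "grid_fun m c = (\<lambda>k l. r k l * w k l)"
  proof (rule grid_fun_eqI)
    show "zero_boundary m (\<lambda>k l. r k l * w k l)"
      using grid_fun_zero_boundary[of m] by (simp add: zero_boundary_def r_def w_def)
    fix i assume i: "i < m\<^sup>2"
    then have "0 < ?q i" using q[OF i] a0(1) by simp
    then show "r (col_of m i) (row_of m i) * w (col_of m i) (row_of m i) = c i"
      by (simp add: r_def w_def grid_fun_node[OF i])
  qed
  have "grid_energy m (\<lambda>k l. r k l * w k l) \<le> (2 * R\<^sup>2 + 8 * L'\<^sup>2) * grid_energy m w"
  proof (rule grid_energy_weighted_le)
    show "zero_boundary m w" unfolding w_def by (rule grid_fun_zero_boundary)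
    show "\<bar>r k l\<bar> \<le> R" if kl: "1 \<le> k" "k \<le> m" "1 \<le> l" "l \<le> m" for k l
    proof -
      obtain i where i: "i < m\<^sup>2" "col_of m i = k" "row_of m i = l" by (rule node_index_surj[OF kl])
      have "r k l = 1 / sqrt (?q i)" using grid_fun_node[OF i(1)] i by (simp add: r_def)
      then show ?thesis using q[OF i(1)] a0(1) unfolding R_def by (simp add: frac_le)
    qed
    have near: "\<bar>r k' l' - r k l\<bar> \<le> L' / ?N"
      if kl: "1 \<le> k" "k \<le> m" "1 \<le> l" "l \<le> m" and kl': "1 \<le> k'" "k' \<le> m" "1 \<le> l'" "l' \<le> m"
        and adj: "dist (grid_point m k' l') (grid_point m k l) \<le> 1 / ?N" for k l k' l'
    proof -
      obtain i where i: "i < m\<^sup>2" "col_of m i = k" "row_of m i = l" by (rule node_index_surj[OF kl])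
      obtain j where j: "j < m\<^sup>2" "col_of m j = k'" "row_of m j = l'" by (rule node_index_surj[OF kl'])
      have ri: "r k l = 1 / sqrt (?q i)" and rj: "r k' l' = 1 / sqrt (?q j)"
        using grid_fun_node[OF i(1)] grid_fun_node[OF j(1)] i j by (simp_all add: r_def)
      have "\<bar>a (node m j) - a (node m i)\<bar> \<le> L * dist (node m j) (node m i)"
        using lipschitz_onD[OF lip node_in_Omega[OF j(1)] node_in_Omega[OF i(1)]] by (simp add: dist_real_def)
      also have "\<dots> \<le> L * (1 / ?N)" using adj i j lipschitz_on_nonneg[OF lip] by (intro mult_left_mono) (simp_all add: node_eq)
      finally have "\<bar>a (node m j) - a (node m i)\<bar> \<le> L / ?N" by simp
      moreover have "\<bar>?q i - a (node m i)\<bar> \<le> 2 * L / ?N" by (rule diag_quot_near_node[OF i(1) a lip])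
      moreover have "\<bar>?q j - a (node m j)\<bar> \<le> 2 * L / ?N" by (rule diag_quot_near_node[OF j(1) a lip])
      moreover have "5 * L / ?N = L / ?N + 2 * L / ?N + 2 * L / ?N" by (simp add: add_divide_distrib[symmetric])
      ultimately have "\<bar>?q j - ?q i\<bar> \<le> 5 * L / ?N" by linarith
      then have "\<bar>?q j - ?q i\<bar> / (2 * a0 * sqrt a0) \<le> 5 * L / ?N / (2 * a0 * sqrt a0)"
        using a0(1) by (intro divide_right_mono) simp_all
      moreover have "\<bar>r k' l' - r k l\<bar> \<le> \<bar>?q j - ?q i\<bar> / (2 * a0 * sqrt a0)"
        unfolding ri rj by (rule inverse_sqrt_diff_le[OF a0(1) q[OF j(1)] q[OF i(1)]])
      moreover have "5 * L / ?N / (2 * a0 * sqrt a0) = L' / ?N" by (simp add: L'_def mult.commute)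
      ultimately show ?thesis by linarith
    qed
    have d1: "dist (grid_point m (Suc k) l) (grid_point m k l) \<le> 1 / ?N"
      and d2: "dist (grid_point m k (Suc l)) (grid_point m k l) \<le> 1 / ?N" for k l
      by (simp_all add: grid_point_def dist_Pair_Pair dist_real_def add_divide_distrib)
    show "\<bar>r (Suc k) l - r k l\<bar> \<le> L' / ?N" if "1 \<le> k" "k < m" "1 \<le> l" "l \<le> m" for k l
      by (rule near[OF _ _ _ _ _ _ _ _ d1]) (use that in auto)
    show "\<bar>r k (Suc l) - r k l\<bar> \<le> L' / ?N" if "1 \<le> k" "k \<le> m" "1 \<le> l" "l < m" for k l
      by (rule near[OF _ _ _ _ _ _ _ _ d2]) (use that in auto)
  qed
  also have "2 * R\<^sup>2 + 8 * L'\<^sup>2 = 2 / a0 + 50 * L\<^sup>2 / a0 ^ 3"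
    using a0(1) by (simp add: R_def L'_def power_divide power_mult_distrib power3_eq_cube power2_eq_square)
  also have "(2 / a0 + 50 * L\<^sup>2 / a0 ^ 3) * grid_energy m w
      \<le> (2 / a0 + 50 * L\<^sup>2 / a0 ^ 3) * (16 * dirichlet d m (\<lambda>i. sqrt (?q i) * c i))"
    using a0(1) dirichlet_ge[of m "\<lambda>i. sqrt (?q i) * c i" d] unfolding w_def by (intro mult_left_mono) auto
  finally show ?thesis unfolding c by (simp only: mult_ac)
qed

lemma herm_form_P:
  "Re (herm_form (m\<^sup>2) (map_mat complex_of_real (P_mat d m a)) v)
    = dirichlet d m (\<lambda>i. sqrt (diag_quot d m a i) * Re (v i)) + dirichlet d m (\<lambda>i. sqrt (diag_quot d m a i) * Im (v i))"
proof -
  have "P_mat d m a \<in> carrier_mat (m\<^sup>2) (m\<^sup>2)" by (simp add: P_mat_eq)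
  then show ?thesis by (simp only: herm_form_of_real_mat(1) P_form)
qed

lemma dirichlet_nonneg: "0 \<le> dirichlet d m c"
  using dirichlet_ge[of m c d] grid_energy_nonneg[of m "grid_fun m c"] by linarith

lemma P_mat_positive_definite:
  assumes a: "bounded_cont d m a" and a0: "0 < a0" "\<forall>x\<in>Omega. a0 \<le> a x"
  shows "positive_definite_form (m\<^sup>2) (map_mat complex_of_real (P_mat d m a))"
  unfolding positive_definite_form_def herm_form_P
proof (intro allI impI)
  fix v :: "nat \<Rightarrow> complex"
  assume "\<exists>i<m\<^sup>2. v i \<noteq> 0"
  then obtain i where i: "i < m\<^sup>2" "v i \<noteq> 0" by blast
  have "a0 \<le> diag_quot d m a i"
    using diag_quot_ge[OF i(1) a] a0(2) mesh_interior_subset_Omega[of d m] by blast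
  then have s: "sqrt (diag_quot d m a i) \<noteq> 0" using a0(1) by simp
  let ?D = "\<lambda>f. dirichlet d m (\<lambda>i. sqrt (diag_quot d m a i) * f i)"
  have pos: "0 < ?D f" if "f i \<noteq> 0" for f :: "nat \<Rightarrow> real"
    by (rule dirichlet_pos) (use i(1) s that in auto)
  from i(2) have "Re (v i) \<noteq> 0 \<or> Im (v i) \<noteq> 0" by (simp add: complex_eq_iff)
  then show "0 < ?D (\<lambda>i. Re (v i)) + ?D (\<lambda>i. Im (v i))"
    using pos[of "\<lambda>i. Re (v i)"] pos[of "\<lambda>i. Im (v i)"] dirichlet_nonneg add_pos_nonneg add_nonneg_pos by metis
qed

lemma P_mat_hermitian: "hermitian_mat (m\<^sup>2) (map_mat complex_of_real (P_mat d m a))"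
  unfolding hermitian_mat_def P_mat_eq by (auto simp: Theta_symmetric[of _ m _ d] mult_ac)

text \<open>The form of \<open>Im(A)\<close> is \<open>\<psi>(x, y) - \<psi>(y, x)\<close> for the real and imaginary parts \<open>x\<close> and \<open>y\<close> of \<open>v\<close>.
  \<open>Psi_form_bound\<close> with parameter \<open>t\<close> bounds both terms by \<open>t\<close> times the energies of \<open>x\<close> and \<open>y\<close>, and
  these are bounded by the energies of \<open>s x\<close> and \<open>s y\<close>, whose sum is the form of \<open>P\<close>.\<close>

lemma Im_form_bound:
  assumes a: "bounded_cont d m a" and a0: "0 < a0" "\<forall>x\<in>Omega. a0 \<le> a x"
    and lip: "L-lipschitz_on Omega a"
    and \<beta>: "bounded_cont d m \<beta>" and M: "0 \<le> M" "\<forall>x\<in>Omega. norm (\<beta> x) \<le> M"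
    and t: "0 < t"
    and sr: "grid_sumsq m (grid_fun m (\<lambda>i. Re (v i))) \<le> (t * real (m + 1))\<^sup>2 * grid_energy m (grid_fun m (\<lambda>i. Re (v i)))"
    and si: "grid_sumsq m (grid_fun m (\<lambda>i. Im (v i))) \<le> (t * real (m + 1))\<^sup>2 * grid_energy m (grid_fun m (\<lambda>i. Im (v i)))"
  shows "cmod (herm_form (m\<^sup>2) (Im_mat (A_mat d m a \<beta>)) v)
    \<le> 72 * M * (2 / a0 + 50 * L\<^sup>2 / a0 ^ 3) * t * Re (herm_form (m\<^sup>2) (map_mat complex_of_real (P_mat d m a)) v)"
proof -
  let ?N = "real (m + 1)" and ?C = "2 / a0 + 50 * L\<^sup>2 / a0 ^ 3"
  let ?x = "\<lambda>i. Re (v i)" and ?y = "\<lambda>i. Im (v i)"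
  let ?F = "\<lambda>c. grid_energy m (grid_fun m c)"
  let ?D = "\<lambda>f. dirichlet d m (\<lambda>i. sqrt (diag_quot d m a i) * f i)"
  let ?\<psi> = "mat_form (m\<^sup>2) (Psi_mat d m \<beta>)"
  have \<psi>: "\<bar>?\<psi> c e\<bar> \<le> M / 2 * t * (?F c + 8 * ?F e)"
    if "grid_sumsq m (grid_fun m e) \<le> (t * ?N)\<^sup>2 * ?F e" for c e
  proof -
    have "\<bar>?\<psi> c e\<bar> \<le> M / 2 * (t * dirichlet d m c + 8 / (t * ?N\<^sup>2) * grid_sumsq m (grid_fun m e))"
      using M mesh_interior_subset_Omega[of d m] t by (intro Psi_form_bound \<beta>) blast+
    also have "\<dots> \<le> M / 2 * (t * ?F c + 8 / (t * ?N\<^sup>2) * ((t * ?N)\<^sup>2 * ?F e))"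
      using M(1) t that by (intro mult_left_mono add_mono dirichlet_le) auto
    also have "8 / (t * ?N\<^sup>2) * ((t * ?N)\<^sup>2 * ?F e) = t * (8 * ?F e)"
    proof -
      have "8 / (t * N\<^sup>2) * ((t * N)\<^sup>2 * G) = t * (8 * G)" if "0 < N" for N G :: real
        using t that by (simp add: power2_eq_square)
      then show ?thesis by simp
    qed
    finally show ?thesis by (simp add: algebra_simps)
  qed
  have F: "?F c \<le> 16 * ?C * ?D c" for c by (rule energy_le_scaled_energy[OF a a0 lip])
  have "cmod (herm_form (m\<^sup>2) (Im_mat (A_mat d m a \<beta>)) v) = \<bar>?\<psi> ?x ?y - ?\<psi> ?y ?x\<bar>"
    unfolding herm_form_Im_A_mat norm_of_real by simp
  also have "\<dots> \<le> M / 2 * t * (?F ?x + 8 * ?F ?y) + M / 2 * t * (?F ?y + 8 * ?F ?x)"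
    using \<psi>[OF si, of ?x] \<psi>[OF sr, of ?y] by linarith
  also have "\<dots> = 9 / 2 * M * t * (?F ?x + ?F ?y)" by (simp add: algebra_simps)
  also have "\<dots> \<le> 9 / 2 * M * t * (16 * ?C * ?D ?x + 16 * ?C * ?D ?y)"
    using M(1) t by (intro mult_left_mono add_mono F) auto
  also have "\<dots> = 72 * M * ?C * t * (?D ?x + ?D ?y)"
  proof -
    have "9 / 2 * M * t * (16 * C * X + 16 * C * Y) = 72 * M * C * t * (X + Y)" for C X Y :: real
      by (simp add: algebra_simps)
    then show ?thesis .
  qed
  finally show ?thesis unfolding herm_form_P .
qed

section \<open>Boundedness and clustering\<close>

lemma grid_fun_block_sum:
  "(\<Sum>k | k \<le> m \<and> k div b = p. \<Sum>l | l \<le> m \<and> l div b = q. grid_fun m c k l)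
    = (\<Sum>j<m\<^sup>2. of_bool (col_of m j div b = p \<and> row_of m j div b = q) * c j)"
proof -
  let ?I = "{k. k \<le> m \<and> k div b = p}" and ?J = "{l. l \<le> m \<and> l div b = q}"
  have unit: "(\<Sum>k\<in>?I. \<Sum>l\<in>?J. unit_grid m j k l) = of_bool (col_of m j div b = p \<and> row_of m j div b = q)"
    if "j < m\<^sup>2" for j
  proof -
    have "(\<Sum>k\<in>?I. \<Sum>l\<in>?J. unit_grid m j k l)
        = (\<Sum>k\<in>?I. if k = col_of m j then (\<Sum>l\<in>?J. if l = row_of m j then 1 else 0) else 0)"
      unfolding unit_grid_def by (intro sum.cong refl) (auto intro!: sum.cong)
    also have "\<dots> = of_bool (col_of m j div b = p \<and> row_of m j div b = q)"
      using node_index_bounds[OF that] by simp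
    finally show ?thesis .
  qed
  have "(\<Sum>k\<in>?I. \<Sum>l\<in>?J. grid_fun m c k l) = (\<Sum>k\<in>?I. \<Sum>j<m\<^sup>2. \<Sum>l\<in>?J. c j * unit_grid m j k l)"
    unfolding grid_fun_def by (rule sum.cong[OF refl]) (rule sum.swap)
  also have "\<dots> = (\<Sum>j<m\<^sup>2. \<Sum>k\<in>?I. \<Sum>l\<in>?J. c j * unit_grid m j k l)" by (rule sum.swap)
  also have "\<dots> = (\<Sum>j<m\<^sup>2. c j * (\<Sum>k\<in>?I. \<Sum>l\<in>?J. unit_grid m j k l))"
    by (simp only: sum_distrib_left)
  also have "\<dots> = (\<Sum>j<m\<^sup>2. of_bool (col_of m j div b = p \<and> row_of m j div b = q) * c j)"
    by (intro sum.cong refl) (simp add: unit mult.commute)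
  finally show ?thesis .
qed

text \<open>The constants: for \<open>K \<le> m\<close> the blocks have width \<open>b \<le> 2 N / K\<close>, and \<open>2 b\<^sup>2 \<le> 8 N\<^sup>2 / K\<^sup>2\<close>.\<close>

lemma block_width:
  assumes "1 \<le> K" "K \<le> m"
  shows "2 * (real (m div K + 1))\<^sup>2 \<le> (3 / real K * real (m + 1))\<^sup>2"
proof -
  have K: "0 < real K" using assms(1) by simp
  have "real (m div K) \<le> real m / real K" by (rule of_nat_div_le_of_nat)
  moreover have "1 \<le> real m / real K" using assms K by (simp add: pos_le_divide_eq)
  ultimately have "real (m div K + 1) \<le> 2 * (real m / real K)" by simp
  also have "\<dots> \<le> 2 / real K * real (m + 1)" using K by (simp add: field_simps)
  finally have "(real (m div K + 1))\<^sup>2 \<le> (2 / real K * real (m + 1))\<^sup>2" by (intro power_mono) auto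
  moreover have "(3 / real K * real (m + 1))\<^sup>2 = 9 / 4 * (2 / real K * real (m + 1))\<^sup>2"
    by (simp only: power_mult_distrib power_divide) simp
  moreover have "0 \<le> (2 / real K * real (m + 1))\<^sup>2" by simp
  ultimately show ?thesis by linarith
qed

text \<open>The \<open>K\<^sup>2\<close> blocks are numbered by \<open>p = Q K + P\<close>, with \<open>P\<close> the block column and \<open>Q\<close> the block row.\<close>

lemma block_constraints_imp_poincare:
  assumes K: "1 \<le> K" "K \<le> m"
    and zero: "\<And>p. p < K\<^sup>2 \<Longrightarrow> (\<Sum>j<m\<^sup>2. of_bool (col_of m j div (m div K + 1) = p mod K
        \<and> row_of m j div (m div K + 1) = p div K) * c j) = 0"
  shows "grid_sumsq m (grid_fun m c) \<le> (3 / real K * real (m + 1))\<^sup>2 * grid_energy m (grid_fun m c)"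
proof -
  let ?b = "m div K + 1"
  have "grid_sumsq m (grid_fun m c) \<le> 2 * (real ?b)\<^sup>2 * grid_energy m (grid_fun m c)"
  proof (rule block_poincare)
    show "0 < ?b" by simp
    have "m < K * ?b" using K(1) by (simp add: dividend_less_times_div)
    then show "m div ?b < K" by (simp add: less_mult_imp_div_less)
    fix P Q assume PQ: "P < K" "Q < K"
    have "Q * K + P < Suc Q * K" using PQ(1) by simp
    also have "\<dots> \<le> K\<^sup>2" unfolding power2_eq_square using PQ(2) by (intro mult_le_mono1) simp
    finally have "Q * K + P < K\<^sup>2" .
    from zero[OF this] PQ
    show "(\<Sum>k | k \<le> m \<and> k div ?b = P. \<Sum>l | l \<le> m \<and> l div ?b = Q. grid_fun m c k l) = 0"
      unfolding grid_fun_block_sum by simp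
  qed
  also have "\<dots> \<le> (3 / real K * real (m + 1))\<^sup>2 * grid_energy m (grid_fun m c)"
    by (intro mult_right_mono block_width K grid_energy_nonneg)
  finally show ?thesis .
qed

lemma P_mat_times_precond:
  assumes a: "bounded_cont d m a" and a0: "0 < a0" "\<forall>x\<in>Omega. a0 \<le> a x"
  shows "precond_Im_mat d a \<beta> m \<in> carrier_mat (m\<^sup>2) (m\<^sup>2)"
    and "map_mat complex_of_real (P_mat d m a) * precond_Im_mat d a \<beta> m = Im_mat (A_mat d m a \<beta>)"
proof -
  let ?n = "m\<^sup>2" and ?P = "P_mat d m a" and ?B = "Im_mat (A_mat d m a \<beta>)"
  have P: "?P \<in> carrier_mat ?n ?n" by (simp add: P_mat_eq)
  have "A_mat d m a \<beta> \<in> carrier_mat ?n ?n" using Theta_carrier Psi_carrier by (simp add: A_mat_def)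
  from hermitian_matD(1)[OF Im_mat_hermitian[OF this]] have B: "?B \<in> carrier_mat ?n ?n" .
  have inj: "v = 0\<^sub>v ?n" if v: "v \<in> carrier_vec ?n" and Pv: "?P *\<^sub>v v = 0\<^sub>v ?n" for v
  proof (rule ccontr)
    define x where "x i = vec_index v i" for i
    assume "v \<noteq> 0\<^sub>v ?n"
    then have "\<exists>i<?n. x i \<noteq> 0" using v unfolding x_def by (metis eq_vecI index_zero_vec carrier_vecD)
    then obtain i where i: "i < ?n" "x i \<noteq> 0" by blast
    have "herm_form ?n (map_mat complex_of_real ?P) (\<lambda>i. complex_of_real (x i)) =
        (\<Sum>i<?n. complex_of_real (x i) * complex_of_real (vec_index (?P *\<^sub>v v) i))"
      unfolding herm_form_def using P v
      by (intro sum.cong refl) (simp add: x_def scalar_prod_def atLeast0LessThan sum_distrib_left mult.assoc)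
    also have "\<dots> = 0" unfolding Pv by (intro sum.neutral) simp
    finally have "Re (herm_form ?n (map_mat complex_of_real ?P) (\<lambda>i. complex_of_real (x i))) = 0" by simp
    moreover have "0 < Re (herm_form ?n (map_mat complex_of_real ?P) (\<lambda>i. complex_of_real (x i)))"
      by (rule positive_definite_formD[OF P_mat_positive_definite[OF a a0]]) (use i in auto)
    ultimately show False by simp
  qed
  have "Determinant.det ?P \<noteq> 0" unfolding det_0_iff_vec_prod_zero_field[OF P] using inj by blast
  note inv = inv_mat_works[OF P this]
  show "precond_Im_mat d a \<beta> m \<in> carrier_mat ?n ?n"
    unfolding precond_Im_mat_def using inv(1) B by (intro mult_carrier_mat[of _ ?n ?n]) auto
  have "map_mat complex_of_real ?P * precond_Im_mat d a \<beta> m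
      = (map_mat complex_of_real ?P * map_mat complex_of_real (inv_mat ?P)) * ?B"
    unfolding precond_Im_mat_def using P inv(1) B by (intro assoc_mult_mat[symmetric, of _ ?n ?n _ ?n _ ?n]) auto
  also have "map_mat complex_of_real ?P * map_mat complex_of_real (inv_mat ?P) = map_mat complex_of_real (?P * inv_mat ?P)"
    by (rule of_real_hom.mat_hom_mult[OF P inv(1), symmetric])
  also have "\<dots> = 1\<^sub>m ?n" unfolding inv(2) by (rule of_real_hom.mat_hom_one)
  finally show "map_mat complex_of_real ?P * precond_Im_mat d a \<beta> m = ?B" using B by simp
qed

lemma Re_of_bool_times: "Re (of_bool b * z) = of_bool b * Re z"
  and Im_of_bool_times: "Im (of_bool b * z) = of_bool b * Im z"
  by (cases b; simp)+

theorem theorem5p5: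
  fixes d :: diagonal
    and a :: "real \<times> real \<Rightarrow> real" and a0 :: real
    and \<beta> :: "real \<times> real \<Rightarrow> real \<times> real"
    and f :: "real \<times> real \<Rightarrow> real"
  assumes "C2_closure Omega a"
    and "a0 > 0" and "\<And>x. x \<in> closure Omega \<Longrightarrow> a x \<ge> a0"
    and "C1_closure Omega \<beta>"
    and "\<And>x. x \<in> Omega \<Longrightarrow> div_field \<beta> x \<ge> 0"
    and "square_integrable_on f Omega"
  shows "spectrally_bounded (precond_Im_mat d a \<beta>)
    \<and> properly_clustered_at (precond_Im_mat d a \<beta>) 0"
proof -
  have "continuous_on (closure Omega) a" using assms(1) by (simp add: C2_closure_def)
  then have a: "bounded_cont d m a" for m by (rule continuous_on_closure_Omega_bounded(1))
  have "continuous_on (closure Omega) \<beta>" using assms(4) by (simp add: C1_closure_def)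
  note \<beta>' = continuous_on_closure_Omega_bounded[OF this]
  have \<beta>: "bounded_cont d m \<beta>" for m by (rule \<beta>'(1))
  from \<beta>'(2) obtain M where M: "0 \<le> M" "\<forall>x\<in>Omega. norm (\<beta> x) \<le> M" by blast
  obtain L where lip: "L-lipschitz_on Omega a"
    by (rule C2_closure_lipschitz[OF assms(1)])
  have a0: "0 < a0" "\<forall>x\<in>Omega. a0 \<le> a x" using assms(2,3) closure_subset[of Omega] by blast+
  define C where "C = 72 * M * (2 / a0 + 50 * L\<^sup>2 / a0 ^ 3)"
  let ?P = "\<lambda>m. map_mat complex_of_real (P_mat d m a)" and ?B = "\<lambda>m. Im_mat (A_mat d m a \<beta>)"
  note pos = P_mat_positive_definite[OF a a0] and herm = P_mat_hermitian[of m d a for m]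
    and X = P_mat_times_precond[OF a a0]
  have "A_mat d m a \<beta> \<in> carrier_mat (m\<^sup>2) (m\<^sup>2)" for m
    using Theta_carrier Psi_carrier by (simp add: A_mat_def)
  then have hermB: "hermitian_mat (m\<^sup>2) (?B m)" for m by (rule Im_mat_hermitian)
  note bound = Im_form_bound[OF a a0 lip \<beta> M, folded C_def]

  have "spectrally_bounded (precond_Im_mat d a \<beta>)"
    unfolding spectrally_bounded_def
  proof (intro exI[of _ C] allI impI)
    fix m z assume z: "eigenvalue (precond_Im_mat d a \<beta> m) z"
    show "cmod z \<le> C"
    proof (rule eigenvalue_of_pencil_bound[OF hermitian_matD(1)[OF herm] pos X _ z])
      fix v
      have poincare: "grid_sumsq m (grid_fun m c) \<le> (1 * real (m + 1))\<^sup>2 * grid_energy m (grid_fun m c)" for c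
        using grid_poincare[OF grid_fun_zero_boundary, of m c] by simp
      have "cmod (herm_form (m\<^sup>2) (?B m) v) \<le> C * 1 * Re (herm_form (m\<^sup>2) (?P m) v)"
        by (rule bound) (simp, (rule poincare)+)
      then show "cmod (herm_form (m\<^sup>2) (?B m) v) \<le> C * Re (herm_form (m\<^sup>2) (?P m) v)"
        by (simp only: mult_1_right)
    qed
  qed
  moreover have "properly_clustered_at (precond_Im_mat d a \<beta>) 0"
    unfolding properly_clustered_at_def
  proof (intro allI impI)
    fix \<epsilon> :: real assume \<epsilon>: "0 < \<epsilon>"
    obtain K :: nat where K: "max 1 (3 * C / \<epsilon>) < real K" using reals_Archimedean2 by blast
    then have K1: "1 \<le> K" and "3 * C / \<epsilon> < real K" by auto
    then have C\<epsilon>: "C * (3 / real K) < \<epsilon>" using \<epsilon> by (simp add: field_simps)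
    show "\<exists>R. \<forall>m\<ge>1. eigenvalues_outside (precond_Im_mat d a \<beta> m) 0 \<epsilon> \<le> R"
    proof (intro exI[of _ "2 * K\<^sup>2"] allI impI)
      fix m :: nat assume "1 \<le> m"
      show "eigenvalues_outside (precond_Im_mat d a \<beta> m) 0 \<epsilon> \<le> 2 * K\<^sup>2"
      proof (cases "K \<le> m")
        case True
        show ?thesis
        proof (rule eigenvalues_of_pencil_outside_bound[OF herm hermB pos X])
          fix v :: "nat \<Rightarrow> complex"
          assume nz: "\<exists>i<m\<^sup>2. v i \<noteq> 0"
            and zero: "\<And>p. p < K\<^sup>2 \<Longrightarrow> (\<Sum>j<m\<^sup>2. of_bool (col_of m j div (m div K + 1) = p mod K
                \<and> row_of m j div (m div K + 1) = p div K) * v j) = 0"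
          have Re0: "(\<Sum>j<m\<^sup>2. of_bool (col_of m j div (m div K + 1) = p mod K
                \<and> row_of m j div (m div K + 1) = p div K) * Re (v j)) = 0"
            and Im0: "(\<Sum>j<m\<^sup>2. of_bool (col_of m j div (m div K + 1) = p mod K
                \<and> row_of m j div (m div K + 1) = p div K) * Im (v j)) = 0" if "p < K\<^sup>2" for p
            using arg_cong[OF zero[OF that], of Re] arg_cong[OF zero[OF that], of Im]
            by (simp_all add: Re_of_bool_times Im_of_bool_times)
          have "cmod (herm_form (m\<^sup>2) (?B m) v) \<le> C * (3 / real K) * Re (herm_form (m\<^sup>2) (?P m) v)"
            by (rule bound) (use K1 True Re0 Im0 block_constraints_imp_poincare in auto)
          also have "\<dots> < \<epsilon> * Re (herm_form (m\<^sup>2) (?P m) v)"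
            by (intro mult_strict_right_mono C\<epsilon> positive_definite_formD[OF pos nz])
          finally show "cmod (herm_form (m\<^sup>2) (?B m) v) < \<epsilon> * Re (herm_form (m\<^sup>2) (?P m) v)" .
        qed
      next
        case False
        \<comment> \<open>for \<open>m < K\<close> the dimension \<open>m\<^sup>2\<close> is already below \<open>K\<^sup>2\<close>: constrain every entry\<close>
        have "eigenvalues_outside (precond_Im_mat d a \<beta> m) 0 \<epsilon> \<le> 2 * m\<^sup>2"
        proof (rule eigenvalues_of_pencil_outside_bound[OF herm hermB pos X])
          fix v :: "nat \<Rightarrow> complex"
          assume "\<exists>i<m\<^sup>2. v i \<noteq> 0" and zero: "\<And>p. p < m\<^sup>2 \<Longrightarrow> (\<Sum>j<m\<^sup>2. (if j = p then 1 else 0) * v j) = 0"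
          moreover have "(\<Sum>j<m\<^sup>2. (if j = p then 1 else 0) * v j) = v p" if "p < m\<^sup>2" for p
            using that by (simp add: if_distrib[where f="\<lambda>x. x * _"] cong: if_cong)
          ultimately show "cmod (herm_form (m\<^sup>2) (?B m) v) < \<epsilon> * Re (herm_form (m\<^sup>2) (?P m) v)" by auto
        qed
        also have "\<dots> \<le> 2 * K\<^sup>2" using False by (simp add: power_mono)
        finally show ?thesis .
      qed
    qed
  qed
  ultimately show ?thesis ..
qed

end
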